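(* Let $\omega\subset\mathbb{R}^d$ be an open, bounded, smooth domain and let $k\geq1$, $l_0\in(0,1)$ be such that the stage property $\mathrm{(Stage)}$ defined in the context holds for $\omega,k,l_0$ with some given exponents $S,J\geq1$. Let $\beta\in(0,2)$. Then the following holds. For every $v\in\mathcal{C}^2(\bar\omega+\bar B_{2l_0}(0),\mathbb{R}^k)$, $w\in\mathcal{C}^2(\bar\omega+\bar B_{2l_0}(0),\mathbb{R}^d)$ and $A\in\mathcal{C}^{0,\beta}(\bar\omega+\bar B_{2l_0}(0),\mathbb{R}^{d\times d}_{\mathrm{sym}})$ such that $$\mathcal{D}=A-\Big(\frac12(\nabla v)^T\nabla v+\mathrm{sym}\nabla w\Big)\quad\text{satisfies}\quad 0<\|\mathcal{D}\|_0\leq1,$$ and for every $\alpha$ in the range $$0<\alpha<\min\Big\{\frac\beta2,\frac{S}{S+2J}\Big\},$$ there exist $\tilde v\in\mathcal{C}^{1,\alpha}(\bar\omega,\mathbb{R}^k)$ and $\tilde w\in\mathcal{C}^{1,\alpha}(\bar\omega,\mathbb{R}^d)$ with the following properties: $$\|\tilde v-v\|_1\leq C(1+\|\nabla v\|_0)^2\|\mathcal{D}\|_0^{1/4},\qquad \|\tilde w-w\|_1\leq C(1+\|\nabla v\|_0)^3\|\mathcal{D}\|_0^{1/4},$$ $$A-\Big(\frac12(\nabla\tilde v)^T\nabla\tilde v+\mathrm{sym}\nabla\tilde w\Big)=0\quad\text{in }\bar\omega.$$ The norms in the left-hand sides of the first two bounds are taken on $\bar\omega$, and those in the right-hand sides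 on $\bar\omega+\bar B_{2l_0}(0)$. The constants $C$ depend only on $\omega,k,A$ and $\alpha$ (for the given $l_0,S,J$).
   Context: $\mathbb{R}^{d\times d}_{\mathrm{sym}}$ is the space of real symmetric $d\times d$ matrices. $\bar B_r(0)$ is the closed ball of radius $r$ centred at $0$ and $\bar\omega+\bar B_r(0)$ is the Minkowski sum. $(\nabla v)^T\nabla v$ is the $d\times d$ matrix field with entries $\langle\partial_iv,\partial_jv\rangle$; $\mathrm{sym}\nabla w=\frac12(\nabla w+(\nabla w)^T)$. $\|\cdot\|_m$ denotes the $\mathcal{C}^m$ norm ($\|\cdot\|_0$ is the sup norm) and $\|\cdot\|_{m,\beta}$ the Hölder $\mathcal{C}^{m,\beta}$ norm; functions in these spaces on a closed set are restrictions of functions of the same class on $\mathbb{R}^d$. When $\beta\in(1,2)$, $\mathcal{C}^{0,\beta}$ and $\|\cdot\|_{0,\beta}$ are understood as $\mathcal{C}^{1,\beta-1}$ and $\|\cdot\|_{1,\beta-1}$. Property (Stage) for $\omega\subset\mathbb{R}^d$, $k$, $l_0$ with exponents $S,J\ge1$ (no relation between $S$, $J$, $d$ and $k$ is required): for every $l\in(0,l_0)$, every $\beta\in(0,2)$, every $v\in\mathcal{C}^2(\bar\omega+\bar B_{2l}(0),\mathbb{R}^k)$, $w\in\mathcal{C}^2(\bar\omega+\bar B_{2l}(0),\mathbb{R}^d)$, $A\in\mathcal{C}^{0,\beta}(\bar\omega+\bar B_{2l}(0),\mathbb{R}^{d\times d}_{\mathrm{sym}})$, and every $\gamma\in(0,1)$,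 $\lambda>\frac1l$, $M\geq\max\{\|v\|_2,\|w\|_2,1\}$, there exist $\tilde v\in\mathcal{C}^2(\bar\omega+\bar B_l(0),\mathbb{R}^k)$ and $\tilde w\in\mathcal{C}^2(\bar\omega+\bar B_l(0),\mathbb{R}^d)$ such that, with $\mathcal{D}=A-(\frac12(\nabla v)^T\nabla v+\mathrm{sym}\nabla w)$ and $\tilde{\mathcal{D}}=A-(\frac12(\nabla\tilde v)^T\nabla\tilde v+\mathrm{sym}\nabla\tilde w)$, $$\|\tilde v-v\|_1\leq C\lambda^{\gamma/2}\big(\|\mathcal{D}\|_0^{1/2}+lM\big),$$ $$\|\tilde w-w\|_1\leq C\lambda^{\gamma}\big(\|\mathcal{D}\|_0^{1/2}+lM\big)\big(1+\|\mathcal{D}\|_0^{1/2}+lM+\|\nabla v\|_0\big),$$ $$\|\nabla^2\tilde v\|_0\leq C\frac{(\lambda l)^J}{l}\lambda^{\gamma/2}\big(\|\mathcal{D}\|_0^{1/2}+lM\big),$$ $$\|\nabla^2\tilde w\|_0\leq C\frac{(\lambda l)^J}{l}\lambda^{\gamma}\big(\|\mathcal{D}\|_0^{1/2}+lM\big)\big(1+\|\mathcal{D}\|_0^{1/2}+lM+\|\nabla v\|_0\big),$$ $$\|\tilde{\mathcal{D}}\|_0\leq C\Big(l^\beta\|A\|_{0,\beta}+\frac{1}{(\lambda l)^S}\lambda^\gamma\big(\|\mathcal{D}\|_0+(lM)^2\big)\Big),$$ where norms of $v,w,A,\mathcal{D}$ are taken on $\bar\omega+\bar B_{2l}(0)$,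 norms of $\tilde v,\tilde w,\tilde{\mathcal{D}}$ and of the differences $\tilde v-v,\tilde w-w$ on $\bar\omega+\bar B_l(0)$, and the constants $C$ depend only on $\omega,k,\gamma$. *)

theory Defs
  imports "HOL-Analysis.Analysis"
begin

text \<open>
  A function of class \<open>C\<^sup>m\<close> or \<open>C\<^sup>m\<^sup>,\<^sup>\<beta>\<close> on a closed set \<open>T\<close> is the restriction to \<open>T\<close> of a function
  of the same class on the whole space. Throughout, such a function is given by one of these
  global representatives, and every norm, derivative and equation is evaluated on \<open>T\<close> only.
  All sets \<open>T\<close> that occur (the closure of a smooth domain and its closed neighbourhoods) are closures
  of their interiors, so the derivatives on \<open>T\<close> depend only on the restriction to \<open>T\<close>.
\<close>

definition partial :: "'d \<Rightarrow> (real^'d \<Rightarrow> 'b::real_normed_vector) \<Rightarrow> real^'d \<Rightarrow> 'b" where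
  "partial i f x = frechet_derivative f (at x) (axis i 1)"

text \<open>
  The gradient is the tuple of partial derivatives; for vector-valued \<open>f\<close> its \<open>i\<close>-th row is
  \<open>\<partial>\<^sub>i f\<close>, that is, it is the transpose of the Jacobian matrix. Its norm, and that of
  \<open>grad (grad f)\<close>, is the Euclidean (Frobenius) norm of the array of all partial derivatives.
\<close>

definition grad :: "(real^'d \<Rightarrow> 'b::real_normed_vector) \<Rightarrow> real^'d \<Rightarrow> 'b^'d" where
  "grad f x = (\<chi> i. partial i f x)"

primrec C_class :: "nat \<Rightarrow> (real^'d \<Rightarrow> 'b::real_normed_vector) \<Rightarrow> bool" where
  "C_class 0 f \<longleftrightarrow> continuous_on UNIV f"
| "C_class (Suc m) f \<longleftrightarrow> (\<forall>x. f differentiable (at x)) \<and> (\<forall>i. C_class m (partial i f))"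

definition holder :: "real \<Rightarrow> (real^'d \<Rightarrow> 'b::real_normed_vector) \<Rightarrow> bool" where
  "holder \<beta> f \<longleftrightarrow> (\<exists>L. \<forall>x y. norm (f x - f y) \<le> L * dist x y powr \<beta>)"

definition C1_holder :: "real \<Rightarrow> (real^'d \<Rightarrow> 'b::real_normed_vector) \<Rightarrow> bool" where
  "C1_holder \<alpha> f \<longleftrightarrow> C_class 1 f \<and> holder \<alpha> (grad f)"

text \<open>For \<open>1 < \<beta> < 2\<close> the class \<open>C\<^sup>0\<^sup>,\<^sup>\<beta>\<close> is by convention \<open>C\<^sup>1\<^sup>,\<^sup>\<beta>\<^sup>-\<^sup>1\<close>, and likewise for its norm.\<close>

definition C0_holder :: "real \<Rightarrow> (real^'d \<Rightarrow> 'b::real_normed_vector) \<Rightarrow> bool" where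
  "C0_holder \<beta> f \<longleftrightarrow> (if \<beta> \<le> 1 then holder \<beta> f else C1_holder (\<beta> - 1) f)"

definition C0_holder_sym :: "real \<Rightarrow> (real^'d \<Rightarrow> real^'d^'d) \<Rightarrow> bool" where
  "C0_holder_sym \<beta> A \<longleftrightarrow> C0_holder \<beta> A \<and> (\<forall>x. transpose (A x) = A x)"

definition norm0 :: "(real^'d) set \<Rightarrow> (real^'d \<Rightarrow> 'b::real_normed_vector) \<Rightarrow> real" where
  "norm0 T f = (SUP x\<in>T. norm (f x))"

definition norm1 :: "(real^'d) set \<Rightarrow> (real^'d \<Rightarrow> 'b::real_normed_vector) \<Rightarrow> real" where
  "norm1 T f = norm0 T f + norm0 T (grad f)"

definition norm2 :: "(real^'d) set \<Rightarrow> (real^'d \<Rightarrow> 'b::real_normed_vector) \<Rightarrow> real" where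
  "norm2 T f = norm0 T f + norm0 T (grad f) + norm0 T (grad (grad f))"

text \<open>Pairs with equal components contribute \<open>0 / 0 = 0\<close>.\<close>

definition holder_seminorm ::
  "real \<Rightarrow> (real^'d) set \<Rightarrow> (real^'d \<Rightarrow> 'b::real_normed_vector) \<Rightarrow> real" where
  "holder_seminorm \<beta> T f = (SUP (x, y)\<in>T \<times> T. norm (f x - f y) / dist x y powr \<beta>)"

definition norm0_holder ::
  "real \<Rightarrow> (real^'d) set \<Rightarrow> (real^'d \<Rightarrow> 'b::real_normed_vector) \<Rightarrow> real" where
  "norm0_holder \<beta> T f =
    (if \<beta> \<le> 1 then norm0 T f + holder_seminorm \<beta> T f
     else norm1 T f + holder_seminorm (\<beta> - 1) T (grad f))"

text \<open>
  Near each boundary point the domain is, in a suitable direction \<open>e\<close>, the region above the graph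
  of a smooth function of the coordinates orthogonal to \<open>e\<close>; such a function is represented by a
  smooth \<open>g\<close> on the whole space that is constant along \<open>e\<close>.
\<close>

definition smooth_bounded_domain :: "(real^'d) set \<Rightarrow> bool" where
  "smooth_bounded_domain \<omega> \<longleftrightarrow>
    open \<omega> \<and> connected \<omega> \<and> \<omega> \<noteq> {} \<and> bounded \<omega> \<and>
    (\<forall>p\<in>frontier \<omega>. \<exists>r>0. \<exists>e. \<exists>g :: real^'d \<Rightarrow> real.
       norm e = 1 \<and> (\<forall>m. C_class m g) \<and> (\<forall>x t. g (x + t *\<^sub>R e) = g x) \<and>
       \<omega> \<inter> ball p r = {x \<in> ball p r. g x < x \<bullet> e})"

definition nbhd :: "(real^'d) set \<Rightarrow> real \<Rightarrow> (real^'d) set" where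
  "nbhd \<omega> r = {x + y | x y. x \<in> closure \<omega> \<and> y \<in> cball 0 r}"

definition gram :: "(real^'d \<Rightarrow> real^'k) \<Rightarrow> real^'d \<Rightarrow> real^'d^'d" where
  "gram v x = (\<chi> i j. partial i v x \<bullet> partial j v x)"

definition sym_grad :: "(real^'d \<Rightarrow> real^'d) \<Rightarrow> real^'d \<Rightarrow> real^'d^'d" where
  "sym_grad w x = (1/2) *\<^sub>R (grad w x + transpose (grad w x))"

definition defect ::
  "(real^'d \<Rightarrow> real^'d^'d) \<Rightarrow> (real^'d \<Rightarrow> real^'k) \<Rightarrow> (real^'d \<Rightarrow> real^'d) \<Rightarrow> real^'d \<Rightarrow> real^'d^'d"
where
  "defect A v w x = A x - ((1/2) *\<^sub>R gram v x + sym_grad w x)"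

text \<open>
  The codomain dimension \<open>k\<close> is the cardinality of the index type passed as first argument.
  The constant \<open>C\<close> is chosen after \<open>\<gamma>\<close> and before all other data.
\<close>

definition stage ::
  "'k::finite itself \<Rightarrow> (real^'d) set \<Rightarrow> real \<Rightarrow> real \<Rightarrow> real \<Rightarrow> bool" where
  "stage K \<omega> l0 S J \<longleftrightarrow>
    (\<forall>\<gamma>. 0 < \<gamma> \<and> \<gamma> < 1 \<longrightarrow> (\<exists>C>0.
      \<forall>l \<beta> (v :: real^'d \<Rightarrow> real^'k) w A lam M.
        0 < l \<and> l < l0 \<and> 0 < \<beta> \<and> \<beta> < 2 \<and>
        C_class 2 v \<and> C_class 2 w \<and> C0_holder_sym \<beta> A \<and> 1 / l < lam \<and>
        norm2 (nbhd \<omega> (2*l)) v \<le> M \<and> norm2 (nbhd \<omega> (2*l)) w \<le> M \<and> 1 \<le> M \<longrightarrow>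
        (\<exists>(v' :: real^'d \<Rightarrow> real^'k) w'. C_class 2 v' \<and> C_class 2 w' \<and>
          (let T = nbhd \<omega> l; D = norm0 (nbhd \<omega> (2*l)) (defect A v w);
               dv = norm0 (nbhd \<omega> (2*l)) (grad v)
           in norm1 T (\<lambda>x. v' x - v x) \<le> C * lam powr (\<gamma>/2) * (sqrt D + l*M) \<and>
              norm1 T (\<lambda>x. w' x - w x) \<le>
                C * lam powr \<gamma> * (sqrt D + l*M) * (1 + sqrt D + l*M + dv) \<and>
              norm0 T (grad (grad v')) \<le>
                C * ((lam*l) powr J / l) * lam powr (\<gamma>/2) * (sqrt D + l*M) \<and>
              norm0 T (grad (grad w')) \<le>
                C * ((lam*l) powr J / l) * lam powr \<gamma> * (sqrt D + l*M) * (1 + sqrt D + l*M + dv) \<and>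
              norm0 T (defect A v' w') \<le>
                C * (l powr \<beta> * norm0_holder \<beta> (nbhd \<omega> (2*l)) A
                     + 1 / (lam*l) powr S * lam powr \<gamma> * (D + (l*M)\<^sup>2))))))"

end

theory Submission
  imports Defs
begin

text \<open>
  Since (Stage) loses a factor \<open>\<lambda>\<^sup>\<gamma>\<close> with \<open>\<lambda> > 1 / l\<close> while the second derivatives of \<open>v\<close> and \<open>w\<close> are not
  controlled by the data, it cannot be applied directly. First, one classical Kuiper stage is carried out
  by hand: \<open>v\<close> is corrugated successively in finitely many directions, at a fixed power of \<open>n\<close> as
  frequencies and with amplitudes given by Bernstein polynomials. It changes \<open>v\<close> and \<open>w\<close> by
  \<open>O(\<parallel>\<D>\<parallel>\<^sub>0\<^sup>1\<^sup>/\<^sup>2)\<close> in \<open>C\<^sup>1\<close> with no loss, and leaves a defect \<open>O(n powr (- s))\<close> with second derivatives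
  \<open>O(n ^ q)\<close>. From there (Stage) is iterated with \<open>M\<^sub>i = M\<^sub>0 powr (b ^ i)\<close>, \<open>l\<^sub>i = M\<^sub>i powr (- 1 - \<rho>\<^sub>i)\<close>, defect
  at most \<open>M\<^sub>i powr (- 2 * \<rho>\<^sub>i)\<close> and \<open>\<gamma>\<close> tiny, where \<open>\<rho>\<^sub>i\<close> increases from a small multiple of \<open>s / q\<close> to a
  limit \<open>r\<close> with \<open>\<alpha> < r / (1 + r) < min (\<beta> / 2) (S / (S + 2 * J))\<close>. The increments are summable in
  \<open>C\<^sup>1\<^sup>,\<^sup>\<alpha>\<close> of the closure of the domain, and their \<open>C\<^sup>1\<close> norms add up to as little as desired when \<open>n\<close> is
  large. They are extended to the whole space by reflection across the boundary and then summed.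
\<close>

section \<open>Partial derivatives and norms\<close>

text \<open>The exponents come from one balance. When second derivatives have size \<open>M\<close>,
  the scale \<open>l = M powr (- 1 - \<rho>)\<close> makes \<open>l * M\<close> equal to
  \<open>M powr (- \<rho>)\<close>, the square root of the defect. With
  \<open>lam * l = M powr p\<close>, and up to the loss, (Stage) raises the second derivatives to
  \<open>M powr (1 + p * J)\<close> and lowers the defect to
  \<open>M powr (- 2 * \<rho> - p * S)\<close>. The ratio \<rho> thus moves to
  \<open>(\<rho> + p * S / 2) / (1 + p * J)\<close>, whose fixed point is
  \<open>S / (2 * J)\<close>; the term \<open>l powr \<beta>\<close> caps
  \<open>\<rho> / (1 + \<rho>)\<close> by \<open>\<beta> / 2\<close>. Interpolation between
  increments \<open>M powr (- \<rho>)\<close> and second derivatives close to \<open>M\<close>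
  yields Hoelder exponents below \<open>\<rho> / (1 + \<rho>)\<close>, which is
  \<open>S / (S + 2 * J)\<close> at the fixed point. Only the limiting ratio decides the regularity,
  so a tiny initial ratio is harmless. That initial ratio depends on \<open>v\<close> and
  \<open>w\<close>, hence so do \<gamma> and the constant of (Stage) for it. This constant never
  reaches the final estimate: it is absorbed by taking \<open>M\<close> large, and the constant of
  the theorem stems from the first stage alone.\<close>

lemma bounded_linear_axis: "bounded_linear (axis j :: 'b::real_normed_vector \<Rightarrow> 'b^'m)"
proof (rule bounded_linear_intro[where K=1])
  show "norm (axis j x :: 'b^'m) \<le> norm x * 1" for x
  proof -
    have "norm (axis j x :: 'b^'m) \<le> (\<Sum>i\<in>UNIV. norm ((axis j x :: 'b^'m) $ i))"
      unfolding norm_vec_def by (rule L2_set_le_sum) simp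
    also have "\<dots> = (\<Sum>i\<in>UNIV. if i = j then norm x else 0)"
      by (rule sum.cong) (auto simp: axis_def)
    finally show ?thesis by simp
  qed
qed (auto simp: axis_def vec_eq_iff)

lemma vec_lambda_sum_axis: "(\<chi> j. f j) = (\<Sum>j\<in>UNIV. axis j (f j) :: 'b::real_normed_vector^'m)"
  by (simp add: vec_eq_iff axis_def sum.delta if_distrib cong: if_cong)

lemma has_derivative_vec_lambda:
  fixes F :: "'m::finite \<Rightarrow> 'a::real_normed_vector \<Rightarrow> 'b::real_normed_vector"
  assumes "\<And>j. (F j has_derivative F' j) (at x)"
  shows "((\<lambda>x. \<chi> j. F j x) has_derivative (\<lambda>h. \<chi> j. F' j h)) (at x)"
  unfolding vec_lambda_sum_axis
  by (intro has_derivative_sum bounded_linear.has_derivative[OF bounded_linear_axis] assms)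

lemma norm_vec_le_sum: "norm (x :: 'b::real_normed_vector^'m) \<le> (\<Sum>i\<in>UNIV. norm (x $ i))"
  unfolding norm_vec_def by (rule L2_set_le_sum) simp

lemma norm_vec_le_card:
  assumes "\<And>i. norm ((x :: 'b::real_normed_vector^'m) $ i) \<le> c"
  shows "norm x \<le> real CARD('m) * c"
proof -
  have "norm x \<le> (\<Sum>i\<in>UNIV. norm (x $ i))" by (rule norm_vec_le_sum)
  also have "\<dots> \<le> (\<Sum>i\<in>(UNIV::'m set). c)" by (intro sum_mono assms)
  finally show ?thesis by simp
qed

lemma partial_eq:
  "(f has_derivative D) (at x) \<Longrightarrow> partial i f x = D (axis i 1)"
  unfolding partial_def using frechet_derivative_at by metis

lemma has_derivative_partial:
  assumes "f differentiable (at x)"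
  shows "(f has_derivative (\<lambda>h. \<Sum>i\<in>UNIV. (h $ i) *\<^sub>R partial i f x)) (at x)"
proof -
  let ?D = "frechet_derivative f (at x)"
  have D: "(f has_derivative ?D) (at x)" using assms by (simp add: frechet_derivative_works)
  interpret bounded_linear ?D using D by (rule has_derivative_bounded_linear)
  have "?D h = (\<Sum>i\<in>UNIV. (h $ i) *\<^sub>R partial i f x)" for h
  proof -
    have "?D h = ?D (\<Sum>i\<in>UNIV. (h $ i) *\<^sub>R axis i 1)"
      using basis_expansion[of h] by (simp add: scalar_mult_eq_scaleR)
    then show ?thesis by (simp add: sum scale partial_def)
  qed
  then have "?D = (\<lambda>h. \<Sum>i\<in>UNIV. (h $ i) *\<^sub>R partial i f x)" by blast
  with D show ?thesis by simp
qed

lemma norm_sum_scaleR_le: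
  "norm (\<Sum>i\<in>UNIV. (h $ i) *\<^sub>R (p $ i)) \<le> norm p * norm (h :: real^'d)"
proof -
  have "norm (\<Sum>i\<in>UNIV. (h $ i) *\<^sub>R (p $ i)) \<le> (\<Sum>i\<in>UNIV. \<bar>h $ i\<bar> * \<bar>norm (p $ i)\<bar>)"
    by (rule order_trans[OF norm_sum]) simp
  also have "\<dots> \<le> norm h * norm p"
    unfolding norm_vec_def using L2_set_mult_ineq[of "\<lambda>i. norm (h $ i)" "\<lambda>i. norm (p $ i)" UNIV] by simp
  finally show ?thesis by (simp add: mult.commute)
qed

text \<open>The mean value inequality. By Cauchy-Schwarz the Euclidean norm of the array of partial
  derivatives dominates the operator norm of the derivative, so \<open>B\<close> serves unchanged as
  Lipschitz constant.\<close>

lemma convex_grad_bound: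
  fixes f :: "real^'d \<Rightarrow> 'b::real_normed_vector"
  assumes "convex X" "\<And>x. f differentiable (at x)" "\<And>x. x \<in> X \<Longrightarrow> norm (grad f x) \<le> B"
    and "x \<in> X" "y \<in> X"
  shows "norm (f x - f y) \<le> B * dist x y"
proof -
  have "norm (f x - f y) \<le> B * norm (x - y)"
  proof (rule differentiable_bound[OF assms(1) _ _ assms(4,5)])
    fix z assume z: "z \<in> X"
    show "(f has_derivative (\<lambda>h. \<Sum>i\<in>UNIV. (h $ i) *\<^sub>R partial i f z)) (at z within X)"
      using has_derivative_partial[OF assms(2)] has_derivative_at_withinI by blast
    have "norm (\<Sum>i\<in>UNIV. (h $ i) *\<^sub>R partial i f z) \<le> B * norm h" for h
      using norm_sum_scaleR_le[of h "grad f z"] mult_right_mono[OF assms(3)[OF z], of "norm h"]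
      by (simp add: grad_def)
    then show "onorm (\<lambda>h. \<Sum>i\<in>UNIV. (h $ i) *\<^sub>R partial i f z) \<le> B" by (rule onorm_le)
  qed
  then show ?thesis by (simp add: dist_norm)
qed

lemma partial_add:
  "f differentiable (at x) \<Longrightarrow> g differentiable (at x) \<Longrightarrow>
    partial i (\<lambda>x. f x + g x) x = partial i f x + partial i g x"
  unfolding partial_def frechet_derivative_works
  by (rule partial_eq[unfolded partial_def, OF has_derivative_add])

lemma partial_diff:
  "f differentiable (at x) \<Longrightarrow> g differentiable (at x) \<Longrightarrow>
    partial i (\<lambda>x. f x - g x) x = partial i f x - partial i g x"
  unfolding partial_def frechet_derivative_works
  by (rule partial_eq[unfolded partial_def, OF has_derivative_diff])

lemma partial_vec:
  fixes F :: "'m::finite \<Rightarrow> real^'d \<Rightarrow> 'b::real_normed_vector"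
  assumes "\<And>j. F j differentiable (at x)"
  shows "(\<lambda>x. \<chi> j. F j x) differentiable (at x)"
    and "partial i (\<lambda>x. \<chi> j. F j x) x = (\<chi> j. partial i (F j) x)"
proof -
  have *: "((\<lambda>x. \<chi> j. F j x) has_derivative (\<lambda>h. \<chi> j. frechet_derivative (F j) (at x) h)) (at x)"
    by (rule has_derivative_vec_lambda) (simp add: assms flip: frechet_derivative_works)
  show "(\<lambda>x. \<chi> j. F j x) differentiable (at x)" using * by (rule differentiableI)
  show "partial i (\<lambda>x. \<chi> j. F j x) x = (\<chi> j. partial i (F j) x)"
    unfolding partial_eq[OF *] by (simp add: partial_def)
qed

section \<open>Closure properties of the differentiability classes\<close>

lemma C_class_Suc_imp: "C_class (Suc m) f \<Longrightarrow> C_class m f"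
proof (induction m arbitrary: f)
  case 0
  then show ?case
    by (simp add: differentiable_imp_continuous_on differentiable_on_def differentiable_at_withinI)
qed auto

lemma C_class_continuous: "C_class m f \<Longrightarrow> continuous_on UNIV f"
  by (induction m) (use C_class_Suc_imp in force)+

lemma C_class_differentiable: "C_class (Suc m) f \<Longrightarrow> f differentiable (at x)"
  by simp

lemma C_class_add: "C_class m f \<Longrightarrow> C_class m g \<Longrightarrow> C_class m (\<lambda>x. f x + g x)"
proof (induction m arbitrary: f g)
  case (Suc m)
  then have "partial i (\<lambda>x. f x + g x) = (\<lambda>x. partial i f x + partial i g x)" for i
    by (simp add: fun_eq_iff partial_add)
  with Suc show ?case by simp
qed (auto intro: continuous_intros)

lemma C_class_diff: "C_class m f \<Longrightarrow> C_class m g \<Longrightarrow> C_class m (\<lambda>x. f x - g x)"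
proof (induction m arbitrary: f g)
  case (Suc m)
  then have "partial i (\<lambda>x. f x - g x) = (\<lambda>x. partial i f x - partial i g x)" for i
    by (simp add: fun_eq_iff partial_diff)
  with Suc show ?case by simp
qed (auto intro: continuous_intros)

lemma C_class_vec:
  fixes F :: "'m::finite \<Rightarrow> real^'d \<Rightarrow> 'b::real_normed_vector"
  shows "(\<And>j. C_class m (F j)) \<Longrightarrow> C_class m (\<lambda>x. \<chi> j. F j x)"
proof (induction m arbitrary: F)
  case (Suc m)
  then have "partial i (\<lambda>x. \<chi> j. F j x) = (\<lambda>x. \<chi> j. partial i (F j) x)" for i
    by (simp add: fun_eq_iff partial_vec)
  with Suc show ?case by (simp add: partial_vec)
qed (auto intro!: continuous_intros)

lemma C_class_grad: "C_class (Suc m) f \<Longrightarrow> C_class m (grad f)"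
  unfolding grad_def[abs_def] by (rule C_class_vec) simp

lemma grad_add:
  "f differentiable (at x) \<Longrightarrow> g differentiable (at x) \<Longrightarrow> grad (\<lambda>x. f x + g x) x = grad f x + grad g x"
  by (simp add: grad_def vec_eq_iff partial_add)

lemma grad_diff:
  "f differentiable (at x) \<Longrightarrow> g differentiable (at x) \<Longrightarrow> grad (\<lambda>x. f x - g x) x = grad f x - grad g x"
  by (simp add: grad_def vec_eq_iff partial_diff)

lemma C_class_2D:
  assumes "C_class 2 f"
  shows "f differentiable (at x)" "grad f differentiable (at x)"
    "continuous_on T f" "continuous_on T (grad f)" "continuous_on T (grad (grad f))"
proof -
  have 2: "C_class (Suc (Suc 0)) f" using assms by (simp add: numeral_2_eq_2)
  show "f differentiable (at x)" using 2 by simp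
  have 1: "C_class (Suc 0) (grad f)" using 2 by (rule C_class_grad)
  then show "grad f differentiable (at x)" by simp
  show "continuous_on T f" "continuous_on T (grad f)" "continuous_on T (grad (grad f))"
    using C_class_continuous[OF 2] C_class_continuous[OF 1] C_class_continuous[OF C_class_grad[OF 1]]
      continuous_on_subset by blast+
qed

text \<open>The supremum of an unbounded set of reals is an unspecified number; compactness and
  continuity are what make the set bounded.\<close>

lemma norm0_ge:
  assumes "compact T" "continuous_on T f" "x \<in> T"
  shows "norm (f x) \<le> norm0 T f"
proof -
  have "compact ((\<lambda>x. norm (f x)) ` T)"
    by (intro compact_continuous_image continuous_intros assms)
  then have "bdd_above ((\<lambda>x. norm (f x)) ` T)" by (simp add: compact_imp_bounded bounded_imp_bdd_above)
  then show ?thesis unfolding norm0_def using assms(3) by (rule cSUP_upper2) auto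
qed

lemma norm0_le: "T \<noteq> {} \<Longrightarrow> (\<And>x. x \<in> T \<Longrightarrow> norm (f x) \<le> c) \<Longrightarrow> norm0 T f \<le> c"
  unfolding norm0_def by (rule cSUP_least)

lemma norm0_nonneg: "compact T \<Longrightarrow> T \<noteq> {} \<Longrightarrow> continuous_on T f \<Longrightarrow> 0 \<le> norm0 T f"
  using norm0_ge norm_ge_zero order_trans by blast

lemma norm2_ge:
  assumes "compact T" "C_class 2 f" "x \<in> T"
  shows "norm (f x) \<le> norm2 T f" "norm (grad f x) \<le> norm2 T f" "norm (grad (grad f) x) \<le> norm2 T f"
proof -
  have T: "T \<noteq> {}" using assms(3) by auto
  note c = C_class_2D[OF assms(2)]
  note n = norm0_nonneg[OF assms(1) T c(3)] norm0_nonneg[OF assms(1) T c(4)] norm0_nonneg[OF assms(1) T c(5)]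
  show "norm (f x) \<le> norm2 T f" "norm (grad f x) \<le> norm2 T f" "norm (grad (grad f) x) \<le> norm2 T f"
    using norm0_ge[OF assms(1) c(3) assms(3)] norm0_ge[OF assms(1) c(4) assms(3)]
      norm0_ge[OF assms(1) c(5) assms(3)] n by (auto simp: norm2_def)
qed

lemma norm2_le:
  assumes "T \<noteq> {}" "\<And>x. x \<in> T \<Longrightarrow> norm (f x) \<le> a" "\<And>x. x \<in> T \<Longrightarrow> norm (grad f x) \<le> b"
    "\<And>x. x \<in> T \<Longrightarrow> norm (grad (grad f) x) \<le> c"
  shows "norm2 T f \<le> a + b + c"
  unfolding norm2_def by (intro add_mono norm0_le assms)

lemma norm1_le:
  assumes "T \<noteq> {}" "\<And>x. x \<in> T \<Longrightarrow> norm (f x) \<le> a" "\<And>x. x \<in> T \<Longrightarrow> norm (grad f x) \<le> b"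
  shows "norm1 T f \<le> a + b"
  unfolding norm1_def by (intro add_mono norm0_le assms)

lemma norm1_ge:
  assumes "compact T" "C_class 2 f" "x \<in> T"
  shows "norm (f x) \<le> norm1 T f" "norm (grad f x) \<le> norm1 T f"
proof -
  have T: "T \<noteq> {}" using assms(3) by auto
  note c = C_class_2D[OF assms(2)]
  note n = norm0_nonneg[OF assms(1) T c(3)] norm0_nonneg[OF assms(1) T c(4)]
  show "norm (f x) \<le> norm1 T f" "norm (grad f x) \<le> norm1 T f" 
    using norm0_ge[OF assms(1) c(3) assms(3)] norm0_ge[OF assms(1) c(4) assms(3)] n
    by (auto simp: norm1_def)
qed

section \<open>Closed neighbourhoods of the domain and continuity of the defect\<close>

lemma compact_nbhd: "bounded \<omega> \<Longrightarrow> compact (nbhd \<omega> r)"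
  unfolding nbhd_def by (rule compact_sums) (auto simp: compact_closure)

lemma nbhd_mono: "r \<le> s \<Longrightarrow> nbhd \<omega> r \<subseteq> nbhd \<omega> s"
  unfolding nbhd_def by force

lemma nbhdI: "x \<in> closure \<omega> \<Longrightarrow> dist x y \<le> r \<Longrightarrow> y \<in> nbhd \<omega> r"
  unfolding nbhd_def
  by (intro CollectI exI[of _ x] exI[of _ "y - x"]) (simp add: dist_norm norm_minus_commute)

lemma closure_subset_nbhd: "0 \<le> r \<Longrightarrow> closure \<omega> \<subseteq> nbhd \<omega> r"
  by (auto intro: nbhdI)

lemma sym_grad_nth: "sym_grad w x $ i $ j = (partial i w x $ j + partial j w x $ i) / 2"
  by (simp add: sym_grad_def grad_def transpose_def)

lemma continuous_on_partial: "C_class 2 f \<Longrightarrow> continuous_on T (partial i f)"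
  using continuous_on_component[OF C_class_2D(4), of f T i] by (simp add: grad_def)

lemma continuous_on_defect:
  assumes "continuous_on T A" "C_class 2 v" "C_class 2 w"
  shows "continuous_on T (defect A v w)"
proof -
  have "defect A v w = (\<lambda>x. A x - (\<chi> i j. (partial i v x \<bullet> partial j v x) / 2
      + (partial i w x $ j + partial j w x $ i) / 2))"
    by (simp add: fun_eq_iff defect_def vec_eq_iff sym_grad_nth gram_def)
  then show ?thesis
    by (auto intro!: continuous_intros continuous_on_partial assms)
qed

section \<open>Extension from a smooth domain\<close>

text \<open>An inequality rather than a norm, so that no supremum has to be shown finite. One
  constant for size and oscillation turns sums, products and compositions into a calculus of
  constants on arbitrary sets.\<close>

definition holder_bounded ::
  "real \<Rightarrow> 'a::metric_space set \<Rightarrow> ('a \<Rightarrow> 'b::real_normed_vector) \<Rightarrow> real \<Rightarrow> bool" where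
  "holder_bounded \<alpha> X f c \<longleftrightarrow>
    (\<forall>x\<in>X. norm (f x) \<le> c) \<and> (\<forall>x\<in>X. \<forall>y\<in>X. norm (f x - f y) \<le> c * dist x y powr \<alpha>)"

text \<open>The gradient is carried as a function of its own, so that Hoelder bounds for it can be
  glued and summed alongside those of the function; its continuity comes afterwards from these
  bounds. Derivatives are taken in the whole space, not within \<open>X\<close>.\<close>

definition has_gradient :: "('a::real_inner \<Rightarrow> real) \<Rightarrow> ('a \<Rightarrow> 'a) \<Rightarrow> 'a set \<Rightarrow> bool" where
  "has_gradient u G X \<longleftrightarrow> (\<forall>x\<in>X. (u has_derivative (\<lambda>h. G x \<bullet> h)) (at x))"

section \<open>Calculus of Hoelder bounds\<close>

lemma holder_imp_continuous:
  fixes f :: "'a::real_normed_vector \<Rightarrow> 'b::real_normed_vector"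
  assumes "0 < \<alpha>" "\<And>x y. norm (f x - f y) \<le> L * dist x y powr \<alpha>"
  shows "continuous_on UNIV f"
  unfolding continuous_on_def
proof
  fix x :: 'a
  have "((\<lambda>y. L * dist y x powr \<alpha>) \<longlongrightarrow> L * dist x x powr \<alpha>) (at x)"
    using assms(1) by (intro tendsto_intros) auto
  then have "((\<lambda>y. L * dist y x powr \<alpha>) \<longlongrightarrow> 0) (at x)" by simp
  then have "((\<lambda>y. f y - f x) \<longlongrightarrow> 0) (at x)"
    by (rule Lim_null_comparison[rotated]) (simp add: assms(2))
  then show "(f \<longlongrightarrow> f x) (at x within UNIV)" by (simp add: LIM_zero_iff)
qed

lemma holder_bounded_subset:
  "holder_bounded \<alpha> X f c \<Longrightarrow> Y \<subseteq> X \<Longrightarrow> holder_bounded \<alpha> Y f c"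
  unfolding holder_bounded_def by blast

lemma holder_bounded_mono:
  "holder_bounded \<alpha> X f c \<Longrightarrow> c \<le> c' \<Longrightarrow> holder_bounded \<alpha> X f c'"
  unfolding holder_bounded_def by (meson mult_right_mono order_trans powr_ge_zero)

lemma holder_bounded_cong:
  "holder_bounded \<alpha> X f c \<Longrightarrow> (\<And>x. x \<in> X \<Longrightarrow> g x = f x) \<Longrightarrow> holder_bounded \<alpha> X g c"
  unfolding holder_bounded_def by simp

lemma holder_bounded_nonneg: "holder_bounded \<alpha> X f c \<Longrightarrow> X \<noteq> {} \<Longrightarrow> 0 \<le> c"
  unfolding holder_bounded_def by (meson all_not_in_conv norm_ge_zero order_trans)

lemma holder_bounded_add:
  assumes "holder_bounded \<alpha> X f c" "holder_bounded \<alpha> X g d"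
  shows "holder_bounded \<alpha> X (\<lambda>x. f x + g x) (c + d)"
proof -
  have "norm (f x + g x - (f y + g y)) \<le> (c + d) * dist x y powr \<alpha>" if "x \<in> X" "y \<in> X" for x y
  proof -
    have "norm (f x + g x - (f y + g y)) \<le> norm (f x - f y) + norm (g x - g y)"
      by (metis add_diff_add norm_triangle_ineq)
    with assms that show ?thesis unfolding holder_bounded_def by (fastforce simp: distrib_right)
  qed
  moreover have "norm (f x + g x) \<le> c + d" if "x \<in> X" for x
    using assms that unfolding holder_bounded_def by (fastforce intro: norm_triangle_le add_mono)
  ultimately show ?thesis unfolding holder_bounded_def by blast
qed

text \<open>The difference splits as \<open>P (f x - f y) (g x) + P (f y) (g x - g y)\<close>,
  whence the factor 2.\<close>

lemma holder_bounded_bilinear: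
  assumes "bounded_bilinear P" "\<And>a b. norm (P a b) \<le> norm a * norm b"
    and f: "holder_bounded \<alpha> X f c" and g: "holder_bounded \<alpha> X g d"
  shows "holder_bounded \<alpha> X (\<lambda>x. P (f x) (g x)) (2 * c * d)"
proof (cases "X = {}")
  case False
  interpret bounded_bilinear P by fact
  have c: "0 \<le> c" and d: "0 \<le> d"
    using holder_bounded_nonneg False f g by blast+
  have "norm (P (f x) (g x) - P (f y) (g y)) \<le> 2 * c * d * dist x y powr \<alpha>"
    if "x \<in> X" "y \<in> X" for x y
  proof -
    have "P (f x) (g x) - P (f y) (g y) = P (f x - f y) (g x) + P (f y) (g x - g y)"
      by (simp add: diff_left diff_right)
    then have "norm (P (f x) (g x) - P (f y) (g y))
        \<le> norm (f x - f y) * norm (g x) + norm (f y) * norm (g x - g y)"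
      using norm_triangle_ineq assms(2) by (smt (verit, ccfv_SIG))
    also have "\<dots> \<le> (c * dist x y powr \<alpha>) * d + c * (d * dist x y powr \<alpha>)"
      using f g that c d unfolding holder_bounded_def
      by (intro add_mono mult_mono) auto
    finally show ?thesis by (simp add: algebra_simps)
  qed
  moreover have "norm (P (f x) (g x)) \<le> 2 * c * d" if "x \<in> X" for x
  proof -
    have "norm (P (f x) (g x)) \<le> norm (f x) * norm (g x)" by fact
    also have "\<dots> \<le> c * d"
      using f g that c d unfolding holder_bounded_def by (intro mult_mono) auto
    also have "\<dots> \<le> 2 * c * d" using c d by simp
    finally show ?thesis .
  qed
  ultimately show ?thesis unfolding holder_bounded_def by blast
qed (simp add: holder_bounded_def)

lemmas holder_bounded_scaleR =
  holder_bounded_bilinear[OF bounded_bilinear_scaleR, simplified]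
lemmas holder_bounded_inner =
  holder_bounded_bilinear[OF bounded_bilinear_inner, simplified, OF Cauchy_Schwarz_ineq2]
lemmas holder_bounded_mult =
  holder_bounded_bilinear[OF bounded_bilinear_mult norm_mult_ineq]

lemma holder_bounded_cmult:
  assumes "holder_bounded \<alpha> X f c"
  shows "holder_bounded \<alpha> X (\<lambda>x. a *\<^sub>R f x) (\<bar>a\<bar> * c)"
proof -
  have "norm (a *\<^sub>R f x - a *\<^sub>R f y) = \<bar>a\<bar> * norm (f x - f y)" for x y
    by (metis norm_scaleR scaleR_diff_right)
  then show ?thesis using assms unfolding holder_bounded_def
    by (auto simp: mult.assoc intro!: mult_left_mono)
qed

lemma holder_bounded_diff:
  assumes "holder_bounded \<alpha> X f c" "holder_bounded \<alpha> X g d"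
  shows "holder_bounded \<alpha> X (\<lambda>x. f x - g x) (c + d)"
  using holder_bounded_add[OF assms(1) holder_bounded_cmult[OF assms(2), of "-1"]] by simp

lemma holder_bounded_max0:
  fixes f :: "_ \<Rightarrow> real"
  assumes "holder_bounded \<alpha> X f c"
  shows "holder_bounded \<alpha> X (\<lambda>x. max 0 (f x)) c"
proof -
  have "\<bar>max 0 a - max 0 b\<bar> \<le> \<bar>a - b\<bar>" "\<bar>max 0 a\<bar> \<le> \<bar>a\<bar>" for a b :: real by auto
  then show ?thesis using assms unfolding holder_bounded_def real_norm_def by (meson order_trans)
qed

lemma le_powr_unit: "0 \<le> d \<Longrightarrow> d \<le> 1 \<Longrightarrow> \<alpha> \<le> 1 \<Longrightarrow> d \<le> d powr (\<alpha>::real)"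
  by (cases "d = 0") (use powr_mono'[of \<alpha> 1 d] in auto)

lemma holder_bounded_lipschitz:
  assumes "\<alpha> \<le> 1" "0 \<le> L" "\<And>x y. x \<in> X \<Longrightarrow> y \<in> X \<Longrightarrow> dist x y \<le> 1"
    "\<And>x. x \<in> X \<Longrightarrow> norm (f x) \<le> L" "\<And>x y. x \<in> X \<Longrightarrow> y \<in> X \<Longrightarrow> norm (f x - f y) \<le> L * dist x y"
  shows "holder_bounded \<alpha> X f L"
proof -
  have "norm (f x - f y) \<le> L * dist x y powr \<alpha>" if "x \<in> X" "y \<in> X" for x y
    using assms(5)[OF that] mult_left_mono[OF le_powr_unit[OF _ assms(3)[OF that] assms(1)] assms(2)]
    by simp
  with assms(4) show ?thesis unfolding holder_bounded_def by blast
qed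

lemma holder_bounded_const: "norm a \<le> c \<Longrightarrow> holder_bounded \<alpha> X (\<lambda>_. a) c"
  unfolding holder_bounded_def using order_trans[OF norm_ge_zero, of a c] by simp

lemma holder_bounded_compose:
  assumes "holder_bounded \<alpha> Y f c" "\<And>x. x \<in> X \<Longrightarrow> T x \<in> Y"
    "\<And>x y. x \<in> X \<Longrightarrow> y \<in> X \<Longrightarrow> dist (T x) (T y) \<le> K * dist x y" "1 \<le> K" "0 < \<alpha>" "\<alpha> \<le> 1"
  shows "holder_bounded \<alpha> X (\<lambda>x. f (T x)) (K * c)"
proof (cases "X = {}")
  case False
  then have "Y \<noteq> {}" using assms(2) by auto
  then have c: "0 \<le> c" using holder_bounded_nonneg assms(1) by blast
  have "norm (f (T x) - f (T y)) \<le> K * c * dist x y powr \<alpha>" if "x \<in> X" "y \<in> X" for x y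
  proof -
    have "norm (f (T x) - f (T y)) \<le> c * dist (T x) (T y) powr \<alpha>"
      using assms(1) assms(2) that unfolding holder_bounded_def by blast
    also have "dist (T x) (T y) powr \<alpha> \<le> (K * dist x y) powr \<alpha>"
      using assms that by (intro powr_mono2) auto
    also have "\<dots> = K powr \<alpha> * dist x y powr \<alpha>" using assms by (simp add: powr_mult)
    also have "K powr \<alpha> \<le> K" using powr_mono[of \<alpha> 1 K] assms by simp
    finally show ?thesis using c by (simp add: mult_left_mono mult_right_mono mult.assoc mult.left_commute)
  qed
  moreover have "norm (f (T x)) \<le> K * c" if "x \<in> X" for x
  proof -
    have "norm (f (T x)) \<le> c" using assms that unfolding holder_bounded_def by blast
    also have "\<dots> \<le> K * c" using assms(4) c by (simp add: mult_le_cancel_right1)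
    finally show ?thesis .
  qed
  ultimately show ?thesis unfolding holder_bounded_def by blast
qed (simp add: holder_bounded_def)

text \<open>For points on different sides of the interface, the intermediate value theorem on the
  segment between them gives a point with \<open>t z = 0\<close>, where both branches agree. Both
  parts of the segment are no longer than the whole, whence the factor 2.\<close>

lemma holder_bounded_if:
  fixes X :: "'a::real_normed_vector set" and t :: "'a \<Rightarrow> real"
  assumes "convex X" "continuous_on X t" "0 < \<alpha>"
    and f: "holder_bounded \<alpha> {x \<in> X. t x \<le> 0} f c" and g: "holder_bounded \<alpha> {x \<in> X. 0 \<le> t x} g c"
    and eq: "\<And>x. x \<in> X \<Longrightarrow> t x = 0 \<Longrightarrow> f x = g x"
  shows "holder_bounded \<alpha> X (\<lambda>x. if t x \<le> 0 then f x else g x) (2 * c)"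
proof (cases "X = {}")
  case False
  then have c: "0 \<le> c"
    using f g unfolding holder_bounded_def by (smt (verit) ex_in_conv mem_Collect_eq norm_ge_zero)
  define F where "F = (\<lambda>x. if t x \<le> 0 then f x else g x)"
  have mixed: "norm (f x - g y) \<le> 2 * c * dist x y powr \<alpha>"
    if xy: "x \<in> X" "y \<in> X" "t x \<le> 0" "0 \<le> t y" for x y
  proof -
    have seg: "closed_segment x y \<subseteq> X" using xy assms(1) by (simp add: closed_segment_subset)
    have "connected (t ` closed_segment x y)"
      by (intro connected_continuous_image continuous_on_subset[OF assms(2) seg]) simp
    then have "{t x..t y} \<subseteq> t ` closed_segment x y"
      by (rule connected_contains_Icc) auto
    then obtain z where z: "z \<in> closed_segment x y" "t z = 0" using xy(3,4) by force
    have zX: "z \<in> X" using z seg by auto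
    have d: "dist x z \<le> dist x y" "dist z y \<le> dist x y"
      using segment_bound[OF z(1)] by (auto simp: dist_norm norm_minus_commute)
    have "norm (f x - g y) \<le> norm (f x - f z) + norm (g z - g y)"
      using eq[OF zX z(2)] norm_triangle_ineq[of "f x - f z" "g z - g y"] by simp
    also have "\<dots> \<le> c * dist x z powr \<alpha> + c * dist z y powr \<alpha>"
      using f g xy zX z(2) unfolding holder_bounded_def by (intro add_mono) auto
    also have "\<dots> \<le> c * dist x y powr \<alpha> + c * dist x y powr \<alpha>"
      using d c assms(3) by (intro add_mono mult_left_mono powr_mono2) auto
    finally show ?thesis by simp
  qed
  have same: "c * s \<le> 2 * c * s" if "0 \<le> s" for s using that c by (simp add: mult_right_mono)
  have "norm (F x - F y) \<le> 2 * c * dist x y powr \<alpha>" if "x \<in> X" "y \<in> X" for x y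
  proof (cases "t x \<le> 0"; cases "t y \<le> 0")
    assume "t x \<le> 0" "t y \<le> 0"
    then have "norm (F x - F y) \<le> c * dist x y powr \<alpha>"
      using that f unfolding holder_bounded_def F_def by simp
    then show ?thesis using same[of "dist x y powr \<alpha>"] by simp
  next
    assume "\<not> t x \<le> 0" "\<not> t y \<le> 0"
    then have "norm (F x - F y) \<le> c * dist x y powr \<alpha>"
      using that g unfolding holder_bounded_def F_def by simp
    then show ?thesis using same[of "dist x y powr \<alpha>"] by simp
  next
    assume "t x \<le> 0" "\<not> t y \<le> 0"
    then show ?thesis using mixed[of x y] that by (simp add: F_def)
  next
    assume "\<not> t x \<le> 0" "t y \<le> 0"
    then show ?thesis using mixed[of y x] that by (simp add: F_def norm_minus_commute dist_commute)
  qed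
  moreover have "norm (F x) \<le> 2 * c" if "x \<in> X" for x
    using f g that c unfolding holder_bounded_def F_def by fastforce
  ultimately show ?thesis unfolding holder_bounded_def F_def by blast
qed (simp add: holder_bounded_def)

text \<open>A point of the half ball and a point outside the ball are at least
  \<open>\<rho> / 2\<close> apart, so for such pairs the sup bound is a Hoelder bound at the price
  of \<open>(2/\<rho>) powr \<alpha>\<close>.\<close>

lemma holder_bounded_zero_extension:
  assumes "0 < \<rho>" "0 < \<alpha>" "holder_bounded \<alpha> (ball p \<rho>) f c" "\<And>x. x \<notin> ball p (\<rho>/2) \<Longrightarrow> f x = 0"
  shows "holder_bounded \<alpha> UNIV f (c * (1 + (2/\<rho>) powr \<alpha>))"
proof -
  have c: "0 \<le> c" using holder_bounded_nonneg[OF assms(3)] assms(1) by auto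
  have le: "c * s \<le> c * (1 + (2/\<rho>) powr \<alpha>) * s" if "0 \<le> s" for s
    using that c by (intro mult_right_mono) (simp_all add: algebra_simps)
  have bd: "norm (f x) \<le> c" for x
    using assms(1,3,4) c unfolding holder_bounded_def by (cases "x \<in> ball p (\<rho>/2)") auto
  have mixed: "norm (f x - f y) \<le> c * (1 + (2/\<rho>) powr \<alpha>) * dist x y powr \<alpha>" if "y \<notin> ball p \<rho>" for x y
  proof (cases "x \<in> ball p (\<rho>/2)")
    case True
    have "dist p y \<le> dist p x + dist x y" by (rule dist_triangle)
    then have d: "\<rho>/2 \<le> dist x y" using True that by simp
    have "1 = (2/\<rho>) powr \<alpha> * (\<rho>/2) powr \<alpha>" using assms(1) by (simp flip: powr_mult)
    also have "\<dots> \<le> (2/\<rho>) powr \<alpha> * dist x y powr \<alpha>"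
      using d assms by (intro mult_left_mono powr_mono2) auto
    finally have "c * 1 \<le> c * ((2/\<rho>) powr \<alpha> * dist x y powr \<alpha>)" using c by (rule mult_left_mono)
    moreover have "0 \<le> c * dist x y powr \<alpha>" using c by simp
    moreover have "f y = 0" using that assms(1,4) by force
    ultimately show ?thesis using bd[of x] by (simp add: algebra_simps)
  next
    case False
    then have "f x = 0" "f y = 0" using that assms(1,4) by force+
    then show ?thesis using c by simp
  qed
  have "norm (f x - f y) \<le> c * (1 + (2/\<rho>) powr \<alpha>) * dist x y powr \<alpha>" for x y
  proof (cases "x \<in> ball p \<rho>"; cases "y \<in> ball p \<rho>")
    assume "x \<in> ball p \<rho>" "y \<in> ball p \<rho>"
    then have "norm (f x - f y) \<le> c * dist x y powr \<alpha>"
      using assms(3) unfolding holder_bounded_def by blast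
    also have "\<dots> \<le> c * (1 + (2/\<rho>) powr \<alpha>) * dist x y powr \<alpha>" by (rule le) simp
    finally show ?thesis .
  qed (use mixed[of y x] mixed[of x y] in \<open>simp_all add: norm_minus_commute dist_commute\<close>)
  moreover have "norm (f x) \<le> c * (1 + (2/\<rho>) powr \<alpha>)" for x
    using bd[of x] le[of 1] by simp
  ultimately show ?thesis unfolding holder_bounded_def by blast
qed

text \<open>Both branches satisfy the same first order estimate with the same linear map, so it does
  not matter which of them a nearby point selects.\<close>

lemma has_derivative_if_same:
  assumes "(f has_derivative D) (at x)" "(g has_derivative D) (at x)" "f x = g x"
  shows "((\<lambda>y. if P y then f y else g y) has_derivative D) (at x)"
  unfolding has_derivative_at_alt
proof (intro conjI allI impI)
  show "bounded_linear D" using assms(1) by (rule has_derivative_bounded_linear)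
  fix e :: real assume "0 < e"
  then obtain d1 d2 where d: "d1 > 0" "d2 > 0"
    "\<And>y. norm (y - x) < d1 \<Longrightarrow> norm (f y - f x - D (y - x)) \<le> e * norm (y - x)"
    "\<And>y. norm (y - x) < d2 \<Longrightarrow> norm (g y - g x - D (y - x)) \<le> e * norm (y - x)"
    using assms(1,2) unfolding has_derivative_at_alt by metis
  show "\<exists>d>0. \<forall>y. norm (y - x) < d \<longrightarrow> norm ((if P y then f y else g y)
      - (if P x then f x else g x) - D (y - x)) \<le> e * norm (y - x)"
    by (rule exI[of _ "min d1 d2"]) (use d assms(3) in auto)
qed

section \<open>Squared positive parts and cutoff functions\<close>

lemma has_derivative_max0_square: "((\<lambda>s::real. (max 0 s)\<^sup>2) has_real_derivative 2 * max 0 s) (at s)"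
proof -
  have eq: "(\<lambda>s::real. (max 0 s)\<^sup>2) = (\<lambda>s. if s \<le> 0 then 0 else s\<^sup>2)" by (auto simp: fun_eq_iff)
  have d: "((\<lambda>s::real. s\<^sup>2) has_real_derivative 2 * s) (at s)" by (auto intro!: derivative_eq_intros)
  consider "s < 0" | "s = 0" | "s > 0" by linarith
  then show ?thesis
  proof cases
    case 1
    have "((\<lambda>s::real. 0) has_real_derivative 2 * max 0 s) (at s)" using 1 by (simp add: max_def)
    then show ?thesis
      by (rule has_field_derivative_transform_within_open[of _ _ _ "{..<0}"]) (use 1 in auto)
  next
    case 2
    then show ?thesis unfolding eq has_field_derivative_def
      by (intro has_derivative_if_same) (use d in \<open>auto simp: has_field_derivative_def lambda_zero[symmetric]\<close>)
  next
    case 3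
    then have "((\<lambda>s::real. s\<^sup>2) has_real_derivative 2 * max 0 s) (at s)" using d by (simp add: max_def)
    then show ?thesis
      by (rule has_field_derivative_transform_within_open[of _ _ _ "{0<..}"]) (use 3 in auto)
  qed
qed

lemma has_gradient_max0_square:
  assumes "has_gradient f F X"
  shows "has_gradient (\<lambda>x. (max 0 (f x))\<^sup>2) (\<lambda>x. (2 * max 0 (f x)) *\<^sub>R F x) X"
  unfolding has_gradient_def
proof
  fix x assume "x \<in> X"
  then have "(f has_derivative (\<lambda>h. F x \<bullet> h)) (at x)" using assms by (simp add: has_gradient_def)
  from has_derivative_compose[OF this has_derivative_max0_square[unfolded has_field_derivative_def]]
  show "((\<lambda>x. (max 0 (f x))\<^sup>2) has_derivative (\<lambda>h. ((2 * max 0 (f x)) *\<^sub>R F x) \<bullet> h)) (at x)"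
    by simp
qed

lemma has_gradient_affine:
  "has_gradient f F X \<Longrightarrow> has_gradient (\<lambda>x. a - b * f x) (\<lambda>x. (- b) *\<^sub>R F x) X"
  unfolding has_gradient_def by (auto intro!: derivative_eq_intros)

text \<open>A cutoff with Lipschitz gradient is enough, because second derivatives of extensions are
  never measured. It is built from squared positive parts: outside the half ball \<open>f0\<close>
  is at most 0, so \<open>f1\<close> is 1 and \<psi> vanishes; in the quarter ball \<open>f1\<close>
  is at most 0, so \<psi> is 1.\<close>

lemma plateau_function:
  fixes p :: "'a::real_inner"
  assumes "0 < \<rho>" "\<rho> \<le> 1/2" "\<alpha> \<le> 1"
  obtains \<psi> \<Psi> k where "has_gradient \<psi> \<Psi> UNIV"
    "holder_bounded \<alpha> (ball p \<rho>) \<psi> k" "holder_bounded \<alpha> (ball p \<rho>) \<Psi> k"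
    "\<And>x. x \<notin> ball p (\<rho>/2) \<Longrightarrow> \<psi> x = 0 \<and> \<Psi> x = 0"
    "\<And>x. x \<in> ball p (\<rho>/4) \<Longrightarrow> \<psi> x = 1 \<and> \<Psi> x = 0"
proof -
  let ?X = "ball p \<rho>"
  \<comment> \<open>In the quarter ball \<open>f0\<close> is at least \<open>(\<rho>/2)\<^sup>2 -
    (\<rho>/4)\<^sup>2 = 3 * \<rho>\<^sup>2 / 16\<close>; \<open>c\<close> is the reciprocal of the
    square of this number.\<close>
  define c where "c = (16/(3*\<rho>\<^sup>2))\<^sup>2"
  define f0 where "f0 = (\<lambda>x. (\<rho>/2)\<^sup>2 - (x - p) \<bullet> (x - p))"
  define f1 where "f1 = (\<lambda>x. 1 - c * (max 0 (f0 x))\<^sup>2)"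
  define F0 where "F0 = (\<lambda>x. (-2) *\<^sub>R (x - p))"
  define F1 where "F1 = (\<lambda>x. (- c) *\<^sub>R ((2 * max 0 (f0 x)) *\<^sub>R F0 x))"
  define \<psi> where "\<psi> = (\<lambda>x. 1 - (max 0 (f1 x))\<^sup>2)"
  define \<Psi> where "\<Psi> = (\<lambda>x. - ((2 * max 0 (f1 x)) *\<^sub>R F1 x))"
  have g0: "has_gradient f0 F0 UNIV"
    unfolding has_gradient_def f0_def F0_def
    by (auto intro!: derivative_eq_intros simp: inner_commute)
  have g1: "has_gradient f1 F1 UNIV"
    unfolding f1_def F1_def by (intro has_gradient_affine has_gradient_max0_square g0)
  have g: "has_gradient \<psi> \<Psi> UNIV"
    using has_gradient_affine[OF has_gradient_max0_square[OF g1], of 1 1] by (simp add: \<psi>_def \<Psi>_def)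
  have diam: "dist x y \<le> 1" if "x \<in> ?X" "y \<in> ?X" for x y
    using that assms(2) dist_triangle2[of x y p] by (simp add: dist_commute)
  have hid: "holder_bounded \<alpha> ?X (\<lambda>x. x - p) 1"
    using assms by (intro holder_bounded_lipschitz diam) (auto simp: dist_norm norm_minus_commute)
  have hk: "holder_bounded \<alpha> ?X (\<lambda>_. a) \<bar>a\<bar>" for a :: real by (rule holder_bounded_const) simp
  obtain k0 where h0: "holder_bounded \<alpha> ?X f0 k0"
    unfolding f0_def using holder_bounded_diff[OF hk holder_bounded_inner[OF hid hid]] by blast
  obtain k1 where h1: "holder_bounded \<alpha> ?X F0 k1"
    unfolding F0_def using holder_bounded_cmult[OF hid] by blast
  note m0 = holder_bounded_max0[OF h0]
  obtain k2 where h2: "holder_bounded \<alpha> ?X f1 k2"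
    unfolding f1_def power2_eq_square
    using holder_bounded_diff[OF hk holder_bounded_mult[OF hk holder_bounded_mult[OF m0 m0]]] by blast
  obtain k3 where h3: "holder_bounded \<alpha> ?X F1 k3"
    unfolding F1_def
    using holder_bounded_cmult[OF holder_bounded_scaleR[OF holder_bounded_mult[OF hk m0] h1]] by blast
  note m1 = holder_bounded_max0[OF h2]
  obtain k4 where h4: "holder_bounded \<alpha> ?X \<psi> k4"
    unfolding \<psi>_def power2_eq_square
    using holder_bounded_diff[OF hk holder_bounded_mult[OF m1 m1]] by blast
  obtain k5 where h5: "holder_bounded \<alpha> ?X \<Psi> k5"
    unfolding \<Psi>_def
    using holder_bounded_cmult[OF holder_bounded_scaleR[OF holder_bounded_mult[OF hk m1] h3], of "-1"]
    by auto
  show thesis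
  proof
    show "has_gradient \<psi> \<Psi> UNIV" by fact
    show "holder_bounded \<alpha> ?X \<psi> (max k4 k5)" "holder_bounded \<alpha> ?X \<Psi> (max k4 k5)"
      using h4 h5 holder_bounded_mono max.cobounded1 max.cobounded2 by blast+
    show "\<psi> x = 0 \<and> \<Psi> x = 0" if "x \<notin> ball p (\<rho>/2)" for x
    proof -
      have "(\<rho>/2)\<^sup>2 \<le> (norm (x - p))\<^sup>2"
        using that assms(1) by (intro power_mono) (auto simp: dist_norm norm_minus_commute)
      then have "max 0 (f0 x) = 0" by (simp add: f0_def power2_norm_eq_inner)
      then show ?thesis by (simp add: \<psi>_def \<Psi>_def f1_def F1_def)
    qed
    show "\<psi> x = 1 \<and> \<Psi> x = 0" if "x \<in> ball p (\<rho>/4)" for x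
    proof -
      have "(norm (x - p))\<^sup>2 \<le> (\<rho>/4)\<^sup>2"
        using that by (intro power_mono) (auto simp: dist_norm norm_minus_commute)
      moreover have "f0 x = (\<rho>/2)\<^sup>2 - (norm (x - p))\<^sup>2" by (simp add: f0_def power2_norm_eq_inner)
      ultimately have 1: "3*\<rho>\<^sup>2/16 \<le> f0 x" by (simp add: power_divide)
      have "1 = c * (3*\<rho>\<^sup>2/16)\<^sup>2" using assms(1) by (simp add: c_def power_divide power_mult_distrib)
      also have "\<dots> \<le> c * (max 0 (f0 x))\<^sup>2"
        using 1 by (intro mult_left_mono power_mono) (auto simp: c_def)
      finally have "max 0 (f1 x) = 0" by (simp add: f1_def)
      then show ?thesis by (simp add: \<psi>_def \<Psi>_def)
    qed
  qed
qed

text \<open>\<open>u\<close> is differentiable everywhere but bounded only on \<open>T\<close>, as a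
  stage controls its output only near the domain. The point is a bound that is linear in
  \<open>c\<close>. The set \<open>X\<close>, where the extension is controlled, and the set
  \<open>Y\<close>, where it must agree with \<open>u\<close>, are separated so that local
  extensions on balls can be glued: the global one agrees on a growing union of balls.\<close>

definition extendable :: "real \<Rightarrow> 'a::real_inner set \<Rightarrow> 'a set \<Rightarrow> 'a set \<Rightarrow> real \<Rightarrow> bool" where
  "extendable \<alpha> T X Y C \<longleftrightarrow>
    (\<forall>u G c. has_gradient u G UNIV \<and> holder_bounded \<alpha> T u c \<and> holder_bounded \<alpha> T G c \<longrightarrow>
      (\<exists>U GU. has_gradient U GU X \<and> holder_bounded \<alpha> X U (C * c) \<and> holder_bounded \<alpha> X GU (C * c) \<and>
        (\<forall>x\<in>T \<inter> Y. U x = u x \<and> GU x = G x)))"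

section \<open>Local extensions\<close>

lemma local_extension_interior:
  assumes "open \<omega>" "p \<in> \<omega>"
  shows "\<exists>\<rho>>0. \<exists>C\<ge>0. \<rho> \<le> 1/2 \<and> extendable \<alpha> (closure \<omega>) (ball p \<rho>) (ball p \<rho>) C"
proof -
  obtain r where r: "r > 0" "ball p r \<subseteq> \<omega>" using assms by (meson open_contains_ball)
  have sub: "ball p (min r (1/2)) \<subseteq> closure \<omega>"
    using r(2) closure_subset by (force dest: subsetD)
  show ?thesis
    unfolding extendable_def
  proof (rule exI[of _ "min r (1/2)"], intro conjI exI[of _ 1] allI impI)
    fix u :: "'a \<Rightarrow> real" and G c
    assume *: "has_gradient u G UNIV \<and> holder_bounded \<alpha> (closure \<omega>) u c \<and> holder_bounded \<alpha> (closure \<omega>) G c"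
    then show "\<exists>U GU. has_gradient U GU (ball p (min r (1/2))) \<and>
      holder_bounded \<alpha> (ball p (min r (1/2))) U (1 * c) \<and> holder_bounded \<alpha> (ball p (min r (1/2))) GU (1 * c) \<and>
      (\<forall>x\<in>closure \<omega> \<inter> ball p (min r (1/2)). U x = u x \<and> GU x = G x)"
      unfolding has_gradient_def
      by (intro exI[of _ u] exI[of _ G]) (auto intro: holder_bounded_subset[OF _ sub])
  qed (use r in auto)
qed

text \<open>
  Where the domain is \<open>{x. t x < 0}\<close> with \<open>t x = g x - x \<bullet> e\<close>, the function \<open>u\<close> is continued to \<open>t x > 0\<close> by
  \<open>3 u (x + 2 t e) - 2 u (x + 3 t e)\<close>: since \<open>3 - 2 = 1\<close> and \<open>3 \<cdot> 2 - 2 \<cdot> 3 = 0\<close>, value and gradient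
  match on \<open>t x = 0\<close>.
\<close>

lemma local_extension_boundary:
  fixes \<omega> :: "(real^'d) set"
  assumes "smooth_bounded_domain \<omega>" "p \<in> frontier \<omega>" "0 < \<alpha>" "\<alpha> \<le> 1"
  shows "\<exists>\<rho>>0. \<exists>C\<ge>0. \<rho> \<le> 1/2 \<and> extendable \<alpha> (closure \<omega>) (ball p \<rho>) (ball p \<rho>) C"
proof -
  obtain r e and g :: "real^'d \<Rightarrow> real" where r: "0 < r" and e: "norm e = 1"
    and g: "\<And>m. C_class m g" and ge: "\<And>x t. g (x + t *\<^sub>R e) = g x"
    and om: "\<omega> \<inter> ball p r = {x \<in> ball p r. g x < x \<bullet> e}"
  proof -
    have "\<forall>p\<in>frontier \<omega>. \<exists>r>0. \<exists>e. \<exists>g :: real^'d \<Rightarrow> real. norm e = 1 \<and> (\<forall>m. C_class m g) \<and>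
        (\<forall>x t. g (x + t *\<^sub>R e) = g x) \<and> \<omega> \<inter> ball p r = {x \<in> ball p r. g x < x \<bullet> e}"
      using assms(1) unfolding smooth_bounded_domain_def by (elim conjE)
    with assms(2) show thesis using that by blast
  qed
  have opn: "open \<omega>" using assms(1) by (simp add: smooth_bounded_domain_def)
  have ee: "e \<bullet> e = 1" using e by (simp add: norm_eq_1)
  define t where "t = (\<lambda>x. g x - x \<bullet> e)"
  define Gt where "Gt = (\<lambda>x. grad g x - e)"
  note g2 = C_class_2D[OF g]
  have gradt: "(t has_derivative (\<lambda>h. Gt x \<bullet> h)) (at x)" for x
  proof -
    have "(\<lambda>h. \<Sum>i\<in>UNIV. (h $ i) *\<^sub>R partial i g x) = (\<lambda>h. grad g x \<bullet> h)"
      by (simp add: fun_eq_iff inner_vec_def grad_def mult.commute)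
    then have "(g has_derivative (\<lambda>h. grad g x \<bullet> h)) (at x)"
      using has_derivative_partial[OF g2(1), of x] by simp
    then show ?thesis unfolding t_def Gt_def
      by (auto intro!: derivative_eq_intros simp: fun_eq_iff inner_diff_right inner_diff_left inner_commute)
  qed
  have contt: "continuous_on X t" for X
    using gradt by (meson continuous_at_imp_continuous_on has_derivative_continuous)
  define L where "L = 2 + norm0 (cball p r) (grad g) + norm0 (cball p r) (grad (grad g))"
  have cb: "compact (cball p r)" "convex (cball p r)" by auto
  have n0: "0 \<le> norm0 (cball p r) (grad g)" "0 \<le> norm0 (cball p r) (grad (grad g))"
    using r by (intro norm0_nonneg cb g2(4,5); auto)+
  have L1: "1 \<le> L" using n0 by (simp add: L_def)
  have Gt_le: "norm (Gt x) \<le> L" if "x \<in> cball p r" for x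
    using norm0_ge[OF cb(1) g2(4) that] norm_triangle_ineq4[of "grad g x" e] e n0
    by (simp add: Gt_def L_def)
  have Gt_lip: "norm (Gt x - Gt y) \<le> L * dist x y" if "x \<in> cball p r" "y \<in> cball p r" for x y
  proof -
    have "norm (Gt x - Gt y) \<le> norm0 (cball p r) (grad (grad g)) * dist x y"
      using convex_grad_bound[OF cb(2) g2(2) norm0_ge[OF cb(1) g2(5)] that] by (simp add: Gt_def)
    also have "\<dots> \<le> L * dist x y" using n0 by (intro mult_right_mono) (auto simp: L_def)
    finally show ?thesis .
  qed
  have t_lip: "\<bar>t x - t y\<bar> \<le> L * dist x y" if "x \<in> cball p r" "y \<in> cball p r" for x y
  proof -
    have "\<bar>t x - t y\<bar> \<le> \<bar>g x - g y\<bar> + \<bar>(x - y) \<bullet> e\<bar>" by (simp add: t_def inner_diff_left)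
    also have "\<dots> \<le> norm0 (cball p r) (grad g) * dist x y + dist x y"
      using convex_grad_bound[OF cb(2) g2(1) norm0_ge[OF cb(1) g2(4)] that]
        Cauchy_Schwarz_ineq2[of "x - y" e] e
      by (intro add_mono) (auto simp: dist_norm)
    also have "\<dots> = (norm0 (cball p r) (grad g) + 1) * dist x y" by (simp add: algebra_simps)
    also have "\<dots> \<le> L * dist x y" using n0 by (intro mult_right_mono) (auto simp: L_def)
    finally show ?thesis .
  qed
  have clos: "x \<in> closure \<omega> \<longleftrightarrow> t x \<le> 0" if x: "x \<in> ball p r" for x
  proof
    assume "x \<in> closure \<omega>"
    then have "x \<in> closure (\<omega> \<inter> ball p r)"
      using x open_Int_closure_subset[of "ball p r" \<omega>] by (auto simp: Int_commute)
    also have "\<dots> \<subseteq> closure {x. t x \<le> 0}" by (intro closure_mono) (auto simp: om t_def)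
    also have "\<dots> = {x. t x \<le> 0}"
      by (intro closure_closed closed_Collect_le contt continuous_intros)
    finally show "t x \<le> 0" by simp
  next
    \<comment> \<open>A point with \<open>t x\<close> at most 0 is the limit of its translates along
      \<open>e\<close>, for which \<open>t\<close> is negative and which therefore lie in the
      domain.\<close>
    assume tx: "t x \<le> 0"
    have lim: "(\<lambda>n. x + inverse (real (Suc n)) *\<^sub>R e) \<longlonglongrightarrow> x + 0 *\<^sub>R e"
      by (intro tendsto_intros LIMSEQ_inverse_real_of_nat)
    then have "eventually (\<lambda>n. x + inverse (real (Suc n)) *\<^sub>R e \<in> ball p r) sequentially"
      using x by (intro topological_tendstoD) auto
    then obtain N where N: "\<And>n. n \<ge> N \<Longrightarrow> x + inverse (real (Suc n)) *\<^sub>R e \<in> ball p r"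
      unfolding eventually_sequentially by blast
    show "x \<in> closure \<omega>"
    proof (rule closure_sequential[THEN iffD2], intro exI conjI allI)
      show "(\<lambda>n. x + inverse (real (Suc (n + N))) *\<^sub>R e) \<longlonglongrightarrow> x"
        using LIMSEQ_ignore_initial_segment[OF lim, of N] by simp
      fix n
      have "x + inverse (real (Suc (n + N))) *\<^sub>R e \<in> \<omega> \<inter> ball p r"
      proof -
        have "0 < inverse (real (Suc (n + N)))" by simp
        then have "g x < x \<bullet> e + inverse (real (Suc (n + N)))"
          using tx unfolding t_def by linarith
        then show ?thesis unfolding om using N[of "n + N"] by (simp add: ge inner_add_left ee)
      qed
      then show "x + inverse (real (Suc (n + N))) *\<^sub>R e \<in> \<omega>" by blast
    qed
  qed
  have tp: "t p = 0"
  proof -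
    have "p \<in> closure \<omega>" "p \<notin> \<omega>" using assms(2) opn by (auto simp: frontier_def interior_open)
    then have "t p \<le> 0" "p \<notin> \<omega> \<inter> ball p r" using clos[of p] r by auto
    then show ?thesis unfolding om using r by (simp add: t_def)
  qed
  \<comment> \<open>A Lipschitz constant of the shifts \<open>T s\<close> below for \<open>s\<close>
    up to 3, the largest factor in the reflection formula.\<close>
  define K where "K = 1 + 3 * L"
  have K: "1 \<le> K" "0 < K" using L1 by (auto simp: K_def)
  \<comment> \<open>The shifts fix \<open>p\<close>, where \<open>t\<close> vanishes, and are
    \<open>K\<close>-Lipschitz, so this radius keeps the images inside the chart
    \<open>ball p r\<close>.\<close>
  define \<rho> where "\<rho> = min (1/2) (r / (2 * K))"
  have \<rho>: "0 < \<rho>" "\<rho> \<le> 1/2" "\<rho> * K < r" "\<rho> \<le> r"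
  proof -
    show "0 < \<rho>" "\<rho> \<le> 1/2" using r K by (auto simp: \<rho>_def)
    have "\<rho> * K \<le> r / (2 * K) * K" using K by (intro mult_right_mono) (auto simp: \<rho>_def)
    then show lt: "\<rho> * K < r" using K r by simp
    show "\<rho> \<le> r" using mult_left_mono[OF K(1), of \<rho>] \<open>0 < \<rho>\<close> lt by linarith
  qed
  let ?B = "ball p \<rho>"
  have sub: "?B \<subseteq> ball p r" "?B \<subseteq> cball p r" using \<rho>(4) by auto
  \<comment> \<open>Since \<open>g\<close> is constant along \<open>e\<close>, the shift multiplies
    \<open>t\<close> by \<open>1 - s\<close>; for \<open>s\<close> at least 1 it carries the outer
    side into the closure of the domain.\<close>
  define T where "T = (\<lambda>s x. x + (s * t x) *\<^sub>R e)"
  have tT: "t (T s x) = (1 - s) * t x" for s x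
  proof -
    have "g (T s x) = g x" by (simp add: T_def ge)
    then show ?thesis by (simp add: t_def T_def inner_add_left ee algebra_simps)
  qed
  have T_lip: "dist (T s x) (T s y) \<le> K * dist x y"
    if "x \<in> cball p r" "y \<in> cball p r" "0 \<le> s" "s \<le> 3" for s x y
  proof -
    have "dist (T s x) (T s y) = norm ((x - y) + (s * (t x - t y)) *\<^sub>R e)"
      by (simp add: T_def dist_norm algebra_simps)
    also have "\<dots> \<le> norm (x - y) + s * \<bar>t x - t y\<bar>"
      using norm_triangle_ineq[of "x - y" "(s * (t x - t y)) *\<^sub>R e"] e that by (simp add: abs_mult)
    also have "s * \<bar>t x - t y\<bar> \<le> 3 * (L * dist x y)"
      using t_lip[OF that(1,2)] that by (intro mult_mono) auto
    finally show ?thesis by (simp add: K_def dist_norm algebra_simps)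
  qed
  have T_ball: "T s x \<in> ball p r" if "x \<in> ?B" "0 \<le> s" "s \<le> 3" for s x
  proof -
    have "dist (T s p) (T s x) \<le> K * dist p x" using that r sub by (intro T_lip) auto
    also have "\<dots> \<le> K * \<rho>" using that K by simp
    also have "\<dots> < r" using \<rho>(3) by (simp add: mult.commute)
    finally show ?thesis by (simp add: T_def tp)
  qed
  have T_clos: "T s x \<in> closure \<omega>" if "x \<in> ?B" "0 \<le> t x" "1 \<le> s" "s \<le> 3" for s x
    using clos[OF T_ball] that by (simp add: tT mult_le_0_iff)
  have T_der: "((\<lambda>x. u (T s x)) has_derivative (\<lambda>h. (G (T s x) + (s * (G (T s x) \<bullet> e)) *\<^sub>R Gt x) \<bullet> h)) (at x)"
    if "has_gradient u G UNIV" for u G s x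
  proof -
    have "(T s has_derivative (\<lambda>h. h + (s * (Gt x \<bullet> h)) *\<^sub>R e)) (at x)"
      unfolding T_def by (auto intro!: derivative_eq_intros gradt)
    moreover have "(u has_derivative (\<lambda>h. G (T s x) \<bullet> h)) (at (T s x))"
      using that by (simp add: has_gradient_def)
    ultimately have "((\<lambda>x. u (T s x)) has_derivative (\<lambda>h. G (T s x) \<bullet> (h + (s * (Gt x \<bullet> h)) *\<^sub>R e))) (at x)"
      by (rule has_derivative_compose)
    then show ?thesis by (simp add: inner_add_right inner_add_left mult_ac)
  qed
  have diam: "dist x y \<le> 1" if "x \<in> ?B" "y \<in> ?B" for x y
    using that \<rho>(2) dist_triangle2[of x y p] by (simp add: dist_commute)
  define Y where "Y = {x \<in> ?B. 0 \<le> t x}"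
  have hGt: "holder_bounded \<alpha> Y Gt L"
    using assms(4) L1 \<rho>(4) Gt_le Gt_lip diam by (intro holder_bounded_lipschitz) (auto simp: Y_def)
  have he: "holder_bounded \<alpha> Y (\<lambda>_. e) 1" by (rule holder_bounded_const) (simp add: e)
  \<comment> \<open>The 5 is 3 + 2 from the weights of the two reflections. Differentiating them
    adds \<open>s * (G \<bullet> e) *\<^sub>R Gt\<close>, two products costing a factor 4, which
    gives \<open>3 * 2 * 4 + 2 * 3 * 4 = 48\<close>. The outer 2 is the price of gluing along
    \<open>t x = 0\<close>.\<close>
  define C where "C = 2 * (5 * K + 48 * K * L)"
  show ?thesis
    unfolding extendable_def
  proof (rule exI[of _ \<rho>], intro conjI exI[of _ C] allI impI)
    show "0 < \<rho>" "\<rho> \<le> 1/2" by fact+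
    show "0 \<le> C" using K L1 by (simp add: C_def)
    fix u :: "real^'d \<Rightarrow> real" and G c
    assume "has_gradient u G UNIV \<and> holder_bounded \<alpha> (closure \<omega>) u c \<and> holder_bounded \<alpha> (closure \<omega>) G c"
    then have u: "has_gradient u G UNIV" "holder_bounded \<alpha> (closure \<omega>) u c" "holder_bounded \<alpha> (closure \<omega>) G c"
      by auto
    have "p \<in> closure \<omega>" using assms(2) by (simp add: frontier_def)
    then have c: "0 \<le> c" using holder_bounded_nonneg[OF u(2)] by (metis empty_iff)
    define R where "R = (\<lambda>x. 3 *\<^sub>R u (T 2 x) - 2 *\<^sub>R u (T 3 x))"
    define GR where "GR = (\<lambda>x. 3 *\<^sub>R (G (T 2 x) + (2 * (G (T 2 x) \<bullet> e)) *\<^sub>R Gt x)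
      - 2 *\<^sub>R (G (T 3 x) + (3 * (G (T 3 x) \<bullet> e)) *\<^sub>R Gt x))"
    define U where "U = (\<lambda>x. if t x \<le> 0 then u x else R x)"
    define GU where "GU = (\<lambda>x. if t x \<le> 0 then G x else GR x)"
    have R_der: "(R has_derivative (\<lambda>h. GR x \<bullet> h)) (at x)" for x
    proof -
      have "(R has_derivative (\<lambda>h. 3 *\<^sub>R ((G (T 2 x) + (2 * (G (T 2 x) \<bullet> e)) *\<^sub>R Gt x) \<bullet> h)
          - 2 *\<^sub>R ((G (T 3 x) + (3 * (G (T 3 x) \<bullet> e)) *\<^sub>R Gt x) \<bullet> h))) (at x)"
        unfolding R_def by (intro has_derivative_diff has_derivative_scaleR_right T_der u(1))
      then show ?thesis unfolding GR_def by (simp add: inner_diff_left)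
    qed
    have u_der: "(u has_derivative (\<lambda>h. G x \<bullet> h)) (at x)" for x
      using u(1) by (simp add: has_gradient_def)
    have t0: "R x = u x" "GR x = G x" if "t x = 0" for x
      using that scaleR_left_distrib[of 1 2 "G x"] by (auto simp: R_def GR_def T_def algebra_simps)
    have "(U has_derivative (\<lambda>h. GU x \<bullet> h)) (at x)" for x
    proof -
      consider "t x < 0" | "t x = 0" | "t x > 0" by linarith
      then show ?thesis
      proof cases
        case 1
        have "(u has_derivative (\<lambda>h. GU x \<bullet> h)) (at x)" using u_der[of x] 1 by (simp add: GU_def)
        then show ?thesis
          by (rule has_derivative_transform_within_open[of _ _ _ _ "{x. t x < 0}"])
            (use 1 contt in \<open>auto simp: U_def intro!: open_Collect_less continuous_intros\<close>)
      next
        case 2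
        then show ?thesis unfolding U_def
          using u_der[of x] R_der[of x] t0[OF 2] by (intro has_derivative_if_same) (auto simp: GU_def)
      next
        case 3
        have "(R has_derivative (\<lambda>h. GU x \<bullet> h)) (at x)" using R_der[of x] 3 by (simp add: GU_def)
        then show ?thesis
          by (rule has_derivative_transform_within_open[of _ _ _ _ "{x. 0 < t x}"])
            (use 3 contt in \<open>auto simp: U_def intro!: open_Collect_less continuous_intros\<close>)
      qed
    qed
    then have 1: "has_gradient U GU ?B" by (simp add: has_gradient_def)
    have hT: "holder_bounded \<alpha> Y (\<lambda>x. f (T s x)) (K * c)"
      if "holder_bounded \<alpha> (closure \<omega>) f c" "1 \<le> s" "s \<le> 3" for s and f :: "real^'d \<Rightarrow> 'z::real_normed_vector"
      using that sub assms(3,4) K by (intro holder_bounded_compose[OF that(1)] T_clos T_lip) (auto simp: Y_def)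
    have hR: "holder_bounded \<alpha> Y R (5 * K * c)"
      unfolding R_def
      using holder_bounded_diff[OF holder_bounded_cmult[OF hT[OF u(2), of 2], of 3]
          holder_bounded_cmult[OF hT[OF u(2), of 3], of 2]]
      by (rule holder_bounded_mono) (auto simp: algebra_simps)
    have hS: "holder_bounded \<alpha> Y (\<lambda>x. G (T s x) + (s * (G (T s x) \<bullet> e)) *\<^sub>R Gt x) (K * c + \<bar>s\<bar> * (4 * K * c * L))"
      if "1 \<le> s" "s \<le> 3" for s
      using holder_bounded_add[OF hT[OF u(3) that]
          holder_bounded_scaleR[OF holder_bounded_cmult[OF holder_bounded_inner[OF hT[OF u(3) that] he], of s] hGt]]
      by (simp add: mult.assoc mult.left_commute)
    have hGR: "holder_bounded \<alpha> Y GR ((5 * K + 48 * K * L) * c)"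
      unfolding GR_def
      using holder_bounded_diff[OF holder_bounded_cmult[OF hS[of 2], of 3] holder_bounded_cmult[OF hS[of 3], of 2]]
      by (rule holder_bounded_mono) (auto simp: algebra_simps)
    have cc: "c \<le> (5 * K + 48 * K * L) * c" "5 * K * c \<le> (5 * K + 48 * K * L) * c"
    proof -
      have "0 \<le> K * L" using K L1 by simp
      then have "1 \<le> 5 * K + 48 * K * L" using K(1) by linarith
      then show "c \<le> (5 * K + 48 * K * L) * c" using mult_right_mono[of 1 _ c] c by simp
      show "5 * K * c \<le> (5 * K + 48 * K * L) * c" using \<open>0 \<le> K * L\<close> c by (intro mult_right_mono) auto
    qed
    have sub2: "{x \<in> ?B. t x \<le> 0} \<subseteq> closure \<omega>" using clos sub by auto
    have Yeq: "{x \<in> ?B. 0 \<le> t x} = Y" by (simp add: Y_def)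
    have "holder_bounded \<alpha> ?B U (2 * ((5 * K + 48 * K * L) * c))"
      unfolding U_def
      by (rule holder_bounded_if[OF _ contt assms(3)])
        (use holder_bounded_mono[OF holder_bounded_subset[OF u(2) sub2] cc(1)]
          holder_bounded_mono[OF hR cc(2)] t0 in \<open>auto simp: Yeq simp del: mem_ball\<close>)
    then have 2: "holder_bounded \<alpha> ?B U (C * c)" by (simp only: C_def mult.assoc)
    have "holder_bounded \<alpha> ?B GU (2 * ((5 * K + 48 * K * L) * c))"
      unfolding GU_def
      by (rule holder_bounded_if[OF _ contt assms(3)])
        (use holder_bounded_mono[OF holder_bounded_subset[OF u(3) sub2] cc(1)] hGR t0 in \<open>auto simp: Yeq simp del: mem_ball\<close>)
    then have 3: "holder_bounded \<alpha> ?B GU (C * c)" by (simp only: C_def mult.assoc)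
    have 4: "\<forall>x\<in>closure \<omega> \<inter> ?B. U x = u x \<and> GU x = G x"
      using clos sub by (auto simp: U_def GU_def)
    show "\<exists>U GU. has_gradient U GU ?B \<and> holder_bounded \<alpha> ?B U (C * c) \<and> holder_bounded \<alpha> ?B GU (C * c) \<and>
        (\<forall>x\<in>closure \<omega> \<inter> ?B. U x = u x \<and> GU x = G x)"
      using 1 2 3 4 by blast
  qed
qed


section \<open>From local extensions to a global one\<close>

lemma local_extension:
  fixes \<omega> :: "(real^'d) set"
  assumes "smooth_bounded_domain \<omega>" "p \<in> closure \<omega>" "0 < \<alpha>" "\<alpha> \<le> 1"
  shows "\<exists>\<rho>>0. \<exists>C\<ge>0. \<rho> \<le> 1/2 \<and> extendable \<alpha> (closure \<omega>) (ball p \<rho>) (ball p \<rho>) C"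
proof (cases "p \<in> \<omega>")
  case True
  have "open \<omega>" using assms(1) by (simp add: smooth_bounded_domain_def)
  then show ?thesis using True by (rule local_extension_interior)
next
  case False
  then have "p \<in> frontier \<omega>"
    using assms(1,2) by (simp add: smooth_bounded_domain_def frontier_def interior_open)
  then show ?thesis using assms by (intro local_extension_boundary)
qed

text \<open>\<open>W\<close> is arbitrary outside the ball. As \<psi> vanishes off the half ball,
  the blend coincides with \<open>U\<close> on the open complement of the closed half ball, which
  covers the remaining points.\<close>

lemma has_gradient_blend:
  assumes U: "has_gradient U GU UNIV" and W: "has_gradient W GW (ball p \<rho>)"
    and \<psi>: "has_gradient \<psi> \<Psi> UNIV" "\<And>x. x \<notin> ball p (\<rho>/2) \<Longrightarrow> \<psi> x = 0 \<and> \<Psi> x = 0" and "0 < \<rho>"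
  shows "has_gradient (\<lambda>x. U x + \<psi> x * (W x - U x))
    (\<lambda>x. GU x + (if x \<in> ball p \<rho> then \<psi> x *\<^sub>R (GW x - GU x) + (W x - U x) *\<^sub>R \<Psi> x else 0)) UNIV"
  unfolding has_gradient_def
proof
  fix x
  have dU: "(U has_derivative (\<lambda>h. GU x \<bullet> h)) (at x)" and d\<psi>: "(\<psi> has_derivative (\<lambda>h. \<Psi> x \<bullet> h)) (at x)"
    using U \<psi>(1) by (auto simp: has_gradient_def)
  show "((\<lambda>x. U x + \<psi> x * (W x - U x)) has_derivative
     (\<lambda>h. (GU x + (if x \<in> ball p \<rho> then \<psi> x *\<^sub>R (GW x - GU x) + (W x - U x) *\<^sub>R \<Psi> x else 0)) \<bullet> h)) (at x)"
  proof (cases "x \<in> ball p \<rho>")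
    case True
    then have dW: "(W has_derivative (\<lambda>h. GW x \<bullet> h)) (at x)" using W by (simp add: has_gradient_def)
    show ?thesis
      using True by (auto intro!: derivative_eq_intros dU dW d\<psi> simp: inner_add_left inner_diff_left algebra_simps)
  next
    case False
    then have "(U has_derivative (\<lambda>h. (GU x + (if x \<in> ball p \<rho> then \<psi> x *\<^sub>R (GW x - GU x) + (W x - U x) *\<^sub>R \<Psi> x else 0)) \<bullet> h)) (at x)"
      using dU by simp
    then show ?thesis
      by (rule has_derivative_transform_within_open[of _ _ _ _ "- cball p (\<rho>/2)"])
        (use False \<psi>(2) \<open>0 < \<rho>\<close> in auto)
  qed
qed

text \<open>In place of a partition of unity, the local extensions are blended in one at a time as
  \<open>U + \<psi> * (W - U)\<close>. At a point of the closure where \<open>U\<close> already has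
  the value and gradient of \<open>u\<close>, so has \<open>W\<close> inside its ball, and blending
  changes nothing; where \<psi> is 1 the result is \<open>W\<close>. Each step thus enlarges the set
  of agreement by a quarter ball.\<close>

lemma extension_finite_cover:
  fixes \<omega> :: "(real^'d) set" and \<rho> :: "real^'d \<Rightarrow> real"
  assumes \<alpha>: "0 < \<alpha>" "\<alpha> \<le> 1" and ne: "closure \<omega> \<noteq> {}" and "finite F"
    and loc: "\<And>p. p \<in> F \<Longrightarrow> 0 < \<rho> p \<and> \<rho> p \<le> 1/2 \<and> (\<exists>C\<ge>0. extendable \<alpha> (closure \<omega>) (ball p (\<rho> p)) (ball p (\<rho> p)) C)"
  shows "\<exists>C\<ge>0. extendable \<alpha> (closure \<omega>) UNIV (\<Union>p\<in>F. ball p (\<rho> p / 4)) C"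
  using \<open>finite F\<close> loc
proof (induction F)
  case empty
  show ?case
  proof -
    have z: "((\<lambda>_. 0) has_derivative (\<bullet>) (0::real^'d)) (at x)" for x
      by (rule has_derivative_eq_rhs[OF has_derivative_const]) (simp add: fun_eq_iff)
    show ?thesis
      by (intro exI[of _ 0]) (auto simp: extendable_def has_gradient_def holder_bounded_def intro!: exI[of _ "\<lambda>_. 0"] z)
  qed
next
  case (insert p F)
  obtain C1 where C1: "C1 \<ge> 0" "extendable \<alpha> (closure \<omega>) UNIV (\<Union>p\<in>F. ball p (\<rho> p / 4)) C1"
    using insert.IH insert.prems by blast
  let ?r = "\<rho> p" and ?B = "ball p (\<rho> p)"
  have r: "0 < ?r" "?r \<le> 1/2" using insert.prems[of p] by auto
  obtain C2 where C2: "C2 \<ge> 0" "extendable \<alpha> (closure \<omega>) ?B ?B C2"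
    using insert.prems[of p] by blast
  obtain \<psi> \<Psi> k where \<psi>: "has_gradient \<psi> \<Psi> UNIV" "holder_bounded \<alpha> ?B \<psi> k" "holder_bounded \<alpha> ?B \<Psi> k"
    "\<And>x. x \<notin> ball p (?r/2) \<Longrightarrow> \<psi> x = 0 \<and> \<Psi> x = 0" "\<And>x. x \<in> ball p (?r/4) \<Longrightarrow> \<psi> x = 1 \<and> \<Psi> x = 0"
    using plateau_function[OF r \<alpha>(2)] by metis
  have k: "0 \<le> k" using holder_bounded_nonneg[OF \<psi>(2)] r by auto
  define Q where "Q = 1 + (2/?r) powr \<alpha>"
  define C where "C = C1 + 4 * k * (C1 + C2) * Q"
  have Q: "0 \<le> Q" by (simp add: Q_def)
  show ?case
    unfolding extendable_def
  proof (rule exI[of _ C], intro conjI allI impI)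
    show "0 \<le> C" using C1(1) C2(1) k Q by (simp add: C_def)
    fix u :: "real^'d \<Rightarrow> real" and G c
    assume *: "has_gradient u G UNIV \<and> holder_bounded \<alpha> (closure \<omega>) u c \<and> holder_bounded \<alpha> (closure \<omega>) G c"
    then have c: "0 \<le> c" using holder_bounded_nonneg ne by blast
    obtain U GU where U: "has_gradient U GU UNIV" "holder_bounded \<alpha> UNIV U (C1 * c)" "holder_bounded \<alpha> UNIV GU (C1 * c)"
      "\<And>x. x \<in> closure \<omega> \<Longrightarrow> x \<in> (\<Union>p\<in>F. ball p (\<rho> p / 4)) \<Longrightarrow> U x = u x \<and> GU x = G x"
      using C1(2)[unfolded extendable_def, rule_format, OF *] by blast
    obtain W GW where W: "has_gradient W GW ?B" "holder_bounded \<alpha> ?B W (C2 * c)" "holder_bounded \<alpha> ?B GW (C2 * c)"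
      "\<And>x. x \<in> closure \<omega> \<Longrightarrow> x \<in> ?B \<Longrightarrow> W x = u x \<and> GW x = G x"
      using C2(2)[unfolded extendable_def, rule_format, OF *] by blast
    define V where "V = (\<lambda>x. \<psi> x * (W x - U x))"
    define GV where "GV = (\<lambda>x. if x \<in> ?B then \<psi> x *\<^sub>R (GW x - GU x) + (W x - U x) *\<^sub>R \<Psi> x else 0)"
    have gr: "has_gradient (\<lambda>x. U x + V x) (\<lambda>x. GU x + GV x) UNIV"
      unfolding V_def GV_def using U(1) W(1) \<psi>(1,4) r(1) by (rule has_gradient_blend)
    have hUB: "holder_bounded \<alpha> ?B U (C1 * c)" "holder_bounded \<alpha> ?B GU (C1 * c)"
      using U(2,3) holder_bounded_subset by blast+
    note hW = holder_bounded_diff[OF W(2) hUB(1)] and hGW = holder_bounded_diff[OF W(3) hUB(2)]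
    have le: "2 * k * (C2 * c + C1 * c) \<le> 4 * k * (C1 + C2) * c"
      using k c C1(1) C2(1) by (simp add: algebra_simps)
    have "holder_bounded \<alpha> ?B V (4 * k * (C1 + C2) * c)"
      unfolding V_def by (rule holder_bounded_mono[OF holder_bounded_mult[OF \<psi>(2) hW] le])
    then have hV: "holder_bounded \<alpha> UNIV V (4 * k * (C1 + C2) * c * Q)"
      unfolding Q_def by (rule holder_bounded_zero_extension[OF r(1) \<alpha>(1)]) (simp add: V_def \<psi>(4))
    have "holder_bounded \<alpha> ?B GV (4 * k * (C1 + C2) * c)"
    proof (rule holder_bounded_cong)
      show "holder_bounded \<alpha> ?B (\<lambda>x. \<psi> x *\<^sub>R (GW x - GU x) + (W x - U x) *\<^sub>R \<Psi> x) (4 * k * (C1 + C2) * c)"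
        by (rule holder_bounded_mono[OF holder_bounded_add[OF holder_bounded_scaleR[OF \<psi>(2) hGW]
            holder_bounded_scaleR[OF hW \<psi>(3)]]]) (simp add: algebra_simps)
    qed (simp add: GV_def)
    then have hGV: "holder_bounded \<alpha> UNIV GV (4 * k * (C1 + C2) * c * Q)"
      unfolding Q_def
      by (rule holder_bounded_zero_extension[OF r(1) \<alpha>(1)]) (use \<psi>(4) in \<open>simp add: GV_def\<close>)
    have Cc: "C1 * c + 4 * k * (C1 + C2) * c * Q = C * c" by (simp add: C_def algebra_simps)
    have eq: "U x + V x = u x \<and> GU x + GV x = G x"
      if x: "x \<in> closure \<omega>" "x \<in> ball p (?r/4) \<or> x \<in> (\<Union>p\<in>F. ball p (\<rho> p / 4))" for x
    proof (cases "x \<in> ball p (?r/4)")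
      case True
      moreover have "x \<in> ?B" using True r(1) by simp
      ultimately show ?thesis using \<psi>(5)[of x] W(4)[OF x(1)] by (simp add: V_def GV_def)
    next
      case False
      then have "U x = u x \<and> GU x = G x" using x U(4) by blast
      then show ?thesis
        using W(4)[OF x(1)] \<psi>(4)[of x] r(1) by (cases "x \<in> ?B") (auto simp: V_def GV_def)
    qed
    have 1: "holder_bounded \<alpha> UNIV (\<lambda>x. U x + V x) (C * c)" "holder_bounded \<alpha> UNIV (\<lambda>x. GU x + GV x) (C * c)"
      using holder_bounded_add[OF U(2) hV] holder_bounded_add[OF U(3) hGV] unfolding Cc by auto
    show "\<exists>U GU. has_gradient U GU UNIV \<and> holder_bounded \<alpha> UNIV U (C * c) \<and> holder_bounded \<alpha> UNIV GU (C * c) \<and>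
      (\<forall>x\<in>closure \<omega> \<inter> (\<Union>p\<in>insert p F. ball p (\<rho> p / 4)). U x = u x \<and> GU x = G x)"
      by (rule exI[of _ "\<lambda>x. U x + V x"], rule exI[of _ "\<lambda>x. GU x + GV x"]) (use gr 1 eq in auto)
  qed
qed

lemma extension:
  fixes \<omega> :: "(real^'d) set"
  assumes "smooth_bounded_domain \<omega>" "0 < \<alpha>" "\<alpha> \<le> 1"
  shows "\<exists>C\<ge>0. extendable \<alpha> (closure \<omega>) UNIV UNIV C"
proof -
  have om: "closure \<omega> \<noteq> {}" "compact (closure \<omega>)"
    using assms(1) by (auto simp: smooth_bounded_domain_def compact_closure)
  obtain \<rho> where \<rho>: "\<And>p. p \<in> closure \<omega> \<Longrightarrow> 0 < \<rho> p \<and> \<rho> p \<le> 1/2 \<and> (\<exists>C\<ge>0. extendable \<alpha> (closure \<omega>) (ball p (\<rho> p)) (ball p (\<rho> p)) C)"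
  proof -
    have "\<forall>p\<in>closure \<omega>. \<exists>r. 0 < r \<and> r \<le> 1/2 \<and> (\<exists>C\<ge>0. extendable \<alpha> (closure \<omega>) (ball p r) (ball p r) C)"
      using local_extension[OF assms(1) _ assms(2,3)] by blast
    from bchoice[OF this] show thesis using that by blast
  qed
  have "closure \<omega> \<subseteq> (\<Union>p\<in>closure \<omega>. ball p (\<rho> p / 4))" using \<rho> by force
  then obtain F where F: "F \<subseteq> closure \<omega>" "finite F" "closure \<omega> \<subseteq> (\<Union>p\<in>F. ball p (\<rho> p / 4))"
    using compactE_image[OF om(2), of "closure \<omega>" "\<lambda>p. ball p (\<rho> p / 4)"] by blast
  then have Int: "closure \<omega> \<inter> (\<Union>p\<in>F. ball p (\<rho> p / 4)) = closure \<omega>" by blast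
  show ?thesis
    using extension_finite_cover[OF assms(2,3) om(1) F(2), of \<rho>] \<rho> F(1)
    unfolding extendable_def Int by (simp add: subset_iff)
qed

section \<open>Convergent series of functions with Hoelder gradients\<close>

lemma has_gradient_series:
  fixes u :: "nat \<Rightarrow> 'a::euclidean_space \<Rightarrow> real"
  assumes "\<And>i. has_gradient (u i) (G i) UNIV" "summable c" "0 < \<alpha>"
    and "\<And>i. holder_bounded \<alpha> UNIV (u i) (c i)" "\<And>i. holder_bounded \<alpha> UNIV (G i) (c i)"
  shows "has_gradient (\<lambda>x. \<Sum>i. u i x) (\<lambda>x. \<Sum>i. G i x) UNIV"
    and "holder_bounded \<alpha> UNIV (\<lambda>x. \<Sum>i. G i x) (\<Sum>i. c i)"
    and "\<And>x. (\<lambda>i. u i x) sums (\<Sum>i. u i x)" and "\<And>x. (\<lambda>i. G i x) sums (\<Sum>i. G i x)"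
proof -
  have bu: "norm (u i x) \<le> c i" and bG: "norm (G i x) \<le> c i"
    and bH: "norm (G i x - G i y) \<le> c i * dist x y powr \<alpha>" for i x y
    using assms(4,5) unfolding holder_bounded_def by auto
  have su: "summable (\<lambda>i. u i x)" for x by (rule summable_comparison_test'[OF assms(2)]) (rule bu)
  have sG: "summable (\<lambda>i. G i x)" for x by (rule summable_comparison_test'[OF assms(2)]) (rule bG)
  have snG: "summable (\<lambda>i. norm (G i x))" for x
    by (rule summable_comparison_test'[OF assms(2)]) (simp add: bG)
  show sums_u: "(\<lambda>i. u i x) sums (\<Sum>i. u i x)" for x using su by (rule summable_sums)
  show "(\<lambda>i. G i x) sums (\<Sum>i. G i x)" for x using sG by (rule summable_sums)
  have "norm (\<Sum>i. G i x) \<le> (\<Sum>i. c i)" for x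
    using order_trans[OF summable_norm[OF snG] suminf_le[OF bG snG assms(2)]] by simp
  moreover have "norm ((\<Sum>i. G i x) - (\<Sum>i. G i y)) \<le> (\<Sum>i. c i) * dist x y powr \<alpha>" for x y
  proof -
    have s1: "summable (\<lambda>i. c i * dist x y powr \<alpha>)" by (intro summable_mult2 assms)
    have s2: "summable (\<lambda>i. norm (G i x - G i y))"
      by (rule summable_comparison_test'[OF s1]) (simp add: bH)
    have "norm ((\<Sum>i. G i x) - (\<Sum>i. G i y)) = norm (\<Sum>i. G i x - G i y)"
      by (simp add: suminf_diff[OF sG sG])
    also have "\<dots> \<le> (\<Sum>i. c i * dist x y powr \<alpha>)"
      using order_trans[OF summable_norm[OF s2] suminf_le[OF bH s2 s1]] by simp
    finally show ?thesis by (simp add: suminf_mult2[OF assms(2)])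
  qed
  ultimately show "holder_bounded \<alpha> UNIV (\<lambda>x. \<Sum>i. G i x) (\<Sum>i. c i)"
    unfolding holder_bounded_def by blast
  have "\<exists>g. \<forall>x\<in>UNIV. (\<lambda>n. u n x) sums g x \<and> (g has_derivative (\<lambda>h. (\<Sum>i. G i x) \<bullet> h)) (at x within UNIV)"
  proof (rule has_derivative_series)
    show "(u n has_derivative (\<lambda>h. G n x \<bullet> h)) (at x within UNIV)" for n x
      using assms(1) by (simp add: has_gradient_def)
    show "(\<lambda>n. u n 0) sums (\<Sum>i. u i 0)" by (rule sums_u)
    fix e :: real assume e: "e > 0"
    have "(\<lambda>n. \<Sum>i<n. c i) \<longlonglongrightarrow> (\<Sum>i. c i)" using assms(2) by (rule summable_LIMSEQ)
    then have "\<forall>\<^sub>F n in sequentially. dist (\<Sum>i<n. c i) (\<Sum>i. c i) < e" using e by (rule tendstoD)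
    then show "\<forall>\<^sub>F n in sequentially. \<forall>x\<in>UNIV. \<forall>h. norm ((\<Sum>i<n. G i x \<bullet> h) - (\<Sum>i. G i x) \<bullet> h) \<le> e * norm h"
    proof eventually_elim
      case (elim n)
      have "norm ((\<Sum>i<n. G i x \<bullet> h) - (\<Sum>i. G i x) \<bullet> h) \<le> e * norm h" for x h
      proof -
        have cs: "summable (\<lambda>i. c (i + n))" by (rule summable_ignore_initial_segment[OF assms(2)])
        have ns: "summable (\<lambda>i. norm (G (i + n) x))" by (rule summable_ignore_initial_segment[OF snG])
        have "(\<Sum>i. G i x) - (\<Sum>i<n. G i x) = (\<Sum>i. G (i + n) x)"
          using suminf_split_initial_segment[OF sG, of x n] by simp
        then have "norm ((\<Sum>i. G i x) - (\<Sum>i<n. G i x)) \<le> (\<Sum>i. c (i + n))"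
          using order_trans[OF summable_norm[OF ns] suminf_le[OF bG ns cs]] by simp
        also have "\<dots> = (\<Sum>i. c i) - (\<Sum>i<n. c i)"
          using suminf_split_initial_segment[OF assms(2), of n] by simp
        also have "\<dots> \<le> e" using elim by (simp add: dist_real_def)
        finally have le: "norm ((\<Sum>i<n. G i x) - (\<Sum>i. G i x)) \<le> e" by (simp add: norm_minus_commute)
        have "norm (((\<Sum>i<n. G i x) - (\<Sum>i. G i x)) \<bullet> h) \<le> norm ((\<Sum>i<n. G i x) - (\<Sum>i. G i x)) * norm h"
          using Cauchy_Schwarz_ineq2 by simp
        also have "\<dots> \<le> e * norm h" using le by (rule mult_right_mono) simp
        finally show ?thesis by (simp add: inner_diff_left inner_sum_left)
      qed
      then show ?case by blast
    qed
  qed auto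
  then obtain g where g: "\<And>x. (\<lambda>n. u n x) sums g x" "\<And>x. (g has_derivative (\<lambda>h. (\<Sum>i. G i x) \<bullet> h)) (at x)" by auto
  then have "g = (\<lambda>x. \<Sum>i. u i x)" by (simp add: fun_eq_iff sums_iff)
  then show "has_gradient (\<lambda>x. \<Sum>i. u i x) (\<lambda>x. \<Sum>i. G i x) UNIV" using g(2) by (simp add: has_gradient_def)
qed

text \<open>The extensions are summed rather than the functions, so that the limit is global.\<close>

lemma extension_series:
  fixes \<omega> :: "(real^'d) set" and f :: "nat \<Rightarrow> real^'d \<Rightarrow> real^'m"
  assumes "smooth_bounded_domain \<omega>" "0 < \<alpha>" "\<alpha> \<le> 1"
    and f: "\<And>i x. f i differentiable (at x)" and c: "summable c"
    and hf: "\<And>i. holder_bounded \<alpha> (closure \<omega>) (f i) (c i)"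
    and hG: "\<And>i. holder_bounded \<alpha> (closure \<omega>) (grad (f i)) (c i)"
  shows "\<exists>F. C1_holder \<alpha> F \<and> (\<forall>x\<in>closure \<omega>. (\<lambda>i. f i x) sums F x \<and> (\<forall>k. (\<lambda>i. partial k (f i) x) sums partial k F x))"
proof -
  obtain C where C: "C \<ge> 0" "extendable \<alpha> (closure \<omega>) UNIV UNIV C"
    using extension[OF assms(1-3)] by blast
  \<comment> \<open>\<open>extendable\<close> concerns scalar functions, so every component
    \<open>j\<close> is extended separately, with the same bound \<open>c i\<close>.\<close>
  define u where "u = (\<lambda>j i x. f i x $ j)"
  define G where "G = (\<lambda>j i x. \<chi> k. partial k (f i) x $ j)"
  have "has_gradient (u j i) (G j i) UNIV" for i j
    unfolding has_gradient_def
  proof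
    fix x
    have "((\<lambda>x. f i x $ j) has_derivative (\<lambda>h. (\<Sum>k\<in>UNIV. (h $ k) *\<^sub>R partial k (f i) x) $ j)) (at x)"
      by (rule bounded_linear.has_derivative[OF bounded_linear_vec_nth has_derivative_partial[OF f]])
    then show "(u j i has_derivative (\<lambda>h. G j i x \<bullet> h)) (at x)"
      by (simp add: u_def G_def inner_vec_def mult.commute)
  qed
  moreover have "holder_bounded \<alpha> (closure \<omega>) (u j i) (c i)" for i j
  proof -
    have "norm (u j i x) \<le> norm (f i x)" "norm (u j i x - u j i y) \<le> norm (f i x - f i y)" for x y
      using Finite_Cartesian_Product.norm_nth_le[of "f i x" j] Finite_Cartesian_Product.norm_nth_le[of "f i x - f i y" j] by (auto simp: u_def)
    then show ?thesis using hf[of i] unfolding holder_bounded_def by (meson order_trans)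
  qed
  moreover have "holder_bounded \<alpha> (closure \<omega>) (G j i) (c i)" for i j
  proof -
    have "norm (G j i x) \<le> norm (grad (f i) x)" for x
      by (rule norm_le_componentwise_cart) (auto simp: G_def grad_def component_le_norm_cart)
    moreover have "norm (G j i x - G j i y) \<le> norm (grad (f i) x - grad (f i) y)" for x y
    proof (rule norm_le_componentwise_cart)
      fix k
      show "norm ((G j i x - G j i y) $ k) \<le> norm ((grad (f i) x - grad (f i) y) $ k)"
        using component_le_norm_cart[of "partial k (f i) x - partial k (f i) y" j]
        by (simp add: G_def grad_def)
    qed
    ultimately show ?thesis using hG[of i] unfolding holder_bounded_def by (meson order_trans)
  qed
  moreover define Q where "Q = (\<lambda>j i U GU. has_gradient U GU UNIV \<and> holder_bounded \<alpha> UNIV U (C * c i) \<and>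
      holder_bounded \<alpha> UNIV GU (C * c i) \<and> (\<forall>x\<in>closure \<omega>. U x = u j i x \<and> GU x = G j i x))"
  ultimately have "\<exists>U GU. Q j i U GU" for i j
    using C(2) unfolding extendable_def by simp
  then obtain U GU where "\<And>i j. Q j i (U j i) (GU j i)" by metis
  then have U: "\<And>i j. has_gradient (U j i) (GU j i) UNIV"
    "\<And>i j. holder_bounded \<alpha> UNIV (U j i) (C * c i)" "\<And>i j. holder_bounded \<alpha> UNIV (GU j i) (C * c i)"
    "\<And>i j x. x \<in> closure \<omega> \<Longrightarrow> U j i x = u j i x \<and> GU j i x = G j i x"
    unfolding Q_def by blast+
  \<comment> \<open>The bound on an extension is linear in the bound on the closure, so summability
    survives.\<close>
  have Cc: "summable (\<lambda>i. C * c i)" using c by (rule summable_mult)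
  note S = has_gradient_series[where u = "U j" and G = "GU j" for j, OF U(1) Cc assms(2) U(2,3)]
  define F where "F = (\<lambda>x. \<chi> j. \<Sum>i. U j i x)"
  define H where "H = (\<lambda>x. \<chi> k. \<chi> j. (\<Sum>i. GU j i x) $ k)"
  have dF: "(F has_derivative (\<lambda>h. \<chi> j. (\<Sum>i. GU j i x) \<bullet> h)) (at x)" for x
    unfolding F_def using S(1) by (intro has_derivative_vec_lambda) (simp add: has_gradient_def)
  have pF: "partial k F x = H x $ k" for k x
    unfolding partial_eq[OF dF] by (simp add: H_def vec_eq_iff inner_axis)
  have gF: "grad F = H" by (simp add: fun_eq_iff grad_def pF vec_eq_iff)
  let ?L = "real CARD('d) * (real CARD('m) * (\<Sum>i. C * c i))"
  have hol: "norm (H x - H y) \<le> ?L * dist x y powr \<alpha>" for x y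
  proof -
    have "norm (H x - H y) \<le> real CARD('d) * (real CARD('m) * ((\<Sum>i. C * c i) * dist x y powr \<alpha>))"
    proof (rule norm_vec_le_card, rule norm_vec_le_card)
      fix k j
      have "norm ((H x - H y) $ k $ j) = norm (((\<Sum>i. GU j i x) - (\<Sum>i. GU j i y)) $ k)" by (simp add: H_def)
      also have "\<dots> \<le> norm ((\<Sum>i. GU j i x) - (\<Sum>i. GU j i y))" by (rule Finite_Cartesian_Product.norm_nth_le)
      also have "\<dots> \<le> (\<Sum>i. C * c i) * dist x y powr \<alpha>" using S(2) unfolding holder_bounded_def by blast
      finally show "norm ((H x - H y) $ k $ j) \<le> (\<Sum>i. C * c i) * dist x y powr \<alpha>" .
    qed
    then show ?thesis by (simp add: mult.assoc)
  qed
  have "continuous_on UNIV H" by (rule holder_imp_continuous[OF assms(2) hol])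
  then have "C_class 1 F"
    using dF by (auto simp: differentiable_def pF fun_eq_iff intro!: continuous_intros
      cong: continuous_on_cong)
  moreover have "holder \<alpha> (grad F)" unfolding holder_def gF using hol by blast
  moreover have "(\<lambda>i. f i x) sums F x" "(\<lambda>i. partial k (f i) x) sums partial k F x" if "x \<in> closure \<omega>" for x k
  proof -
    have *: "(\<lambda>i. f i x $ j) sums (F x $ j)" for j
      using S(3)[of j x] U(4)[OF that] by (simp add: F_def u_def)
    then show "(\<lambda>i. f i x) sums F x"
      unfolding sums_def by (intro vec_tendstoI) (simp add: sum_component[symmetric] del: sum_component)
    have "(\<lambda>i. GU j i x $ k) sums ((\<Sum>i. GU j i x) $ k)" for j
      using S(4)[of j x] unfolding sums_def by (auto dest!: tendsto_vec_nth[where i=k])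
    then have "(\<lambda>i. partial k (f i) x $ j) sums (partial k F x $ j)" for j
      using U(4)[OF that] by (simp add: pF H_def G_def)
    then show "(\<lambda>i. partial k (f i) x) sums partial k F x"
      unfolding sums_def by (intro vec_tendstoI) simp
  qed
  ultimately show ?thesis unfolding C1_holder_def by blast
qed

section \<open>Families with polynomially bounded derivatives\<close>

text \<open>The base \<open>N p + 1\<close> is at least 1, so bounds of different degrees can be
  compared. The degree stays existential because a frequency chosen later can beat any
  degree.\<close>

definition poly_bounded :: "('p \<Rightarrow> nat) \<Rightarrow> 'a set \<Rightarrow> ('p \<Rightarrow> 'a \<Rightarrow> real) \<Rightarrow> bool" where
  "poly_bounded N X F \<longleftrightarrow> (\<exists>K q. \<forall>p. \<forall>x\<in>X. \<bar>F p x\<bar> \<le> K * real (N p + 1) ^ q)"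

text \<open>Every derivative may have its own degree of growth. This makes the class closed under
  products, differentiation and insertion of oscillations of polynomial frequency, without any
  bookkeeping of exponents. Smoothness is global, growth is measured on \<open>X\<close>
  only.\<close>

primrec tame :: "('p \<Rightarrow> nat) \<Rightarrow> (real^'d) set \<Rightarrow> nat \<Rightarrow> ('p \<Rightarrow> real^'d \<Rightarrow> real) \<Rightarrow> bool" where
  "tame N X 0 F \<longleftrightarrow> (\<forall>p. continuous_on UNIV (F p)) \<and> poly_bounded N X F"
| "tame N X (Suc m) F \<longleftrightarrow> (\<forall>p x. F p differentiable (at x)) \<and> poly_bounded N X F \<and>
     (\<forall>i. tame N X m (\<lambda>p. partial i (F p)))"

section \<open>Closure properties of tame families\<close>

lemma poly_boundedE:
  assumes "poly_bounded N X F"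
  obtains K q where "0 \<le> K" "\<And>p x. x \<in> X \<Longrightarrow> \<bar>F p x\<bar> \<le> K * real (N p + 1) ^ q"
proof -
  obtain K q where *: "\<And>p x. x \<in> X \<Longrightarrow> \<bar>F p x\<bar> \<le> K * real (N p + 1) ^ q"
    using assms unfolding poly_bounded_def by blast
  have "\<bar>F p x\<bar> \<le> \<bar>K\<bar> * real (N p + 1) ^ q" if "x \<in> X" for p x
    by (rule order_trans[OF *[OF that]]) (intro mult_right_mono, auto)
  then show thesis using that[of "\<bar>K\<bar>" q] by simp
qed

lemma poly_bounded_add:
  assumes "poly_bounded N X F" "poly_bounded N X G"
  shows "poly_bounded N X (\<lambda>p x. F p x + G p x)"
proof -
  obtain K q L r where *: "0 \<le> K" "0 \<le> L" "\<And>p x. x \<in> X \<Longrightarrow> \<bar>F p x\<bar> \<le> K * real (N p + 1) ^ q"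
    "\<And>p x. x \<in> X \<Longrightarrow> \<bar>G p x\<bar> \<le> L * real (N p + 1) ^ r"
    using assms poly_boundedE by metis
  have "\<bar>F p x + G p x\<bar> \<le> (K + L) * real (N p + 1) ^ (q + r)" if "x \<in> X" for p x
  proof -
    have "\<bar>F p x + G p x\<bar> \<le> \<bar>F p x\<bar> + \<bar>G p x\<bar>" by simp
    also have "\<dots> \<le> K * real (N p + 1) ^ q + L * real (N p + 1) ^ r"
      using *(3,4) that by (intro add_mono)
    also have "\<dots> \<le> K * real (N p + 1) ^ (q + r) + L * real (N p + 1) ^ (q + r)"
      using * by (intro add_mono mult_left_mono power_increasing) auto
    finally show ?thesis by (simp add: distrib_right)
  qed
  then show ?thesis unfolding poly_bounded_def by blast
qed

lemma poly_bounded_mult: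
  assumes "poly_bounded N X F" "poly_bounded N X G"
  shows "poly_bounded N X (\<lambda>p x. F p x * G p x)"
proof -
  obtain K q L r where *: "0 \<le> K" "0 \<le> L" "\<And>p x. x \<in> X \<Longrightarrow> \<bar>F p x\<bar> \<le> K * real (N p + 1) ^ q"
    "\<And>p x. x \<in> X \<Longrightarrow> \<bar>G p x\<bar> \<le> L * real (N p + 1) ^ r"
    using assms poly_boundedE by metis
  have "\<bar>F p x * G p x\<bar> \<le> (K * L) * real (N p + 1) ^ (q + r)" if "x \<in> X" for p x
  proof -
    have "\<bar>F p x * G p x\<bar> \<le> (K * real (N p + 1) ^ q) * (L * real (N p + 1) ^ r)"
      unfolding abs_mult using *(3,4) that *(1) by (intro mult_mono) auto
    then show ?thesis by (simp add: power_add mult_ac)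
  qed
  then show ?thesis unfolding poly_bounded_def by blast
qed

lemma poly_bounded_const: "(\<And>p x. x \<in> X \<Longrightarrow> \<bar>F p x\<bar> \<le> K) \<Longrightarrow> poly_bounded N X F"
  unfolding poly_bounded_def by (intro exI[of _ K] exI[of _ 0]) simp

lemma poly_bounded_sum:
  "finite I \<Longrightarrow> (\<And>i. i \<in> I \<Longrightarrow> poly_bounded N X (F i)) \<Longrightarrow> poly_bounded N X (\<lambda>p x. \<Sum>i\<in>I. F i p x)"
  by (induction I rule: finite_induct) (auto intro: poly_bounded_add poly_bounded_const[of _ _ 0])

lemma poly_bounded_abs: "poly_bounded N X F \<Longrightarrow> poly_bounded N X (\<lambda>p x. \<bar>F p x\<bar>)"
  unfolding poly_bounded_def by simp

lemma tame_poly_bounded: "tame N X m F \<Longrightarrow> poly_bounded N X F"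
  by (cases m) auto

lemma tame_Suc_imp: "tame N X (Suc m) F \<Longrightarrow> tame N X m F"
proof (induction m arbitrary: F)
  case 0
  then show ?case
    by (simp add: differentiable_imp_continuous_on differentiable_on_def differentiable_at_withinI)
qed auto

lemma tame_C_class: "tame N X m F \<Longrightarrow> C_class m (F p)"
  by (induction m arbitrary: F) auto

lemma tame_add: "tame N X m F \<Longrightarrow> tame N X m G \<Longrightarrow> tame N X m (\<lambda>p x. F p x + G p x)"
proof (induction m arbitrary: F G)
  case (Suc m)
  then have "(\<lambda>p. partial i (\<lambda>x. F p x + G p x)) = (\<lambda>p x. partial i (F p) x + partial i (G p) x)" for i
    by (simp add: fun_eq_iff partial_add)
  with Suc show ?case by (simp add: poly_bounded_add)
qed (auto intro: continuous_intros poly_bounded_add)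

lemma partial_mult:
  fixes f g :: "real^'d \<Rightarrow> real"
  assumes "f differentiable (at x)" "g differentiable (at x)"
  shows "partial i (\<lambda>x. f x * g x) x = partial i f x * g x + f x * partial i g x"
proof -
  have "((\<lambda>x. f x * g x) has_derivative
      (\<lambda>h. f x * frechet_derivative g (at x) h + frechet_derivative f (at x) h * g x)) (at x)"
    using assms unfolding frechet_derivative_works by (rule has_derivative_mult)
  from partial_eq[OF this] show ?thesis by (simp add: partial_def)
qed

lemma tame_mult: "tame N X m F \<Longrightarrow> tame N X m G \<Longrightarrow> tame N X m (\<lambda>p x. F p x * G p x)"
proof (induction m arbitrary: F G)
  case (Suc m)
  then have "(\<lambda>p. partial i (\<lambda>x. F p x * G p x)) =
      (\<lambda>p x. partial i (F p) x * G p x + F p x * partial i (G p) x)" for i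
    by (simp add: fun_eq_iff partial_mult)
  moreover have "tame N X m F" "tame N X m G" using Suc.prems by (blast intro: tame_Suc_imp)+
  ultimately show ?case using Suc by (simp add: poly_bounded_mult tame_add)
qed (auto intro: continuous_intros poly_bounded_mult)

lemma partial_const: "partial i (\<lambda>x. c) = (\<lambda>x. 0)"
  by (rule ext) (rule partial_eq[OF has_derivative_const])

lemma tame_seq:
  assumes "\<And>p. \<bar>c p\<bar> \<le> K * real (N p + 1) ^ q"
  shows "tame N X m (\<lambda>p x. c p)"
  using assms
proof (induction m arbitrary: c K)
  case (Suc m)
  have "tame N X m (\<lambda>p x. 0)" by (rule Suc.IH[of _ 0]) simp
  with Suc.prems show ?case by (auto simp: poly_bounded_def partial_const)
qed (auto simp: poly_bounded_def)

lemma tame_const: "tame N X m (\<lambda>p x. c)"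
  by (rule tame_seq[of _ "\<bar>c\<bar>" _ 0]) simp

lemma tame_diff: "tame N X m F \<Longrightarrow> tame N X m G \<Longrightarrow> tame N X m (\<lambda>p x. F p x - G p x)"
  using tame_add[OF _ tame_mult[OF tame_const[of _ _ _ "-1"]]] by fastforce

lemma tame_sum:
  "finite I \<Longrightarrow> (\<And>i. i \<in> I \<Longrightarrow> tame N X m (F i)) \<Longrightarrow> tame N X m (\<lambda>p x. \<Sum>i\<in>I. F i p x)"
  by (induction I rule: finite_induct) (auto intro: tame_add tame_const)

lemma tame_prod:
  "finite I \<Longrightarrow> (\<And>i. i \<in> I \<Longrightarrow> tame N X m (F i)) \<Longrightarrow> tame N X m (\<lambda>p x. \<Prod>i\<in>I. F i p x)"
  by (induction I rule: finite_induct) (auto intro: tame_mult tame_const)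

lemma tame_coordinate:
  fixes X :: "(real^'d) set"
  assumes "bounded X"
  shows "tame N X m (\<lambda>p x. x $ k)"
proof -
  obtain B where B: "\<And>x. x \<in> X \<Longrightarrow> norm x \<le> B" using assms bounded_iff by blast
  have "\<bar>x $ k\<bar> \<le> B" if "x \<in> X" for x using B[OF that] component_le_norm_cart[of x k] by simp
  then have pb: "poly_bounded N X (\<lambda>p x. x $ k)" by (rule poly_bounded_const)
  have d: "((\<lambda>x. x $ k) has_derivative (\<lambda>h. h $ k)) (at x)" for x :: "real^'d"
    by (rule bounded_linear.has_derivative[OF bounded_linear_vec_nth has_derivative_ident])
  show ?thesis
  proof (cases m)
    case (Suc n)
    have "partial i (\<lambda>x::real^'d. x $ k) = (\<lambda>x. axis i 1 $ k)" for i
      by (simp add: fun_eq_iff partial_eq[OF d])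
    then show ?thesis using Suc pb d tame_const by (auto simp: differentiable_def)
  qed (auto simp: pb intro: continuous_intros)
qed

lemma partial_sin_cos:
  fixes \<eta> :: "real^'d"
  shows "(\<lambda>x. sin (c * (\<eta> \<bullet> x))) differentiable (at x)" "(\<lambda>x. cos (c * (\<eta> \<bullet> x))) differentiable (at x)"
    "partial i (\<lambda>x. sin (c * (\<eta> \<bullet> x))) x = c * \<eta> $ i * cos (c * (\<eta> \<bullet> x))"
    "partial i (\<lambda>x. cos (c * (\<eta> \<bullet> x))) x = - (c * \<eta> $ i) * sin (c * (\<eta> \<bullet> x))"
proof -
  have 1: "((\<lambda>x. sin (c * (\<eta> \<bullet> x))) has_derivative (\<lambda>h. c * (\<eta> \<bullet> h) * cos (c * (\<eta> \<bullet> x)))) (at x)"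
    and 2: "((\<lambda>x. cos (c * (\<eta> \<bullet> x))) has_derivative (\<lambda>h. - (c * (\<eta> \<bullet> h)) * sin (c * (\<eta> \<bullet> x)))) (at x)"
    by (auto intro!: derivative_eq_intros)
  show "(\<lambda>x. sin (c * (\<eta> \<bullet> x))) differentiable (at x)" "(\<lambda>x. cos (c * (\<eta> \<bullet> x))) differentiable (at x)"
    using 1 2 by (auto intro: differentiableI)
  show "partial i (\<lambda>x. sin (c * (\<eta> \<bullet> x))) x = c * \<eta> $ i * cos (c * (\<eta> \<bullet> x))"
    "partial i (\<lambda>x. cos (c * (\<eta> \<bullet> x))) x = - (c * \<eta> $ i) * sin (c * (\<eta> \<bullet> x))"
    unfolding partial_eq[OF 1] partial_eq[OF 2] by (simp_all add: inner_axis)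
qed

text \<open>Sine and cosine are treated together because differentiation exchanges them; each
  derivative costs one factor \<open>c p\<close>, which is polynomial.\<close>

lemma tame_sin_cos:
  assumes "\<And>p. \<bar>c p\<bar> \<le> K * real (N p + 1) ^ q"
  shows "tame N X m (\<lambda>p x. sin (c p * (\<eta> \<bullet> x))) \<and> tame N X m (\<lambda>p x. cos (c p * (\<eta> \<bullet> x)))"
proof (induction m)
  case 0
  show ?case by (auto intro!: continuous_intros poly_bounded_const[of _ _ 1])
next
  case (Suc m)
  have "tame N X m (\<lambda>p x. c p)" by (rule tame_seq[OF assms])
  then have "tame N X m (\<lambda>p x. c p * \<eta> $ i * cos (c p * (\<eta> \<bullet> x)))"
    "tame N X m (\<lambda>p x. (- 1) * (c p * \<eta> $ i) * sin (c p * (\<eta> \<bullet> x)))" for i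
    using Suc by (intro tame_mult tame_const; blast)+
  moreover have "(\<lambda>p. partial i (\<lambda>x. sin (c p * (\<eta> \<bullet> x)))) = (\<lambda>p x. c p * \<eta> $ i * cos (c p * (\<eta> \<bullet> x)))"
    "(\<lambda>p. partial i (\<lambda>x. cos (c p * (\<eta> \<bullet> x)))) = (\<lambda>p x. (- 1) * (c p * \<eta> $ i) * sin (c p * (\<eta> \<bullet> x)))" for i
    by (simp_all add: fun_eq_iff partial_sin_cos)
  ultimately show ?case by (simp add: partial_sin_cos poly_bounded_const[of _ _ 1] del: mult_minus_left)
qed

text \<open>A Bernstein polynomial has a number of terms that grows with its degree. The summands
  are therefore a single family indexed by pairs, with bounds uniform in the second index, and the
  number of terms only has to be polynomial.\<close>

lemma tame_sum_family:
  assumes "\<And>n. finite (S n)" "\<And>n. real (card (S n)) \<le> K * real (N n + 1) ^ q"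
  shows "tame (\<lambda>p. N (fst p)) X m F \<Longrightarrow> tame N X m (\<lambda>n x. \<Sum>k\<in>S n. F (n, k) x)"
proof (induction m arbitrary: F)
  have pb: "poly_bounded N X (\<lambda>n x. \<Sum>k\<in>S n. F (n, k) x)" if F: "poly_bounded (\<lambda>p. N (fst p)) X F" for F
  proof -
    obtain L r where *: "0 \<le> L" "\<And>p x. x \<in> X \<Longrightarrow> \<bar>F p x\<bar> \<le> L * real (N (fst p) + 1) ^ r"
      using poly_boundedE[OF F] by blast
    have "\<bar>\<Sum>k\<in>S n. F (n, k) x\<bar> \<le> (K * L) * real (N n + 1) ^ (q + r)" if "x \<in> X" for n x
    proof -
      have "\<bar>\<Sum>k\<in>S n. F (n, k) x\<bar> \<le> (\<Sum>k\<in>S n. \<bar>F (n, k) x\<bar>)" by (rule sum_abs)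
      also have "\<dots> \<le> (\<Sum>k\<in>S n. L * real (N n + 1) ^ r)"
        using *(2)[OF that, of "(n, k)" for k] by (intro sum_mono) simp
      also have "\<dots> = real (card (S n)) * (L * real (N n + 1) ^ r)" by simp
      also have "\<dots> \<le> K * real (N n + 1) ^ q * (L * real (N n + 1) ^ r)"
        using assms(2) *(1) by (intro mult_right_mono) auto
      finally show ?thesis by (simp add: power_add mult_ac)
    qed
    then show ?thesis unfolding poly_bounded_def by blast
  qed
  {
    case 0
    then show ?case using pb[of F] by (auto intro!: continuous_on_sum)
  next
    case (Suc m)
    have d: "((\<lambda>x. \<Sum>k\<in>S n. F (n, k) x) has_derivative
        (\<lambda>h. \<Sum>k\<in>S n. frechet_derivative (F (n, k)) (at x) h)) (at x)" for n x
      using Suc.prems by (intro has_derivative_sum) (simp flip: frechet_derivative_works)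
    have "partial i (\<lambda>x. \<Sum>k\<in>S n. F (n, k) x) = (\<lambda>x. \<Sum>k\<in>S n. partial i (F (n, k)) x)" for i n
      by (simp add: fun_eq_iff partial_eq[OF d]) (simp add: partial_def)
    then show ?case
      using Suc.prems pb[of F] differentiableI[OF d] Suc.IH[of "\<lambda>p. partial i (F p)" for i]
      by simp
  }
qed

subsection \<open>Bernstein polynomials of Hoelder functions\<close>

text \<open>The case distinction replaces the convention that the polynomial with index -1 is 0,
  since \<open>k - 1\<close> is truncated on the naturals.\<close>

lemma has_derivative_Bernstein:
  "(Bernstein n k has_real_derivative
    real n * ((if k = 0 then 0 else Bernstein (n - 1) (k - 1) y) - Bernstein (n - 1) k y)) (at y)"
proof -
  have "(Bernstein n k has_real_derivative
     real (n choose k) * (real k * y ^ (k - 1)) * (1 - y) ^ (n - k)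
      - real (n choose k) * y ^ k * (real (n - k) * (1 - y) ^ (n - k - 1))) (at y)"
    unfolding Bernstein_def[abs_def] by (auto intro!: derivative_eq_intros)
  moreover have "real (n choose k) * (real k * y ^ (k - 1)) * (1 - y) ^ (n - k)
      = real n * (if k = 0 then 0 else Bernstein (n - 1) (k - 1) y)"
  proof (cases "k = 0")
    case False
    then have "real k * real (n choose k) = real n * real (n - 1 choose (k - 1))"
      using times_binomial_minus1_eq[of k n] by (metis neq0_conv of_nat_mult)
    moreover have "n - 1 - (k - 1) = n - k" using False by simp
    moreover have "real (n choose k) * (real k * y ^ (k - 1)) * (1 - y) ^ (n - k)
        = (real k * real (n choose k)) * y ^ (k - 1) * (1 - y) ^ (n - k)" by (simp only: mult_ac)
    ultimately have "real (n choose k) * (real k * y ^ (k - 1)) * (1 - y) ^ (n - k)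
        = real n * real (n - 1 choose (k - 1)) * y ^ (k - 1) * (1 - y) ^ (n - 1 - (k - 1))" by (simp only:)
    then show ?thesis using False by (simp only: Bernstein_def mult.assoc if_False)
  qed simp
  moreover have "real (n choose k) * y ^ k * (real (n - k) * (1 - y) ^ (n - k - 1))
      = real n * Bernstein (n - 1) k y"
  proof -
    have "real (n - k) * real (n choose k) = real n * real (n - 1 choose k)"
      using binomial_absorb_comp[of n k] by (metis of_nat_mult)
    moreover have "real (n choose k) * y ^ k * (real (n - k) * (1 - y) ^ (n - k - 1))
        = (real (n - k) * real (n choose k)) * y ^ k * (1 - y) ^ (n - k - 1)" by (simp only: mult_ac)
    ultimately have "real (n choose k) * y ^ k * (real (n - k) * (1 - y) ^ (n - k - 1))
        = real n * real (n - 1 choose k) * y ^ k * (1 - y) ^ (n - 1 - k)" by (simp only: diff_commute)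
    then show ?thesis by (simp only: Bernstein_def mult.assoc)
  qed
  ultimately show ?thesis by (simp add: right_diff_distrib)
qed

lemma abs_Bernstein_le_1:
  assumes "0 \<le> y" "y \<le> 1"
  shows "\<bar>Bernstein n k y\<bar> \<le> 1"
proof (cases "k \<le> n")
  case True
  then have "Bernstein n k y \<le> (\<Sum>k\<le>n. Bernstein n k y)"
    using assms by (intro member_le_sum) (auto intro: Bernstein_nonneg)
  then show ?thesis using Bernstein_nonneg[OF assms] by simp
qed (simp add: Bernstein_def binomial_eq_0)

text \<open>This is the variance \<open>y * (1 - y) / n\<close> of the mean of \<open>n\<close>
  Bernoulli variables, obtained from the first two factorial moments.\<close>

lemma Bernstein_variance:
  assumes "0 < n" "0 \<le> y" "y \<le> 1"
  shows "(\<Sum>k\<le>n. Bernstein n k y * (real k / real n - y)\<^sup>2) \<le> 1 / real n"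
proof -
  have "real n ^ 2 * (\<Sum>k\<le>n. Bernstein n k y * (real k / real n - y)\<^sup>2)
      = (\<Sum>k\<le>n. real k * (real k - 1) * Bernstein n k y + (1 - 2 * real n * y) * (real k * Bernstein n k y)
          + (real n * y)\<^sup>2 * Bernstein n k y)"
    unfolding sum_distrib_left using assms(1)
    by (intro sum.cong) (auto simp: power2_eq_square field_simps)
  also have "\<dots> = real n * (real n - 1) * y\<^sup>2 + (1 - 2 * real n * y) * (real n * y) + (real n * y)\<^sup>2 * 1"
    by (simp only: sum.distrib sum_kk_Bernstein sum_k_Bernstein sum_Bernstein flip: sum_distrib_left)
  also have "\<dots> = real n * (y * (1 - y))" by (simp add: power2_eq_square algebra_simps)
  also have "\<dots> \<le> real n * 1" using assms mult_mono[of y 1 "1 - y" 1] by (intro mult_left_mono) auto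
  finally show ?thesis using assms(1) by (simp add: field_simps power2_eq_square)
qed

text \<open>A derivative lowers the degree by one and costs a factor equal to the degree, so the
  induction has to run over all degree and index functions with degree at most
  \<open>N p + 1\<close>. On the cube the rescaled coordinate lies in [0,1], where the values are
  bounded by 1.\<close>

lemma tame_Bernstein:
  fixes X :: "(real^'d) set"
  assumes "0 < R" "\<And>x. x \<in> X \<Longrightarrow> \<bar>x $ i\<bar> \<le> R" "\<And>p. \<nu> p \<le> N p + 1"
  shows "tame N X m (\<lambda>p x. Bernstein (\<nu> p) (k p) ((x $ i + R) / (2 * R)))"
  using assms(3)
proof (induction m arbitrary: \<nu> k)
  have pb: "poly_bounded N X (\<lambda>p x. Bernstein (\<nu> p) (k p) ((x $ i + R) / (2 * R)))" for \<nu> k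
  proof (rule poly_bounded_const)
    fix p x assume "x \<in> X"
    then show "\<bar>Bernstein (\<nu> p) (k p) ((x $ i + R) / (2 * R))\<bar> \<le> 1"
      using assms(1) assms(2)[of x] by (intro abs_Bernstein_le_1) (auto simp: field_simps)
  qed
  have d: "((\<lambda>x. Bernstein n k ((x $ i + R) / (2 * R))) has_derivative (\<lambda>h. real n * ((if k = 0 then 0 else
      Bernstein (n - 1) (k - 1) ((x $ i + R) / (2 * R))) - Bernstein (n - 1) k ((x $ i + R) / (2 * R))) * (h $ i / (2 * R)))) (at x)"
    for x :: "real^'d" and n k
  proof -
    have "((\<lambda>x. (x $ i + R) / (2 * R)) has_derivative (\<lambda>h. h $ i / (2 * R))) (at x)"
      using assms(1) by (auto intro!: derivative_eq_intros
          bounded_linear.has_derivative[OF bounded_linear_vec_nth has_derivative_ident])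
    from has_derivative_compose[OF this has_derivative_Bernstein[unfolded has_field_derivative_def]]
    show ?thesis .
  qed
  {
    case 0
    have "(\<lambda>x. Bernstein (\<nu> p) (k p) ((x $ i + R) / (2 * R))) differentiable (at x)" for p x
      using d by (rule differentiableI)
    then show ?case using pb
      by (simp add: differentiable_imp_continuous_on differentiable_on_def differentiable_at_withinI)
  next
    case (Suc m)
    let ?y = "\<lambda>x::real^'d. (x $ i + R) / (2 * R)"
    have eq: "partial j (\<lambda>x. Bernstein (\<nu> p) (k p) (?y x)) =
      (\<lambda>x. ((if k p = 0 then 0 else real (\<nu> p)) * Bernstein (\<nu> p - 1) (k p - 1) (?y x)
        - real (\<nu> p) * Bernstein (\<nu> p - 1) (k p) (?y x)) * (axis j 1 $ i / (2 * R)))" for j p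
      by (simp add: fun_eq_iff partial_eq[OF d] right_diff_distrib)
    have "\<nu> p - 1 \<le> N p + 1" for p using Suc.prems[of p] by simp
    note IH = Suc.IH[OF this]
    have "real (\<nu> p) \<le> real (N p) + 1" for p using Suc.prems[of p] by linarith
    then have \<nu>: "tame N X m (\<lambda>p x. real (\<nu> p))" "tame N X m (\<lambda>p x. if k p = 0 then 0 else real (\<nu> p))"
      by - (rule tame_seq[of _ 1 _ 1]; simp add: add.commute)+
    have "tame N X m (\<lambda>p. partial j (\<lambda>x. Bernstein (\<nu> p) (k p) (?y x)))" for j
      unfolding eq by (intro tame_mult tame_diff tame_const \<nu> IH)
    then show ?case using pb differentiableI[OF d] by simp
  }
qed

text \<open>Dominates a fractional power by a constant plus a multiple of the square, so that the
  second moment of the Bernstein weights controls the mean of a Hoelder oscillation.\<close>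

lemma powr_le_power2_split:
  fixes t \<delta> s :: real
  assumes "0 < \<delta>" "0 \<le> t" "0 < s" "s \<le> 1"
  shows "t powr s \<le> \<delta> powr s + t\<^sup>2 * \<delta> powr (s - 2)"
proof (cases "t \<le> \<delta>")
  case True
  then have "t powr s \<le> \<delta> powr s" using assms by (intro powr_mono2) auto
  then show ?thesis by (simp add: add_increasing2)
next
  case False
  then have t: "0 < t" using assms by simp
  have "t powr s = t\<^sup>2 * t powr (s - 2)"
    using t powr_add[of t 2 "s - 2"] by simp
  also have "\<dots> \<le> t\<^sup>2 * \<delta> powr (s - 2)"
    using False assms by (intro mult_left_mono powr_mono2') auto
  finally show ?thesis by (simp add: add_increasing)
qed

text \<open>The tensor product Bernstein polynomial of degree \<open>n + 1\<close> in each variable,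
  a positive degree even for \<open>n = 0\<close>. Its weights are a probability distribution on
  grid points with variance of order \<open>1 / (n + 1)\<close> about \<open>x\<close>. Only values
  of \<open>f\<close> on the cube enter, and they enter linearly, so the derivatives grow
  polynomially however rough \<open>f\<close> is.\<close>

lemma Bernstein_approximation:
  fixes f :: "real^'d \<Rightarrow> real"
  assumes "0 < R" and X: "X = {x. \<forall>i. \<bar>x $ i\<bar> \<le> R}" and s: "0 < s" "s \<le> 1"
    and f: "\<And>x y. x \<in> X \<Longrightarrow> y \<in> X \<Longrightarrow> \<bar>f x - f y\<bar> \<le> L * dist x y powr s"
  obtains F K where "\<And>m. tame (\<lambda>n. n) X m F" "0 \<le> K"
    "\<And>n x. x \<in> X \<Longrightarrow> \<bar>F n x - f x\<bar> \<le> K * real (n + 1) powr (- s / 2)"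
proof -
  define S where "S = (\<lambda>n::nat. PiE (UNIV::'d set) (\<lambda>_. {..n + 1}))"
  define pt where "pt = (\<lambda>n (k::'d \<Rightarrow> nat). (\<chi> i. R * (2 * real (k i) / real (n + 1) - 1)) :: real^'d)"
  define y where "y = (\<lambda>(x :: real^'d) i. (x $ i + R) / (2 * R))"
  define W where "W = (\<lambda>(p :: nat \<times> ('d \<Rightarrow> nat)) x. \<Prod>i\<in>UNIV. Bernstein (fst p + 1) (snd p i) (y x i))"
  \<comment> \<open>Zero off \<open>S n\<close>, where \<open>pt\<close> may leave the cube, so that
    the coefficients are bounded uniformly over all pairs.\<close>
  define c where "c = (\<lambda>(n, k). if k \<in> S n then f (pt n k) else 0)"
  define F where "F = (\<lambda>n x. \<Sum>k\<in>S n. c (n, k) * W (n, k) x)"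
  have X0: "0 \<in> X" using assms(1) by (simp add: X)
  have pt: "pt n k \<in> X" if "k \<in> S n" for n k
  proof -
    have "\<bar>R * (2 * real (k i) / real (n + 1) - 1)\<bar> \<le> R" for i
    proof -
      have "k i \<le> n + 1" using that by (auto simp: S_def)
      then have "real (k i) / real (n + 1) \<le> 1" "0 \<le> real (k i) / real (n + 1)" by (simp_all del: of_nat_add)
      then have "\<bar>2 * (real (k i) / real (n + 1)) - 1\<bar> \<le> 1" by linarith
      then have "R * \<bar>2 * (real (k i) / real (n + 1)) - 1\<bar> \<le> R * 1" using assms(1) by (intro mult_left_mono) auto
      then show ?thesis using assms(1) by (simp add: abs_mult)
    qed
    then show ?thesis by (simp add: X pt_def)
  qed
  have finS: "finite (S n)" for n by (simp add: S_def finite_PiE)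
  have "\<bar>x $ i\<bar> \<le> R" if "x \<in> X" for x i using that by (simp add: X)
  note bX = this
  have "norm x \<le> real CARD('d) * R" if "x \<in> X" for x
    using bX[OF that] by (intro norm_vec_le_card) simp
  then have dX: "dist x 0 \<le> real CARD('d) * R" if "x \<in> X" for x using that by simp
  have fb: "\<bar>f x\<bar> \<le> \<bar>f 0\<bar> + \<bar>L\<bar> * (real CARD('d) * R) powr s" if "x \<in> X" for x
  proof -
    have "\<bar>f x - f 0\<bar> \<le> L * dist x 0 powr s" using that X0 by (rule f)
    also have "\<dots> \<le> \<bar>L\<bar> * (real CARD('d) * R) powr s"
      using dX[OF that] s by (intro mult_mono powr_mono2) auto
    finally show ?thesis by linarith
  qed
  have tW: "tame (\<lambda>p. fst p) X m W" for m
    unfolding W_def y_def using assms(1) bX by (intro tame_prod tame_Bernstein) auto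
  have "\<bar>c p\<bar> \<le> (\<bar>f 0\<bar> + \<bar>L\<bar> * (real CARD('d) * R) powr s) * real (fst p + 1) ^ 0" for p
    using fb[OF pt] by (cases p) (auto simp: c_def)
  then have "tame (\<lambda>p. fst p) X m (\<lambda>p x. c p)" for m by (rule tame_seq)
  then have tcW: "tame (\<lambda>p. fst p) X m (\<lambda>p x. c p * W p x)" for m by (intro tame_mult tW)
  have card: "real (card (S n)) \<le> 2 ^ CARD('d) * real (n + 1) ^ CARD('d)" for n
  proof -
    have "real (card (S n)) = real (n + 2) ^ CARD('d)" by (simp add: S_def card_PiE)
    also have "\<dots> \<le> (2 * real (n + 1)) ^ CARD('d)" by (intro power_mono) auto
    finally show ?thesis by (simp only: power_mult_distrib)
  qed
  have tF: "tame (\<lambda>n. n) X m F" for m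
    unfolding F_def using tame_sum_family[of S "2 ^ CARD('d)" "\<lambda>n. n" "CARD('d)" X m "\<lambda>p x. c p * W p x"]
      finS card tcW by blast
  have y01: "0 \<le> y x i" "y x i \<le> 1" if "x \<in> X" for x i
    using bX[OF that, of i] assms(1) by (auto simp: y_def field_simps)
  have W0: "0 \<le> W p x" if "x \<in> X" for p x
    unfolding W_def using y01[OF that] by (intro prod_nonneg) (auto intro: Bernstein_nonneg)
  \<comment> \<open>The factors of the coordinates other than \<open>j\<close> sum to 1 each, so
    averages of functions of \<open>k j\<close> reduce to one-dimensional Bernstein sums.\<close>
  have marg: "(\<Sum>k\<in>S n. W (n, k) x * g (k j)) = (\<Sum>k\<le>n + 1. Bernstein (n + 1) k (y x j) * g k)" for n x g j
  proof -
    have "(\<Sum>k\<in>S n. W (n, k) x * g (k j))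
        = (\<Sum>k\<in>S n. \<Prod>i\<in>UNIV. Bernstein (n + 1) (k i) (y x i) * (if i = j then g (k i) else 1))"
      unfolding W_def by (simp add: prod.distrib)
    also have "\<dots> = (\<Prod>i\<in>UNIV. \<Sum>k\<le>n + 1. Bernstein (n + 1) k (y x i) * (if i = j then g k else 1))"
      unfolding S_def by (subst prod_sum_PiE) auto
    also have "\<dots> = (\<Prod>i\<in>UNIV. if i = j then (\<Sum>k\<le>n + 1. Bernstein (n + 1) k (y x j) * g k) else 1)"
      by (intro prod.cong) (auto simp del: sum.atMost_Suc)
    finally show ?thesis by simp
  qed
  have sumW: "(\<Sum>k\<in>S n. W (n, k) x) = 1" for n x
    using marg[of n x "\<lambda>_. 1"] by (simp del: sum.atMost_Suc)
  define V where "V = 4 * R\<^sup>2 * real CARD('d)"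
  have V0: "0 \<le> V" by (simp add: V_def)
  have var: "(\<Sum>k\<in>S n. W (n, k) x * (dist (pt n k) x)\<^sup>2) \<le> V / real (n + 1)" if x: "x \<in> X" for n x
  proof -
    have sq: "(dist (pt n k) x)\<^sup>2 = (\<Sum>j\<in>UNIV. 4 * R\<^sup>2 * (real (k j) / real (n + 1) - y x j)\<^sup>2)" for k
    proof -
      have "(dist (pt n k) x)\<^sup>2 = (\<Sum>j\<in>UNIV. (pt n k $ j - x $ j)\<^sup>2)"
        by (simp add: dist_norm norm_vec_def L2_set_def sum_nonneg)
      moreover have "pt n k $ j - x $ j = 2 * R * (real (k j) / real (n + 1) - y x j)" for j
      proof -
        have "2 * R * y x j = x $ j + R" using assms(1) by (simp add: y_def)
        moreover have "pt n k $ j = 2 * R * (real (k j) / real (n + 1)) - R"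
          by (simp add: pt_def right_diff_distrib)
        ultimately show ?thesis by (simp only: right_diff_distrib)
      qed
      ultimately show ?thesis by (simp add: power_mult_distrib)
    qed
    have "(\<Sum>k\<in>S n. W (n, k) x * (dist (pt n k) x)\<^sup>2)
        = (\<Sum>j\<in>UNIV. 4 * R\<^sup>2 * (\<Sum>k\<in>S n. W (n, k) x * (real (k j) / real (n + 1) - y x j)\<^sup>2))"
      unfolding sq sum_distrib_left by (subst sum.swap) (simp add: mult_ac)
    also have "\<dots> \<le> (\<Sum>j\<in>(UNIV::'d set). 4 * R\<^sup>2 * (1 / real (n + 1)))"
      using Bernstein_variance[of "n + 1" "y x j" for j] y01[OF x]
      by (intro sum_mono mult_left_mono) (simp_all only: marg[where g = "\<lambda>k. (real k / real (n + 1) - y x j)\<^sup>2" for j], auto)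
    finally show ?thesis by (simp add: V_def mult.commute)
  qed
  have est: "\<bar>F n x - f x\<bar> \<le> \<bar>L\<bar> * (1 + V) * real (n + 1) powr (- s / 2)" if x: "x \<in> X" for n x
  proof -
    \<comment> \<open>The standard deviation of the weights, which balances the two terms of
      \<open>powr_le_power2_split\<close>: both become
      \<open>real (n + 1) powr (- s / 2)\<close>.\<close>
    define \<delta> where "\<delta> = real (n + 1) powr (- 1 / 2)"
    have \<delta>: "0 < \<delta>" by (simp add: \<delta>_def)
    have \<delta>s: "\<delta> powr s = real (n + 1) powr (- s / 2)" "\<delta> powr (s - 2) / real (n + 1) = real (n + 1) powr (- s / 2)"
    proof -
      show "\<delta> powr s = real (n + 1) powr (- s / 2)" by (simp add: \<delta>_def powr_powr)
      have "\<delta> powr (s - 2) = real (n + 1) powr (- s / 2 + 1)"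
        unfolding \<delta>_def powr_powr by (rule arg_cong[of _ _ "\<lambda>e. real (n + 1) powr e"]) (simp add: field_simps)
      then show "\<delta> powr (s - 2) / real (n + 1) = real (n + 1) powr (- s / 2)"
        by (simp only: powr_add) simp
    qed
    have "F n x - f x = (\<Sum>k\<in>S n. W (n, k) x * (f (pt n k) - f x))"
    proof -
      have "F n x = (\<Sum>k\<in>S n. W (n, k) x * f (pt n k))"
        unfolding F_def by (intro sum.cong) (auto simp: c_def)
      moreover have "f x = (\<Sum>k\<in>S n. W (n, k) x * f x)" by (simp add: sumW flip: sum_distrib_right)
      ultimately show ?thesis by (simp add: right_diff_distrib sum_subtractf)
    qed
    also have "\<bar>\<dots>\<bar> \<le> (\<Sum>k\<in>S n. W (n, k) x * (\<bar>L\<bar> * (\<delta> powr s + (dist (pt n k) x)\<^sup>2 * \<delta> powr (s - 2))))"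
    proof (rule order_trans[OF sum_abs], rule sum_mono)
      fix k assume k: "k \<in> S n"
      have "\<bar>f (pt n k) - f x\<bar> \<le> L * dist (pt n k) x powr s" using f[OF pt[OF k] x] .
      also have "\<dots> \<le> \<bar>L\<bar> * (\<delta> powr s + (dist (pt n k) x)\<^sup>2 * \<delta> powr (s - 2))"
        using s by (intro mult_mono powr_le_power2_split \<delta>) auto
      finally show "\<bar>W (n, k) x * (f (pt n k) - f x)\<bar>
          \<le> W (n, k) x * (\<bar>L\<bar> * (\<delta> powr s + (dist (pt n k) x)\<^sup>2 * \<delta> powr (s - 2)))"
        using W0[OF x] by (simp add: abs_mult mult_left_mono)
    qed
    also have "\<dots> = \<bar>L\<bar> * (\<delta> powr s * (\<Sum>k\<in>S n. W (n, k) x)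
        + \<delta> powr (s - 2) * (\<Sum>k\<in>S n. W (n, k) x * (dist (pt n k) x)\<^sup>2))"
      by (simp add: sum_distrib_left sum.distrib algebra_simps)
    also have "\<dots> \<le> \<bar>L\<bar> * (\<delta> powr s * 1 + \<delta> powr (s - 2) * (V / real (n + 1)))"
      using var[OF x] by (intro mult_left_mono add_mono) (auto simp: sumW)
    also have "\<delta> powr (s - 2) * (V / real (n + 1)) = V * (\<delta> powr (s - 2) / real (n + 1))" by simp
    finally show ?thesis unfolding \<delta>s by (simp add: algebra_simps)
  qed
  have "0 \<le> \<bar>L\<bar> * (1 + V)" using V0 by simp
  then show thesis using that[of F "\<bar>L\<bar> * (1 + V)"] tF est by blast
qed

section \<open>A Kuiper stage without loss\<close>

text \<open>What \<open>(1/2) *\<^sub>R gram v + sym_grad w\<close> gains when \<open>f\<close> is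
  added to one component of \<open>v\<close> and the field \<open>W\<close> to \<open>w\<close>,
  with \<open>H\<close> standing for the gradient of that component. \<open>H\<close> is kept as
  separate data because that gradient is merely \<open>C^1\<close> and has to be replaced by a tame
  approximation.\<close>

definition strain ::
  "('d \<Rightarrow> nat \<Rightarrow> real^'d \<Rightarrow> real) \<Rightarrow> (nat \<Rightarrow> real^'d \<Rightarrow> real) \<Rightarrow> ('d \<Rightarrow> nat \<Rightarrow> real^'d \<Rightarrow> real) \<Rightarrow>
    'd \<Rightarrow> 'd \<Rightarrow> nat \<Rightarrow> real^'d \<Rightarrow> real" where
  "strain H f W i j n x = (H i n x * partial j (f n) x + H j n x * partial i (f n) x) / 2
     + partial i (f n) x * partial j (f n) x / 2 + (partial i (W j n) x + partial j (W i n) x) / 2"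

section \<open>A single corrugation\<close>

lemma partial_cmult:
  fixes g :: "real^'d \<Rightarrow> real"
  assumes "g differentiable (at x)"
  shows "partial i (\<lambda>x. c * g x) x = c * partial i g x"
  using partial_mult[of "\<lambda>_. c" x g i] assms by (simp add: partial_const)

lemma tame_differentiable: "(\<And>m. tame N X m F) \<Longrightarrow> F p differentiable (at x)"
  using tame.simps(2)[of N X 0 F] by blast

lemma tame_partial: "(\<And>m. tame N X m F) \<Longrightarrow> tame N X m (\<lambda>p. partial i (F p))"
  using tame.simps(2)[of N X m F] by blast

lemma abs_mult_le: "\<bar>a\<bar> \<le> A \<Longrightarrow> \<bar>b\<bar> \<le> B \<Longrightarrow> \<bar>a * b\<bar> \<le> A * (B::real)"
  unfolding abs_mult by (intro mult_mono) auto

text \<open>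
  One corrugation in direction \<open>\<eta>\<close> adds \<open>a\<^sup>2 \<eta> \<otimes> \<eta>\<close> to the metric: with \<open>\<phi> = 2 a sin \<theta> / \<lambda>\<close> and
  \<open>\<zeta> = a\<^sup>2 sin \<theta> cos \<theta> / \<lambda>\<close>, the term \<open>\<partial>\<^sub>i\<phi> \<partial>\<^sub>j\<phi> / 2\<close> is \<open>2 a\<^sup>2 cos\<^sup>2 \<theta> \<eta>\<^sub>i \<eta>\<^sub>j\<close> up to \<open>O(1/\<lambda>)\<close>, whose oscillating
  part is compensated by \<open>\<zeta>\<close>, while the mixed terms are compensated by \<open>\<phi> P\<close>. The frequency \<open>\<lambda>\<close> is a
  power of \<open>n\<close> exceeding the growth of all derivatives that occur.
\<close>

lemma corrugation_step:
  fixes a f :: "nat \<Rightarrow> real^'d \<Rightarrow> real" and H W :: "'d \<Rightarrow> nat \<Rightarrow> real^'d \<Rightarrow> real"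
  assumes X: "bounded X" and a: "\<And>m. tame (\<lambda>n. n) X m a" and f: "\<And>m. tame (\<lambda>n. n) X m f"
    and H: "\<And>j m. tame (\<lambda>n. n) X m (H j)" and W: "\<And>j m. tame (\<lambda>n. n) X m (W j)"
    and \<eta>: "\<And>i. \<bar>\<eta> $ i\<bar> \<le> 2"
  obtains f' W' K where "\<And>m. tame (\<lambda>n. n) X m f'" "\<And>j m. tame (\<lambda>n. n) X m (W' j)" "0 \<le> K"
    "\<And>n x. x \<in> X \<Longrightarrow> \<bar>f' n x - f n x\<bar> \<le> K / real (n + 1)"
    "\<And>n x j. x \<in> X \<Longrightarrow> \<bar>W' j n x - W j n x\<bar> \<le> K / real (n + 1)"
    "\<And>n x i. x \<in> X \<Longrightarrow> \<bar>partial i (f' n) x - partial i (f n) x\<bar> \<le> 4 * \<bar>a n x\<bar> + K / real (n + 1)"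
    "\<And>n x i j. x \<in> X \<Longrightarrow> \<bar>partial i (W' j n) x - partial i (W j n) x\<bar>
      \<le> 4 * \<bar>a n x\<bar> * \<bar>H j n x + partial j (f n) x\<bar> + 4 * (a n x)\<^sup>2 + K / real (n + 1)"
    "\<And>n x i j. x \<in> X \<Longrightarrow>
      \<bar>strain H f' W' i j n x - strain H f W i j n x - (a n x)\<^sup>2 * \<eta> $ i * \<eta> $ j\<bar> \<le> K / real (n + 1)"
proof -
  define P where "P = (\<lambda>j n x. H j n x + partial j (f n) x)"
  have P: "tame (\<lambda>n. n) X m (P j)" for m j
    unfolding P_def by (intro tame_add H tame_partial f)
  \<comment> \<open>One tame majorant for all quantities in the error terms. The summand 1 makes
    linear errors at most quadratic ones.\<close>
  define Z where "Z = (\<lambda>n x. 1 + \<bar>a n x\<bar> + (\<Sum>i\<in>UNIV. \<bar>partial i (a n) x\<bar>) + (\<Sum>j\<in>UNIV. \<bar>P j n x\<bar>)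
      + (\<Sum>j\<in>UNIV. \<Sum>i\<in>UNIV. \<bar>partial i (P j n) x\<bar>))"
  have "poly_bounded (\<lambda>n. n) X Z"
    unfolding Z_def
    by (intro poly_bounded_add poly_bounded_sum poly_bounded_abs tame_poly_bounded[OF a]
        tame_poly_bounded[OF P] tame_poly_bounded[OF tame_partial[OF a, of 0]]
        tame_poly_bounded[OF tame_partial[OF P, of 0]] poly_bounded_const[of _ _ 1]) auto
  then obtain K0 q where K0: "0 \<le> K0" "\<And>n x. x \<in> X \<Longrightarrow> \<bar>Z n x\<bar> \<le> K0 * real (n + 1) ^ q"
    by (rule poly_boundedE) blast
  have Z1: "1 \<le> Z n x" "\<bar>a n x\<bar> \<le> Z n x" "\<bar>partial i (a n) x\<bar> \<le> Z n x" "\<bar>P j n x\<bar> \<le> Z n x"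
    "\<bar>partial i (P j n) x\<bar> \<le> Z n x" for n x i j
  proof -
    have 1: "\<bar>partial i (a n) x\<bar> \<le> (\<Sum>i\<in>UNIV. \<bar>partial i (a n) x\<bar>)"
      "\<bar>P j n x\<bar> \<le> (\<Sum>j\<in>UNIV. \<bar>P j n x\<bar>)"
      by (rule member_le_sum; simp)+
    have "\<bar>partial i (P j n) x\<bar> \<le> (\<Sum>i\<in>UNIV. \<bar>partial i (P j n) x\<bar>)"
      by (rule member_le_sum; simp)
    also have "\<dots> \<le> (\<Sum>j\<in>UNIV. \<Sum>i\<in>UNIV. \<bar>partial i (P j n) x\<bar>)"
      by (rule member_le_sum[where f = "\<lambda>j. \<Sum>i\<in>UNIV. \<bar>partial i (P j n) x\<bar>"]) (auto intro: sum_nonneg)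
    finally have 2: "\<bar>partial i (P j n) x\<bar> \<le> (\<Sum>j\<in>UNIV. \<Sum>i\<in>UNIV. \<bar>partial i (P j n) x\<bar>)" .
    have nn: "0 \<le> (\<Sum>i\<in>UNIV. \<bar>partial i (a n) x\<bar>)" "0 \<le> (\<Sum>j\<in>UNIV. \<bar>P j n x\<bar>)"
      "0 \<le> (\<Sum>j\<in>UNIV. \<Sum>i\<in>UNIV. \<bar>partial i (P j n) x\<bar>)"
      by (intro sum_nonneg; simp)+
    show "1 \<le> Z n x" "\<bar>a n x\<bar> \<le> Z n x" "\<bar>partial i (a n) x\<bar> \<le> Z n x" "\<bar>P j n x\<bar> \<le> Z n x"
      "\<bar>partial i (P j n) x\<bar> \<le> Z n x"
      unfolding Z_def using 1 2 nn abs_ge_zero[of "a n x"] by linarith+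
  qed
  \<comment> \<open>All errors are of the form \<open>Z\<^sup>2 / lam\<close> with \<open>Z\<close>
    of degree \<open>q\<close>; the exponent \<open>2 * q + 1\<close> leaves a decay of
    \<open>1 / (n + 1)\<close>.\<close>
  define lam where "lam = (\<lambda>n. real (n + 1) ^ (2 * q + 1))"
  define e where "e = (\<lambda>n. 1 / lam n)"
  have lam1: "1 \<le> lam n" for n unfolding lam_def by (rule one_le_power) simp
  have e: "0 < e n" "e n \<le> 1" "e n * lam n = 1" for n
    using lam1[of n] by (auto simp: e_def)
  \<comment> \<open>The largest error counts below add up to 8: in the gradient of \<open>W'\<close>
    as 2 + 4 + 2, and in the strain as 4 + 2 + 2.\<close>
  define K where "K = 8 * K0\<^sup>2"
  have eZ: "8 * (e n * (Z n x)\<^sup>2) \<le> K / real (n + 1)" if "x \<in> X" for n x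
  proof -
    have "(Z n x)\<^sup>2 \<le> (K0 * real (n + 1) ^ q)\<^sup>2"
      using K0(2)[OF that] Z1(1)[of n x] by (intro power_mono) (auto intro: order_trans[OF abs_ge_self])
    then have "e n * (Z n x)\<^sup>2 \<le> e n * (K0 * real (n + 1) ^ q)\<^sup>2" using e(1)[of n] by (intro mult_left_mono) auto
    also have "\<dots> = K0\<^sup>2 / real (n + 1)"
      by (simp add: e_def lam_def power_mult_distrib power_mult[symmetric] mult.commute[of q 2])
    finally show ?thesis by (simp add: K_def)
  qed
  define s where "s = (\<lambda>n x. sin (lam n * (\<eta> \<bullet> x)))"
  define c where "c = (\<lambda>n x. cos (lam n * (\<eta> \<bullet> x)))"
  have "\<bar>lam n\<bar> \<le> 1 * real (n + 1) ^ (2 * q + 1)" "\<bar>e n\<bar> \<le> 1 * real (n + 1) ^ 0" for n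
    using lam1[of n] e[of n] by (auto simp: lam_def)
  note tsc = tame_sin_cos[where N = "\<lambda>n. n" and X = X and \<eta> = \<eta>, OF this(1)]
    and te = tame_seq[where N = "\<lambda>n. n" and X = X, OF this(2)]
  have ts: "tame (\<lambda>n. n) X m s" and tc: "tame (\<lambda>n. n) X m c" for m
    unfolding s_def c_def using tsc by blast+
  have ds: "s n differentiable (at x)" "c n differentiable (at x)"
    "partial i (s n) x = lam n * \<eta> $ i * c n x" "partial i (c n) x = - (lam n * \<eta> $ i) * s n x" for n x i
    unfolding s_def c_def by (rule partial_sin_cos)+
  note da = tame_differentiable[OF a] and dP = tame_differentiable[OF P]
    and df = tame_differentiable[OF f] and dW = tame_differentiable[OF W]
  have sc: "\<bar>s n x\<bar> \<le> 1" "\<bar>c n x\<bar> \<le> 1" "(s n x)\<^sup>2 + (c n x)\<^sup>2 = 1" for n x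
    by (auto simp: s_def c_def)
  define \<phi> where "\<phi> = (\<lambda>n x. 2 * e n * (a n x * s n x))"
  define \<zeta> where "\<zeta> = (\<lambda>n x. e n * (a n x * a n x * (s n x * c n x)))"
  have t\<phi>: "tame (\<lambda>n. n) X m \<phi>" and t\<zeta>: "tame (\<lambda>n. n) X m \<zeta>" for m
    unfolding \<phi>_def \<zeta>_def by (intro tame_mult tame_const te a ts tc)+
  note d\<phi> = tame_differentiable[OF t\<phi>] and d\<zeta> = tame_differentiable[OF t\<zeta>]
  have p\<phi>: "partial i (\<phi> n) x = 2 * a n x * c n x * \<eta> $ i + 2 * e n * s n x * partial i (a n) x" for i n x
  proof -
    have "partial i (\<phi> n) x = 2 * e n * (partial i (a n) x * s n x + a n x * (lam n * \<eta> $ i * c n x))"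
      unfolding \<phi>_def by (simp add: partial_cmult partial_mult da ds)
    also have "\<dots> = 2 * (e n * lam n) * a n x * c n x * \<eta> $ i + 2 * e n * s n x * partial i (a n) x"
      by (simp add: algebra_simps)
    finally show ?thesis by (simp add: e(3))
  qed
  have p\<zeta>: "partial i (\<zeta> n) x = (a n x)\<^sup>2 * \<eta> $ i * ((c n x)\<^sup>2 - (s n x)\<^sup>2)
      + 2 * e n * (a n x * partial i (a n) x * (s n x * c n x))" for i n x
  proof -
    have "partial i (\<zeta> n) x = e n * ((partial i (a n) x * a n x + a n x * partial i (a n) x) * (s n x * c n x)
        + a n x * a n x * (lam n * \<eta> $ i * c n x * c n x + s n x * (- (lam n * \<eta> $ i) * s n x)))"
      unfolding \<zeta>_def by (simp add: partial_cmult partial_mult da ds)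
    also have "\<dots> = (e n * lam n) * ((a n x)\<^sup>2 * \<eta> $ i * ((c n x)\<^sup>2 - (s n x)\<^sup>2))
      + 2 * e n * (a n x * partial i (a n) x * (s n x * c n x))"
      by (simp add: algebra_simps power2_eq_square)
    finally show ?thesis by (simp add: e(3))
  qed
  define f' where "f' = (\<lambda>n x. f n x + \<phi> n x)"
  define W' where "W' = (\<lambda>j n x. W j n x - (\<phi> n x * P j n x + \<eta> $ j * \<zeta> n x))"
  have tf': "tame (\<lambda>n. n) X m f'" for m unfolding f'_def by (intro tame_add f t\<phi>)
  have tW': "tame (\<lambda>n. n) X m (W' j)" for m j
    unfolding W'_def by (intro tame_diff tame_add tame_mult tame_const W t\<phi> P t\<zeta>)
  have pf': "partial i (f' n) x = partial i (f n) x + partial i (\<phi> n) x" for i n x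
    unfolding f'_def by (simp add: partial_add df d\<phi>)
  have pW': "partial i (W' j n) x = partial i (W j n) x -
      (partial i (\<phi> n) x * P j n x + \<phi> n x * partial i (P j n) x + \<eta> $ j * partial i (\<zeta> n) x)" for i j n x
    unfolding W'_def by (simp add: partial_diff partial_add partial_mult partial_const dW d\<phi> dP d\<zeta>)
  show thesis
  proof (rule that[of f' W' K])
    show "0 \<le> K" by (simp add: K_def)
    fix n x i j assume x: "x \<in> X"
    define z where "z = Z n x"
    have z: "1 \<le> z" "\<bar>a n x\<bar> \<le> z" "\<And>i. \<bar>partial i (a n) x\<bar> \<le> z" "\<And>j. \<bar>P j n x\<bar> \<le> z"
      "\<And>i j. \<bar>partial i (P j n) x\<bar> \<le> z" using Z1 unfolding z_def by blast+
    have zz: "z \<le> z\<^sup>2" using z(1) by (simp add: power2_eq_square)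
    have K: "8 * (e n * z\<^sup>2) \<le> K / real (n + 1)" using eZ[OF x] by (simp add: z_def)
    have ez0: "0 \<le> e n * z\<^sup>2" using e(1)[of n] by simp
    have abs_e: "\<bar>e n\<bar> = e n" using e(1)[of n] by simp
    have e_le: "\<bar>e n * t\<bar> \<le> e n * u" if "\<bar>t\<bar> \<le> u" for t u
      using that e(1)[of n] by (simp add: abs_mult)
    have as: "\<bar>a n x * s n x\<bar> \<le> z * 1" by (intro abs_mult_le z sc)
    have sc1: "\<bar>s n x * c n x\<bar> \<le> 1" using abs_mult_le[OF sc(1,2)] by simp
    have \<phi>z: "\<bar>\<phi> n x * t\<bar> \<le> 2 * (e n * z\<^sup>2)" if "\<bar>t\<bar> \<le> z" for t
    proof -
      have "\<bar>(a n x * s n x) * t\<bar> \<le> (z * 1) * z" by (intro abs_mult_le as that)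
      from e_le[OF this] have "\<bar>e n * ((a n x * s n x) * t)\<bar> \<le> e n * z\<^sup>2" by (simp add: power2_eq_square)
      then show ?thesis by (simp add: \<phi>_def abs_mult)
    qed
    have "\<bar>\<phi> n x * 1\<bar> \<le> 2 * (e n * z\<^sup>2)" using z(1) by (intro \<phi>z) simp
    then show "\<bar>f' n x - f n x\<bar> \<le> K / real (n + 1)" using K ez0 by (simp add: f'_def)
    have \<zeta>z: "\<bar>\<zeta> n x\<bar> \<le> e n * z\<^sup>2"
    proof -
      have "\<bar>a n x * a n x * (s n x * c n x)\<bar> \<le> z * z * 1" by (intro abs_mult_le z sc1)
      from e_le[OF this] show ?thesis by (simp add: \<zeta>_def power2_eq_square)
    qed
    have "\<bar>\<eta> $ j * \<zeta> n x\<bar> \<le> 2 * (e n * z\<^sup>2)" by (intro abs_mult_le \<eta> \<zeta>z)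
    then show "\<bar>W' j n x - W j n x\<bar> \<le> K / real (n + 1)"
      using \<phi>z[OF z(4)[of j]] K ez0 unfolding W'_def by linarith
    have main1: "\<bar>2 * a n x * c n x * \<eta> $ i\<bar> \<le> 4 * \<bar>a n x\<bar>"
    proof -
      have "\<bar>c n x * \<eta> $ i\<bar> \<le> 1 * 2" by (intro abs_mult_le sc \<eta>)
      then have "2 * \<bar>a n x\<bar> * \<bar>c n x * \<eta> $ i\<bar> \<le> 2 * \<bar>a n x\<bar> * 2" by (intro mult_left_mono) auto
      then show ?thesis by (simp add: abs_mult)
    qed
    have err1: "\<bar>2 * e n * s n x * partial i (a n) x * t\<bar> \<le> 2 * (e n * z\<^sup>2)" if "\<bar>t\<bar> \<le> z" for t
    proof -
      have "\<bar>s n x * partial i (a n) x * t\<bar> \<le> 1 * z * z" by (intro abs_mult_le sc z that)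
      from e_le[OF this] have "\<bar>e n * (s n x * partial i (a n) x * t)\<bar> \<le> e n * z\<^sup>2" by (simp add: power2_eq_square)
      then show ?thesis by (simp add: abs_mult)
    qed
    have "\<bar>2 * e n * s n x * partial i (a n) x * 1\<bar> \<le> 2 * (e n * z\<^sup>2)" using z(1) by (intro err1) simp
    then show "\<bar>partial i (f' n) x - partial i (f n) x\<bar> \<le> 4 * \<bar>a n x\<bar> + K / real (n + 1)"
      using main1 K ez0 unfolding pf' p\<phi> by simp
    have t1: "\<bar>partial i (\<phi> n) x * P j n x\<bar> \<le> 4 * \<bar>a n x\<bar> * \<bar>P j n x\<bar> + 2 * (e n * z\<^sup>2)"
    proof -
      have "\<bar>2 * a n x * c n x * \<eta> $ i * P j n x\<bar> \<le> 4 * \<bar>a n x\<bar> * \<bar>P j n x\<bar>"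
        by (intro abs_mult_le main1) simp
      then show ?thesis using err1[OF z(4)[of j]] unfolding p\<phi> distrib_right by linarith
    qed
    have t2: "\<bar>\<eta> $ j * partial i (\<zeta> n) x\<bar> \<le> 4 * (a n x)\<^sup>2 + 4 * (e n * z\<^sup>2)"
    proof -
      have "\<bar>(c n x)\<^sup>2 - (s n x)\<^sup>2\<bar> \<le> 1" using sc(3)[of n x] zero_le_power2[of "s n x"] zero_le_power2[of "c n x"]
        by linarith
      then have "\<bar>\<eta> $ j * (\<eta> $ i * ((c n x)\<^sup>2 - (s n x)\<^sup>2))\<bar> \<le> 2 * (2 * 1)" by (intro abs_mult_le \<eta>)
      then have "\<bar>(a n x)\<^sup>2 * (\<eta> $ j * (\<eta> $ i * ((c n x)\<^sup>2 - (s n x)\<^sup>2)))\<bar> \<le> (a n x)\<^sup>2 * 4"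
        by (intro abs_mult_le) auto
      moreover have "\<bar>\<eta> $ j * (a n x * partial i (a n) x * (s n x * c n x))\<bar> \<le> 2 * (z * z * 1)"
        by (intro abs_mult_le \<eta> z sc1)
      from e_le[OF this] have "\<bar>e n * (\<eta> $ j * (a n x * partial i (a n) x * (s n x * c n x)))\<bar> \<le> 2 * (e n * z\<^sup>2)"
        by (simp add: power2_eq_square algebra_simps)
      moreover have "\<eta> $ j * partial i (\<zeta> n) x = (a n x)\<^sup>2 * (\<eta> $ j * (\<eta> $ i * ((c n x)\<^sup>2 - (s n x)\<^sup>2)))
          + 2 * (e n * (\<eta> $ j * (a n x * partial i (a n) x * (s n x * c n x))))"
        unfolding p\<zeta> by (simp add: algebra_simps)
      ultimately show ?thesis by linarith
    qed
    show "\<bar>partial i (W' j n) x - partial i (W j n) x\<bar>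
      \<le> 4 * \<bar>a n x\<bar> * \<bar>H j n x + partial j (f n) x\<bar> + 4 * (a n x)\<^sup>2 + K / real (n + 1)"
      using t1 t2 \<phi>z[OF z(5)[of i j]] K unfolding pW' P_def by linarith
    \<comment> \<open>The mixed terms \<open>P i * partial j \<phi> + P j * partial i \<phi>\<close>
      cancel against the derivative of \<phi> in the correction \<open>\<phi> * P\<close>; only
      \<phi> times derivatives of \<open>P\<close> survives.\<close>
    have "strain H f' W' i j n x - strain H f W i j n x - (a n x)\<^sup>2 * \<eta> $ i * \<eta> $ j =
        partial i (\<phi> n) x * partial j (\<phi> n) x / 2 - \<phi> n x * (partial i (P j n) x + partial j (P i n) x) / 2
        - (\<eta> $ j * partial i (\<zeta> n) x + \<eta> $ i * partial j (\<zeta> n) x) / 2 - (a n x)\<^sup>2 * \<eta> $ i * \<eta> $ j"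
      unfolding strain_def pf' pW' P_def by (simp add: algebra_simps add_divide_distrib diff_divide_distrib)
    \<comment> \<open>The terms of order one vanish: their coefficient is
      \<open>2 * c\<^sup>2 - (c\<^sup>2 - s\<^sup>2) - 1\<close>, which is 0 because
      \<open>s\<^sup>2 + c\<^sup>2 = 1\<close>. What remains carries a factor
      \<open>e n\<close>.\<close>
    also have "\<dots> = e n * (a n x * (s n x * c n x) * (\<eta> $ i * partial j (a n) x + \<eta> $ j * partial i (a n) x)
        + 2 * (e n * ((s n x)\<^sup>2 * (partial i (a n) x * partial j (a n) x)))
        - a n x * s n x * (partial i (P j n) x + partial j (P i n) x))"
    proof -
      have c2: "(c n x)\<^sup>2 = 1 - (s n x)\<^sup>2" using sc(3)[of n x] by linarith
      have "(2 * A * cc * ei + 2 * ee * ss * Ai) * (2 * A * cc * ej + 2 * ee * ss * Aj) / 2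
          - (2 * ee * (A * ss)) * (Pi + Pj) / 2
          - (ej * (A\<^sup>2 * ei * (cc\<^sup>2 - ss\<^sup>2) + 2 * ee * (A * Ai * (ss * cc)))
             + ei * (A\<^sup>2 * ej * (cc\<^sup>2 - ss\<^sup>2) + 2 * ee * (A * Aj * (ss * cc)))) / 2 - A\<^sup>2 * ei * ej
        = ee * (A * (ss * cc) * (ei * Aj + ej * Ai) + 2 * (ee * (ss\<^sup>2 * (Ai * Aj))) - A * ss * (Pi + Pj))"
        if "cc\<^sup>2 = 1 - ss\<^sup>2" for A cc ss ei ej ee Ai Aj Pi Pj :: real
      proof -
        have E: "(2 * A * cc * ei + 2 * ee * ss * Ai) * (2 * A * cc * ej + 2 * ee * ss * Aj) / 2
            = 2 * A\<^sup>2 * cc\<^sup>2 * ei * ej + 2 * ee * A * (ss * cc) * (ei * Aj + ej * Ai) + 2 * ee * (ee * (ss\<^sup>2 * (Ai * Aj)))"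
          by (simp add: algebra_simps power2_eq_square)
        show ?thesis unfolding E that
          by (simp add: algebra_simps add_divide_distrib diff_divide_distrib)
      qed
      moreover have "\<phi> n x = 2 * e n * (a n x * s n x)" by (simp add: \<phi>_def)
      ultimately show ?thesis using c2 unfolding p\<phi> p\<zeta> by simp
    qed
    also have "\<bar>\<dots>\<bar> \<le> e n * (8 * z\<^sup>2)"
    proof (rule e_le)
      have "\<bar>a n x * (s n x * c n x) * (\<eta> $ i * partial j (a n) x)\<bar> \<le> z * 1 * (2 * z)"
        "\<bar>a n x * (s n x * c n x) * (\<eta> $ j * partial i (a n) x)\<bar> \<le> z * 1 * (2 * z)"
        by (intro abs_mult_le z sc1 \<eta>)+
      moreover have "(s n x)\<^sup>2 \<le> 1" using sc(3)[of n x] zero_le_power2[of "c n x"] by linarith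
      then have "\<bar>e n * ((s n x)\<^sup>2 * (partial i (a n) x * partial j (a n) x))\<bar> \<le> 1 * (1 * (z * z))"
        using e[of n] by (intro abs_mult_le z) auto
      moreover have "\<bar>a n x * s n x * partial i (P j n) x\<bar> \<le> z * 1 * z" "\<bar>a n x * s n x * partial j (P i n) x\<bar> \<le> z * 1 * z"
        by (intro abs_mult_le z sc)+
      ultimately show "\<bar>a n x * (s n x * c n x) * (\<eta> $ i * partial j (a n) x + \<eta> $ j * partial i (a n) x)
        + 2 * (e n * ((s n x)\<^sup>2 * (partial i (a n) x * partial j (a n) x)))
        - a n x * s n x * (partial i (P j n) x + partial j (P i n) x)\<bar> \<le> 8 * z\<^sup>2"
        unfolding distrib_left power2_eq_square by linarith
    qed
    finally show "\<bar>strain H f' W' i j n x - strain H f W i j n x - (a n x)\<^sup>2 * \<eta> $ i * \<eta> $ j\<bar> \<le> K / real (n + 1)"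
      using K by simp
  qed (fact tf' tW')+
qed

text \<open>The derivative bounds are relative to arbitrary pointwise bounds \<open>A\<close> of the
  amplitudes and \<open>h\<close> of \<open>H\<close>, with coefficients depending on the number of
  directions alone. Everything that depends on the families sits in \<open>K\<close>, which comes
  with the decaying factor. This separation is what later frees the constant of the first stage from
  the data.\<close>

definition corrugated ::
  "(real^'d) set \<Rightarrow> 'i set \<Rightarrow> ('i \<Rightarrow> nat \<Rightarrow> real^'d \<Rightarrow> real) \<Rightarrow> ('d \<Rightarrow> nat \<Rightarrow> real^'d \<Rightarrow> real) \<Rightarrow>
    ('i \<Rightarrow> real^'d) \<Rightarrow> (nat \<Rightarrow> real^'d \<Rightarrow> real) \<Rightarrow> ('d \<Rightarrow> nat \<Rightarrow> real^'d \<Rightarrow> real) \<Rightarrow> real \<Rightarrow> bool" where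
  "corrugated X I a H \<eta> f W K \<longleftrightarrow> (\<forall>m. tame (\<lambda>n. n) X m f) \<and> (\<forall>j m. tame (\<lambda>n. n) X m (W j)) \<and> 0 \<le> K \<and>
    (\<forall>n. \<forall>x\<in>X. \<bar>f n x\<bar> \<le> K / real (n + 1) \<and> (\<forall>j. \<bar>W j n x\<bar> \<le> K / real (n + 1)) \<and>
      (\<forall>k l. \<bar>strain H f W k l n x - (\<Sum>i\<in>I. (a i n x)\<^sup>2 * \<eta> i $ k * \<eta> i $ l)\<bar> \<le> K / real (n + 1)) \<and>
      (\<forall>A h. (\<forall>i\<in>I. \<bar>a i n x\<bar> \<le> A) \<and> (\<forall>j. \<bar>H j n x\<bar> \<le> h) \<and> 0 \<le> A \<longrightarrow>
        (\<forall>k. \<bar>partial k (f n) x\<bar> \<le> 4 * real (card I) * A + K / real (n + 1)) \<and>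
        (\<forall>k l. \<bar>partial k (W l n) x\<bar> \<le> real (card I) * (4 * A * (h + 4 * real (card I) * A) + 4 * A\<^sup>2)
            + (1 + A) * (K / real (n + 1)))))"

text \<open>The corrugations are added one after another. The frequency of a new one is chosen after
  the derivatives of all earlier ones, and its mixed terms are corrected with \<open>H\<close> plus
  the gradient accumulated so far.\<close>

lemma corrugations:
  fixes a :: "'i \<Rightarrow> nat \<Rightarrow> real^'d \<Rightarrow> real" and H :: "'d \<Rightarrow> nat \<Rightarrow> real^'d \<Rightarrow> real" and \<eta> :: "'i \<Rightarrow> real^'d"
  assumes "finite I" and X: "bounded X" and a: "\<And>i m. i \<in> I \<Longrightarrow> tame (\<lambda>n. n) X m (a i)"
    and H: "\<And>j m. tame (\<lambda>n. n) X m (H j)" and \<eta>: "\<And>i k. i \<in> I \<Longrightarrow> \<bar>\<eta> i $ k\<bar> \<le> 2"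
  shows "\<exists>f W K. corrugated X I a H \<eta> f W K"
  using assms(1) a \<eta>
proof (induction I rule: finite_induct)
  case empty
  have "tame (\<lambda>n. n) X m (\<lambda>_ _. 0)" for m by (rule tame_const)
  then show ?case
    by (intro exI[of _ "\<lambda>_ _. 0"] exI[of _ "\<lambda>_ _ _. 0"] exI[of _ 0])
      (auto simp: corrugated_def strain_def partial_const)
next
  case (insert \<iota> I)
  have "\<exists>f W K. corrugated X I a H \<eta> f W K"
    by (rule insert.IH) (use insert.prems in auto)
  then obtain f W K where "corrugated X I a H \<eta> f W K" by blast
  note IH0 = this[unfolded corrugated_def]
  have IH: "\<And>m. tame (\<lambda>n. n) X m f" "\<And>j m. tame (\<lambda>n. n) X m (W j)" "0 \<le> K"
    using IH0[THEN conjunct1] IH0[THEN conjunct2, THEN conjunct1]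
      IH0[THEN conjunct2, THEN conjunct2, THEN conjunct1] by blast+
  note P = IH0[THEN conjunct2, THEN conjunct2, THEN conjunct2, THEN spec, THEN bspec]
  show ?case
  proof (rule corrugation_step[where H = H and W = W and a = "a \<iota>" and \<eta> = "\<eta> \<iota>",
        OF X insert.prems(1)[OF insertI1] IH(1) H IH(2) insert.prems(2)[OF insertI1]])
    fix f' W' K' assume S: "\<And>m. tame (\<lambda>n. n) X m f'" "\<And>j m. tame (\<lambda>n. n) X m (W' j)" "0 \<le> K'"
    "\<And>n x. x \<in> X \<Longrightarrow> \<bar>f' n x - f n x\<bar> \<le> K' / real (n + 1)"
    "\<And>n x j. x \<in> X \<Longrightarrow> \<bar>W' j n x - W j n x\<bar> \<le> K' / real (n + 1)"
    "\<And>n x i. x \<in> X \<Longrightarrow> \<bar>partial i (f' n) x - partial i (f n) x\<bar> \<le> 4 * \<bar>a \<iota> n x\<bar> + K' / real (n + 1)"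
    "\<And>n x i j. x \<in> X \<Longrightarrow> \<bar>partial i (W' j n) x - partial i (W j n) x\<bar>
      \<le> 4 * \<bar>a \<iota> n x\<bar> * \<bar>H j n x + partial j (f n) x\<bar> + 4 * (a \<iota> n x)\<^sup>2 + K' / real (n + 1)"
    "\<And>n x i j. x \<in> X \<Longrightarrow>
      \<bar>strain H f' W' i j n x - strain H f W i j n x - (a \<iota> n x)\<^sup>2 * \<eta> \<iota> $ i * \<eta> \<iota> $ j\<bar> \<le> K' / real (n + 1)"
  define N where "N = real (card I)"
  have N: "real (card (insert \<iota> I)) = N + 1" "0 \<le> N" using insert.hyps by (auto simp: N_def)
  \<comment> \<open>The 5 absorbs \<open>(1 + A) * \<kappa>\<close> from the earlier directions
    together with \<open>4 * A * \<kappa>\<close>, which arises when the new amplitude meets the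
    remainder in the gradient of \<open>f\<close>.\<close>
  define L where "L = 5 * K + K'"
  show ?case
    unfolding corrugated_def
  proof (intro exI[of _ f'] exI[of _ W'] exI[of _ L] conjI allI ballI impI; (elim conjE)?)
    show "tame (\<lambda>n. n) X m f'" "tame (\<lambda>n. n) X m (W' j)" for m j by fact+
    show "0 \<le> L" using IH(3) S(3) by (simp add: L_def)
    fix n :: nat and x assume x: "x \<in> X"
    define \<kappa> where "\<kappa> = K / real (n + 1)"
    define \<kappa>' where "\<kappa>' = K' / real (n + 1)"
    have \<kappa>: "0 \<le> \<kappa>" "0 \<le> \<kappa>'" using IH(3) S(3) by (auto simp: \<kappa>_def \<kappa>'_def)
    have L: "L / real (n + 1) = 5 * \<kappa> + \<kappa>'" by (simp add: L_def \<kappa>_def \<kappa>'_def add_divide_distrib)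
    show "\<bar>f' n x\<bar> \<le> L / real (n + 1)"
      using P[where x1 = n, OF x] S(4)[OF x, of n] \<kappa> unfolding L \<kappa>_def[symmetric] \<kappa>'_def[symmetric] by linarith
    show "\<bar>W' j n x\<bar> \<le> L / real (n + 1)" for j
      using P[where x1 = n, OF x, THEN conjunct2, THEN conjunct1, rule_format, of j] S(5)[OF x, of j n] \<kappa> unfolding L \<kappa>_def[symmetric] \<kappa>'_def[symmetric] by linarith
    show "\<bar>strain H f' W' k l n x - (\<Sum>i\<in>insert \<iota> I. (a i n x)\<^sup>2 * \<eta> i $ k * \<eta> i $ l)\<bar> \<le> L / real (n + 1)" for k l
      using P[where x1 = n, OF x, THEN conjunct2, THEN conjunct2, THEN conjunct1, rule_format, of k l] S(8)[OF x, of k l n] \<kappa> insert.hyps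
      unfolding L \<kappa>_def[symmetric] \<kappa>'_def[symmetric] by simp
    fix A h assume A: "\<forall>i\<in>insert \<iota> I. \<bar>a i n x\<bar> \<le> A" "\<forall>j. \<bar>H j n x\<bar> \<le> h" "0 \<le> A"
    have aA: "\<bar>a \<iota> n x\<bar> \<le> A" and A': "\<forall>i\<in>I. \<bar>a i n x\<bar> \<le> A" using A(1) by auto
    have pf1: "\<bar>partial k (f n) x\<bar> \<le> 4 * N * A + \<kappa>"
      and pW1: "\<bar>partial k (W l n) x\<bar> \<le> N * (4 * A * (h + 4 * N * A) + 4 * A\<^sup>2) + (1 + A) * \<kappa>" for k l
      using P[where x1 = n, OF x, THEN conjunct2, THEN conjunct2, THEN conjunct2, rule_format, OF conjI[OF A' conjI[OF A(2,3)]]]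
      unfolding N_def \<kappa>_def by blast+
    show "\<bar>partial k (f' n) x\<bar> \<le> 4 * real (card (insert \<iota> I)) * A + L / real (n + 1)" for k
      using pf1[of k] S(6)[OF x, of k n] aA \<kappa> unfolding N(1) L \<kappa>'_def[symmetric] by (simp add: algebra_simps)
    fix k l
    have "\<bar>a \<iota> n x\<bar> * \<bar>H l n x + partial l (f n) x\<bar> \<le> A * (h + (4 * N * A + \<kappa>))"
      using aA A(2)[rule_format, of l] pf1[of l] by (intro mult_mono) (auto intro: A(3))
    moreover have "(a \<iota> n x)\<^sup>2 \<le> A\<^sup>2" using aA A(3) by (simp add: abs_le_square_iff[symmetric])
    ultimately have "\<bar>partial k (W' l n) x\<bar> \<le> \<bar>partial k (W l n) x\<bar> + 4 * (A * (h + (4 * N * A + \<kappa>))) + 4 * A\<^sup>2 + \<kappa>'"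
      using S(7)[OF x, of k l n] unfolding \<kappa>'_def[symmetric] by linarith
    also have "\<dots> \<le> N * (4 * A * (h + 4 * N * A) + 4 * A\<^sup>2) + (1 + A) * \<kappa> + 4 * (A * (h + (4 * N * A + \<kappa>))) + 4 * A\<^sup>2 + \<kappa>'"
      using pW1[of k l] by linarith
    also have "\<dots> = (N + 1) * (4 * A * (h + 4 * N * A) + 4 * A\<^sup>2) + ((1 + A) * \<kappa> + 4 * A * \<kappa> + \<kappa>')"
      by (simp add: algebra_simps)
    also have "\<dots> \<le> (N + 1) * (4 * A * (h + 4 * (N + 1) * A) + 4 * A\<^sup>2) + (1 + A) * (5 * \<kappa> + \<kappa>')"
    proof (rule add_mono)
      have "4 * A * (h + 4 * N * A) \<le> 4 * A * (h + 4 * (N + 1) * A)"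
        using A(3) N(2) by (intro mult_left_mono) (auto simp: algebra_simps)
      then show "(N + 1) * (4 * A * (h + 4 * N * A) + 4 * A\<^sup>2) \<le> (N + 1) * (4 * A * (h + 4 * (N + 1) * A) + 4 * A\<^sup>2)"
        using N(2) by (intro mult_left_mono) auto
      have "0 \<le> A * \<kappa>'" using A(3) \<kappa> by simp
      then show "(1 + A) * \<kappa> + 4 * A * \<kappa> + \<kappa>' \<le> (1 + A) * (5 * \<kappa> + \<kappa>')"
        using \<kappa> by (simp add: algebra_simps)
    qed
    finally show "\<bar>partial k (W' l n) x\<bar> \<le> real (card (insert \<iota> I)) * (4 * A * (h + 4 * real (card (insert \<iota> I)) * A) + 4 * A\<^sup>2)
            + (1 + A) * (L / real (n + 1))"
      unfolding N(1) L .
  qed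
  qed
qed

section \<open>Hoelder bounds for the data and perturbation by tame families\<close>

lemma C0_holder_continuous:
  assumes "C0_holder \<beta> A" "0 < \<beta>"
  shows "continuous_on UNIV A"
proof (cases "\<beta> \<le> 1")
  case True
  then show ?thesis using assms holder_imp_continuous unfolding C0_holder_def holder_def by metis
next
  case False
  then show ?thesis using assms C_class_continuous unfolding C0_holder_def C1_holder_def by metis
qed

lemma holder_bounded_C1:
  fixes f :: "real^'d \<Rightarrow> 'b::real_normed_vector"
  assumes "compact X" "convex X" "\<And>x. f differentiable (at x)" "continuous_on X (grad f)" "0 < s" "s \<le> 1"
  obtains c where "holder_bounded s X f c"
proof (cases "X = {}")
  case True
  then show thesis using that by (simp add: holder_bounded_def)
next
  case False
  have cf: "continuous_on X f"
    using assms(3) by (simp add: differentiable_imp_continuous_on differentiable_on_def differentiable_at_withinI)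
  have B: "dist x y \<le> diameter X" if "x \<in> X" "y \<in> X" for x y
    using diameter_bounded_bound[OF compact_imp_bounded[OF assms(1)] that] .
  define D where "D = max 1 (diameter X)"
  have D: "1 \<le> D" "\<And>x y. x \<in> X \<Longrightarrow> y \<in> X \<Longrightarrow> dist x y \<le> D" using B by (fastforce simp: D_def)+
  have n: "0 \<le> norm0 X (grad f)" using assms False by (intro norm0_nonneg)
  have "norm (f x - f y) \<le> norm0 X (grad f) * D * dist x y powr s" if "x \<in> X" "y \<in> X" for x y
  proof -
    have "dist x y \<le> D * dist x y powr s"
    proof (cases "dist x y = 0")
      case False
      have "dist x y = dist x y powr (1 - s) * dist x y powr s" using False by (simp flip: powr_add)
      also have "\<dots> \<le> D powr (1 - s) * dist x y powr s"
        using assms D(2)[OF that] by (intro mult_right_mono powr_mono2) auto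
      also have "\<dots> \<le> D powr 1 * dist x y powr s"
        using assms D(1) by (intro mult_right_mono powr_mono) auto
      finally show ?thesis using D(1) by simp
    qed (use D in simp)
    then have "norm0 X (grad f) * dist x y \<le> norm0 X (grad f) * (D * dist x y powr s)"
      using n by (rule mult_left_mono)
    then show ?thesis
      using convex_grad_bound[OF assms(2,3) norm0_ge[OF assms(1,4)] that] by (simp add: mult.assoc)
  qed
  moreover have "norm (f x) \<le> norm0 X f" if "x \<in> X" for x
    using norm0_ge[OF assms(1) cf that] .
  ultimately have "holder_bounded s X f (max (norm0 X f) (norm0 X (grad f) * D))"
    unfolding holder_bounded_def by (meson max.coboundedI1 max.cobounded2 mult_right_mono order_trans powr_ge_zero)
  then show thesis by (rule that)
qed

text \<open>Exponents above 1 are truncated: the first stage only needs some positive Hoelder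
  exponent, from which it draws its rate.\<close>

lemma holder_bounded_C0_holder:
  fixes A :: "real^'d \<Rightarrow> 'b::real_normed_vector"
  assumes "compact X" "convex X" "C0_holder \<beta> A" "0 < \<beta>" "\<beta> < 2"
  obtains c where "holder_bounded (min \<beta> 1) X A c"
proof (cases "\<beta> \<le> 1")
  case True
  then obtain L where L: "\<And>x y. norm (A x - A y) \<le> L * dist x y powr \<beta>"
    using assms(3) unfolding C0_holder_def holder_def by auto
  have c: "continuous_on X A" using C0_holder_continuous[OF assms(3,4)] continuous_on_subset by blast
  have "holder_bounded \<beta> X A (max (norm0 X A) L)"
    unfolding holder_bounded_def using norm0_ge[OF assms(1) c] L
    by (meson max.coboundedI1 max.cobounded2 mult_right_mono order_trans powr_ge_zero)
  then show thesis using that True by (simp add: min_def)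
next
  case False
  then have "C_class 1 A" using assms(3) by (simp add: C0_holder_def C1_holder_def)
  then have 1: "C_class (Suc 0) A" by (simp only: One_nat_def)
  have "continuous_on X (grad A)"
    using C_class_continuous[OF C_class_grad[OF 1]] continuous_on_subset by blast
  then obtain c where "holder_bounded 1 X A c"
    using holder_bounded_C1[OF assms(1,2) C_class_differentiable[OF 1], of 1] by auto
  then show thesis using that False by (simp add: min_def)
qed

lemma holder_bounded_nth:
  assumes "holder_bounded \<alpha> X f c"
  shows "holder_bounded \<alpha> X (\<lambda>x. f x $ i) c"
proof -
  have "norm (f x $ i - f y $ i) \<le> norm (f x - f y)" for x y
    using Finite_Cartesian_Product.norm_nth_le[of "f x - f y" i] by simp
  then show ?thesis using assms Finite_Cartesian_Product.norm_nth_le unfolding holder_bounded_def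
    by (meson order_trans)
qed

text \<open>The square root is not Lipschitz at 0. Cutting the radicand off at \<open>m\<close>
  makes it so on the whole line, hence also at those points of a cube around \<open>T\<close> where
  the defect is not bounded by its norm on \<open>T\<close>.\<close>

lemma sqrt_max_lipschitz:
  assumes "0 < m"
  shows "\<bar>sqrt (max m a) - sqrt (max m b)\<bar> \<le> \<bar>a - b\<bar> / sqrt m"
proof -
  have p: "0 < sqrt (max m a)" "sqrt m \<le> sqrt (max m a)" "0 < sqrt (max m b)" "0 < sqrt m" using assms by auto
  have "(sqrt (max m a) - sqrt (max m b)) * (sqrt (max m a) + sqrt (max m b)) = max m a - max m b"
    using assms by (simp add: algebra_simps)
  then have eq: "\<bar>sqrt (max m a) - sqrt (max m b)\<bar> * (sqrt (max m a) + sqrt (max m b)) = \<bar>max m a - max m b\<bar>"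
    using p by (metis abs_mult abs_of_pos add_pos_pos)
  have pp: "sqrt m \<le> sqrt (max m a) + sqrt (max m b)"
    by (rule add_increasing2[OF less_imp_le[OF p(3)] p(2)])
  have "\<bar>sqrt (max m a) - sqrt (max m b)\<bar> * sqrt m \<le> \<bar>max m a - max m b\<bar>"
    unfolding eq[symmetric] by (rule mult_left_mono[OF pp]) simp
  also have "\<dots> \<le> \<bar>a - b\<bar>" by (auto simp: max_def)
  finally have "\<bar>sqrt (max m a) - sqrt (max m b)\<bar> * sqrt m \<le> \<bar>a - b\<bar>" .
  then show ?thesis using p(4) by (simp add: field_simps)
qed

lemma partial_grad:
  assumes "C_class 2 f"
  shows "partial i (grad f) x = (\<chi> k. partial i (partial k f) x)"
proof -
  have "C_class (Suc (Suc 0)) f" using assms by (simp add: numeral_2_eq_2)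
  then have "partial k f differentiable (at x)" for k by simp
  from partial_vec(2)[OF this] show ?thesis by (simp add: grad_def[abs_def])
qed

text \<open>The fixed function \<open>v\<close> contributes a constant to \<open>norm2\<close>, so
  the growth in \<open>n\<close> is that of the tame family; its unknown second derivatives enter
  only through \<open>K\<close>.\<close>

lemma tame_perturbation:
  fixes v :: "real^'d \<Rightarrow> real^'m" and g :: "'m \<Rightarrow> nat \<Rightarrow> real^'d \<Rightarrow> real"
  assumes v: "C_class 2 v" and g: "\<And>j m. tame (\<lambda>n. n) X m (g j)" and T: "compact T" "T \<noteq> {}" "T \<subseteq> X"
  defines "u \<equiv> \<lambda>n x. v x + (\<chi> j. g j n x)"
  shows "C_class 2 (u n)" and "partial i (u n) x = partial i v x + (\<chi> j. partial i (g j n) x)"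
    and "\<exists>K q. 0 \<le> K \<and> (\<forall>n. norm2 T (u n) \<le> K * real (n + 1) ^ q)"
proof -
  define G where "G = (\<lambda>n x. \<chi> j. g j n x)"
  have G2: "C_class 2 (G n)" for n unfolding G_def by (intro C_class_vec tame_C_class[OF g])
  show C2: "C_class 2 (u n)" for n
    unfolding u_def using C_class_add[OF v G2[of n]] by (simp add: G_def)
  note dg = tame_differentiable[OF g]
  have pG: "partial i (G n) x = (\<chi> j. partial i (g j n) x)" for i n x
    unfolding G_def by (rule partial_vec) (rule dg)
  show pu: "partial i (u n) x = partial i v x + (\<chi> j. partial i (g j n) x)" for i n x
    using partial_add[OF C_class_2D(1)[OF v] C_class_2D(1)[OF G2[of n]]] pG
    by (simp add: u_def G_def)
  have ppG: "partial i (partial k (G n)) x = (\<chi> j. partial i (partial k (g j n)) x)" for i k n x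
  proof -
    have "partial k (G n) = (\<lambda>x. \<chi> j. partial k (g j n) x)" by (simp add: fun_eq_iff pG)
    then show ?thesis by (simp add: partial_vec(2) tame_differentiable[OF tame_partial[OF g]])
  qed
  define B where "B = (\<lambda>n x. (\<Sum>j\<in>UNIV. \<bar>g j n x\<bar>) + (\<Sum>i\<in>UNIV. \<Sum>j\<in>UNIV. \<bar>partial i (g j n) x\<bar>)
     + (\<Sum>i\<in>UNIV. \<Sum>k\<in>UNIV. \<Sum>j\<in>UNIV. \<bar>partial i (partial k (g j n)) x\<bar>))"
  have "poly_bounded (\<lambda>n. n) X B"
    unfolding B_def
    by (intro poly_bounded_add poly_bounded_sum poly_bounded_abs tame_poly_bounded[OF g]
        tame_poly_bounded[OF tame_partial[OF g, of 0]]
        tame_poly_bounded[OF tame_partial[OF tame_partial[OF g], of 0]]) auto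
  then obtain K q where K: "0 \<le> K" "\<And>n x. x \<in> X \<Longrightarrow> \<bar>B n x\<bar> \<le> K * real (n + 1) ^ q"
    by (rule poly_boundedE) blast
  have nn: "0 \<le> (\<Sum>j\<in>UNIV. \<bar>g j n x\<bar>)" "0 \<le> (\<Sum>i\<in>UNIV. \<Sum>j\<in>UNIV. \<bar>partial i (g j n) x\<bar>)"
    "0 \<le> (\<Sum>i\<in>UNIV. \<Sum>k\<in>UNIV. \<Sum>j\<in>UNIV. \<bar>partial i (partial k (g j n)) x\<bar>)" for n x
    by (intro sum_nonneg; simp)+
  have n1: "norm (G n x) \<le> B n x" for n x
    using norm_vec_le_sum[of "G n x"] nn[of n x] unfolding B_def G_def by simp
  have n2: "norm (grad (G n) x) \<le> B n x" for n x
  proof -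
    have "norm (grad (G n) x) \<le> (\<Sum>i\<in>UNIV. norm (partial i (G n) x))"
      using norm_vec_le_sum[of "grad (G n) x"] by (simp add: grad_def)
    also have "\<dots> \<le> (\<Sum>i\<in>UNIV. \<Sum>j\<in>UNIV. \<bar>partial i (g j n) x\<bar>)"
      by (rule sum_mono) (rule order_trans[OF norm_vec_le_sum], simp add: pG)
    finally show ?thesis using nn[of n x] unfolding B_def by linarith
  qed
  have n3: "norm (grad (grad (G n)) x) \<le> B n x" for n x
  proof -
    have "norm (grad (grad (G n)) x) \<le> (\<Sum>i\<in>UNIV. norm (partial i (grad (G n)) x))"
      using norm_vec_le_sum[of "grad (grad (G n)) x"] by (simp add: grad_def)
    also have "\<dots> \<le> (\<Sum>i\<in>UNIV. \<Sum>k\<in>UNIV. norm (partial i (partial k (G n)) x))"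
      by (rule sum_mono) (rule order_trans[OF norm_vec_le_sum], simp add: partial_grad[OF G2])
    also have "\<dots> \<le> (\<Sum>i\<in>UNIV. \<Sum>k\<in>UNIV. \<Sum>j\<in>UNIV. \<bar>partial i (partial k (g j n)) x\<bar>)"
      by (intro sum_mono) (rule order_trans[OF norm_vec_le_sum], simp add: ppG)
    finally show ?thesis using nn[of n x] unfolding B_def by linarith
  qed
  have uG: "u n = (\<lambda>x. v x + G n x)" for n by (simp add: u_def G_def)
  have gu: "grad (u n) = (\<lambda>x. grad v x + grad (G n) x)" for n
    unfolding uG fun_eq_iff using grad_add C_class_2D(1) v G2 by blast
  have ggu: "grad (grad (u n)) x = grad (grad v) x + grad (grad (G n)) x" for n x
    unfolding gu using grad_add C_class_2D(2) v G2 by blast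
  note nv = norm0_ge[OF T(1) C_class_2D(3)[OF v]] norm0_ge[OF T(1) C_class_2D(4)[OF v]]
    norm0_ge[OF T(1) C_class_2D(5)[OF v]]
  have "norm2 T (u n) \<le> (\<bar>norm2 T v\<bar> + 3 * K) * real (n + 1) ^ q" for n
  proof -
    let ?b = "K * real (n + 1) ^ q"
    have b: "B n x \<le> ?b" if "x \<in> T" for x using K(2)[of x n] that T(3) by (auto intro: order_trans[OF abs_ge_self])
    have "norm2 T (u n) \<le> (norm0 T v + ?b) + (norm0 T (grad v) + ?b) + (norm0 T (grad (grad v)) + ?b)"
    proof (rule norm2_le[OF T(2)])
      fix x assume x: "x \<in> T"
      show "norm (u n x) \<le> norm0 T v + ?b" unfolding uG
        by (rule norm_triangle_mono[OF nv(1)[OF x] order_trans[OF n1 b[OF x]]])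
      show "norm (grad (u n) x) \<le> norm0 T (grad v) + ?b" unfolding gu
        by (rule norm_triangle_mono[OF nv(2)[OF x] order_trans[OF n2 b[OF x]]])
      show "norm (grad (grad (u n)) x) \<le> norm0 T (grad (grad v)) + ?b" unfolding ggu
        by (rule norm_triangle_mono[OF nv(3)[OF x] order_trans[OF n3 b[OF x]]])
    qed
    also have "\<dots> = norm2 T v + 3 * ?b" by (simp add: norm2_def)
    also have "\<dots> \<le> \<bar>norm2 T v\<bar> * real (n + 1) ^ q + 3 * ?b"
      using mult_left_mono[OF one_le_power[of "real (n + 1)" q], of "\<bar>norm2 T v\<bar>"] abs_ge_self[of "norm2 T v"] by simp
    finally show ?thesis by (simp add: distrib_right)
  qed
  moreover have "0 \<le> \<bar>norm2 T v\<bar> + 3 * K" using K(1) by simp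
  ultimately show "\<exists>K q. 0 \<le> K \<and> (\<forall>n. norm2 T (u n) \<le> K * real (n + 1) ^ q)" by blast
qed

subsection \<open>Decomposition of symmetric matrices into rank one matrices\<close>

text \<open>The vectors \<open>e_i + e_j\<close> and \<open>e_i - e_j\<close> for all ordered pairs.
  The diagonal pairs give \<open>2 * e_i\<close> and 0, so no case distinction is needed.\<close>

definition direction :: "'d \<times> 'd \<times> bool \<Rightarrow> real^'d" where
  "direction = (\<lambda>(i, j, b). axis i 1 + (if b then 1 else - 1) *\<^sub>R axis j 1)"

lemma direction_le: "\<bar>direction p $ k\<bar> \<le> 2"
  by (cases p) (auto simp: direction_def axis_def)

text \<open>Polarization: the squares of \<open>e_i + e_j\<close> and \<open>e_i - e_j\<close>
  differ by \<open>2 * (e_i e_j + e_j e_i)\<close>. Weighting by \<open>D i j / 4\<close> and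
  summing over ordered pairs gives the symmetric part of \<open>D\<close>. The weights have either
  sign, so they become squares of amplitudes only after a positive constant is added.\<close>

lemma direction_decomposition:
  fixes D :: "'d::finite \<Rightarrow> 'd \<Rightarrow> real"
  assumes "\<And>i j. D i j = D j i"
  shows "(\<Sum>p\<in>UNIV. (case p of (i, j, b) \<Rightarrow> (if b then 1 else - 1) * D i j / 4) * direction p $ k * direction p $ l) = D k l"
proof -
  define e where "e = (\<lambda>(i::'d) k. if i = k then 1 else (0::real))"
  have "(\<Sum>p\<in>UNIV. (case p of (i, j, b) \<Rightarrow> (if b then 1 else - 1) * D i j / 4) * direction p $ k * direction p $ l)
     = (\<Sum>i\<in>UNIV. \<Sum>j\<in>UNIV. \<Sum>b\<in>UNIV. (if b then 1 else - 1) * D i j / 4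
         * (e i k + (if b then 1 else - 1) * e j k) * (e i l + (if b then 1 else - 1) * e j l))"
    unfolding UNIV_Times_UNIV[symmetric] sum.cartesian_product'
    by (intro sum.cong) (auto simp: direction_def axis_def e_def)
  also have "\<dots> = (\<Sum>i\<in>UNIV. \<Sum>j\<in>UNIV. D i j / 2 * (e i k * e j l) + D i j / 2 * (e j k * e i l))"
    by (intro sum.cong) (simp_all add: UNIV_bool field_simps)
  also have "\<dots> = (\<Sum>i\<in>UNIV. (\<Sum>j\<in>UNIV. if j = l then e i k * (D i l / 2) else 0)
      + (\<Sum>j\<in>UNIV. if j = k then e i l * (D i k / 2) else 0))"
    unfolding sum.distrib[symmetric] by (intro sum.cong) (auto simp: e_def)
  also have "\<dots> = (\<Sum>i\<in>UNIV. (if i = k then D k l / 2 else 0) + (if i = l then D l k / 2 else 0))"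
    by (intro sum.cong) (auto simp: e_def)
  also have "\<dots> = D k l" by (simp add: sum.distrib assms[of l k])
  finally show ?thesis .
qed

section \<open>The first stage\<close>

lemma defect_nth:
  "defect A v w x $ k $ l = A x $ k $ l - ((partial k v x \<bullet> partial l v x) / 2
     + (partial k w x $ l + partial l w x $ k) / 2)"
  by (simp add: defect_def gram_def sym_grad_nth)


lemma norm_matrix_le:
  assumes "\<And>i j. \<bar>(M :: real^'m^'n) $ i $ j\<bar> \<le> c"
  shows "norm M \<le> real CARD('n) * (real CARD('m) * c)"
  by (intro norm_vec_le_card) (simp add: assms)

lemma le_rate:
  assumes "0 < s" "s \<le> 1" "0 \<le> K"
  shows "K / real (n + 1) \<le> K * real (n + 1) powr (- s / 2)"
proof -
  have "real (n + 1) powr (- 1) \<le> real (n + 1) powr (- s / 2)"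
    using assms by (intro powr_mono) auto
  then have "K * real (n + 1) powr (- 1) \<le> K * real (n + 1) powr (- s / 2)"
    using assms(3) by (rule mult_left_mono)
  moreover have "real (n + 1) powr (- 1) = 1 / real (n + 1)"
    using powr_minus_divide[of "real (n + 1)" 1] by simp
  ultimately show ?thesis by simp
qed

definition approximating_family ::
  "(real^'d) set \<Rightarrow> (real^'d \<Rightarrow> real^'d^'d) \<Rightarrow> (real^'d \<Rightarrow> real^'k) \<Rightarrow> (real^'d \<Rightarrow> real^'d) \<Rightarrow> real \<Rightarrow>
    real \<Rightarrow> real \<Rightarrow> nat \<Rightarrow> (nat \<Rightarrow> real^'d \<Rightarrow> real^'k) \<Rightarrow> (nat \<Rightarrow> real^'d \<Rightarrow> real^'d) \<Rightarrow> bool" where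
  "approximating_family T A v w C s K q vs ws \<longleftrightarrow> 0 < s \<and> 0 \<le> K \<and> (\<forall>n. C_class 2 (vs n) \<and> C_class 2 (ws n) \<and>
      norm2 T (vs n) \<le> K * real (n + 1) ^ q \<and> norm2 T (ws n) \<le> K * real (n + 1) ^ q \<and>
      norm0 T (defect A (vs n) (ws n)) \<le> K * real (n + 1) powr (- s) \<and>
      (\<forall>x\<in>T. norm (vs n x - v x) \<le> C * sqrt (norm0 T (defect A v w)) + K * real (n + 1) powr (- s) \<and>
        norm (grad (vs n) x - grad v x) \<le> C * sqrt (norm0 T (defect A v w)) + K * real (n + 1) powr (- s) \<and>
        norm (ws n x - w x) \<le>
          C * sqrt (norm0 T (defect A v w)) * (1 + norm0 T (grad v)) + K * real (n + 1) powr (- s) \<and>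
        norm (grad (ws n) x - grad w x) \<le>
          C * sqrt (norm0 T (defect A v w)) * (1 + norm0 T (grad v)) + K * real (n + 1) powr (- s)))"

text \<open>
  The constant in front of \<open>\<parallel>D\<parallel>\<^sub>0\<^sup>1\<^sup>/\<^sup>2\<close> does not depend on the functions, whereas the rate \<open>s\<close>, the degree \<open>q\<close>
  and \<open>K\<close> may. This is what allows the iteration to start from arbitrarily large second derivatives.
\<close>

lemma initial_stage:
  fixes T :: "(real^'d) set"
  assumes T: "compact T" "T \<noteq> {}"
  shows "\<exists>C\<ge>0. \<forall>\<beta> A (v :: real^'d \<Rightarrow> real^'k) w.
    0 < \<beta> \<and> \<beta> < 2 \<and> C0_holder_sym \<beta> A \<and> C_class 2 v \<and> C_class 2 w \<and>
    0 < norm0 T (defect A v w) \<and> norm0 T (defect A v w) \<le> 1 \<longrightarrow>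
    (\<exists>s K q vs ws. approximating_family T A v w C s K q vs ws)"
proof -
  obtain R0 where R0: "\<And>x. x \<in> T \<Longrightarrow> norm x \<le> R0"
    using compact_imp_bounded[OF T(1)] bounded_iff by blast
  define R where "R = max 1 R0"
  \<comment> \<open>Bernstein approximation lives on a cube, so amplitudes and gradients are
    approximated on a cube containing \<open>T\<close>.\<close>
  define X where "X = {x :: real^'d. \<forall>i. \<bar>x $ i\<bar> \<le> R}"
  have R: "0 < R" by (simp add: R_def)
  have Xbox: "X = cbox (\<chi> i. - R) (\<chi> i. R)"
  proof -
    have "\<bar>a\<bar> \<le> R \<longleftrightarrow> - R \<le> a \<and> a \<le> R" for a :: real by linarith
    then show ?thesis unfolding X_def by (auto simp only: mem_box_cart vec_lambda_beta set_eq_iff mem_Collect_eq)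
  qed
  have X: "compact X" "convex X" "bounded X" by (simp_all add: Xbox)
  have TX: "T \<subseteq> X"
  proof
    fix x assume "x \<in> T"
    then have "\<bar>x $ i\<bar> \<le> R" for i using R0[of x] component_le_norm_cart[of x i] by (simp add: R_def)
    then show "x \<in> X" by (simp add: X_def)
  qed
  define d where "d = real CARD('d)"
  define N where "N = real CARD('d \<times> 'd \<times> bool)"
  have dN: "0 \<le> d" "0 \<le> N" by (simp_all add: d_def N_def)
  \<comment> \<open>\<open>C1\<close> serves the gradient of the change of \<open>v\<close>,
    \<open>C2\<close> the values and \<open>C3\<close> the gradient of the change of
    \<open>w\<close>. They involve only the dimension, the number of directions and the size of
    \<open>T\<close>.\<close>
  define C1 where "C1 = d * (8 * N)"
  define C2 where "C2 = d * (d * (4 * N * R))"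
  define C3 where "C3 = d * (d * (N * (24 + 64 * N) + 4 * N))"
  define C where "C = C1 + C2 + C3"
  have C0: "0 \<le> C1" "0 \<le> C2" "0 \<le> C3" using dN R by (simp_all add: C1_def C2_def C3_def)
  show ?thesis
  proof (rule exI[of _ C], intro conjI allI impI; (elim conjE)?)
    show "0 \<le> C" using C0 by (simp add: C_def)
    fix \<beta> A and v :: "real^'d \<Rightarrow> real^'k" and w
    assume \<beta>: "0 < \<beta>" "\<beta> < 2" and A: "C0_holder_sym \<beta> A" and v: "C_class 2 v" and w: "C_class 2 w"
      and \<tau>: "0 < norm0 T (defect A v w)" "norm0 T (defect A v w) \<le> 1"
    define \<tau> where "\<tau> = norm0 T (defect A v w)"
    define t where "t = sqrt \<tau>"
    have t: "0 < \<tau>" "\<tau> \<le> 1" "0 < t" "t \<le> 1" "\<tau> = t * t" "\<tau> \<le> t"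
    proof -
      show \<tau>': "0 < \<tau>" "\<tau> \<le> 1" using \<tau> by (simp_all add: \<tau>_def)
      then show t': "0 < t" "t \<le> 1" "\<tau> = t * t" by (simp_all add: t_def)
      show "\<tau> \<le> t" using t' by (simp add: mult_left_le)
    qed
    define G where "G = norm0 T (grad v)"
    have G: "0 \<le> G" unfolding G_def by (intro norm0_nonneg T C_class_2D v)
    define s where "s = min \<beta> 1"
    have s: "0 < s" "s \<le> 1" using \<beta> by (auto simp: s_def)
    have contA: "continuous_on Y A" for Y
      using A C0_holder_continuous \<beta>(1) continuous_on_subset unfolding C0_holder_sym_def by blast
    obtain cA where cA: "holder_bounded s X A cA"
      unfolding s_def using holder_bounded_C0_holder[OF X(1,2) _ \<beta>] A by (auto simp: C0_holder_sym_def)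
    obtain cv where cv: "holder_bounded s X (grad v) cv"
      using holder_bounded_C1[OF X(1,2) C_class_2D(2,5)[OF v] s] by blast
    obtain cw where cw: "holder_bounded s X (grad w) cw"
      using holder_bounded_C1[OF X(1,2) C_class_2D(2,5)[OF w] s] by blast
    define D where "D = (\<lambda>k l x. defect A v w x $ k $ l)"
    have Dsym: "D k l x = D l k x" for k l x
    proof -
      have "transpose (A x) = A x" using A by (simp add: C0_holder_sym_def)
      then have "A x $ k $ l = transpose (A x) $ k $ l" by simp
      then have "A x $ k $ l = A x $ l $ k" by (simp add: transpose_def)
      then show ?thesis by (simp add: D_def defect_nth inner_commute add.commute)
    qed
    have "\<exists>c. holder_bounded s X (D k l) c" for k l
    proof -
      have "D k l = (\<lambda>x. A x $ k $ l - ((1/2) *\<^sub>R (grad v x $ k \<bullet> grad v x $ l)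
          + (1/2) *\<^sub>R (grad w x $ k $ l + grad w x $ l $ k)))"
        by (simp add: fun_eq_iff D_def defect_nth grad_def)
      moreover have hA: "holder_bounded s X (\<lambda>x. A x $ k $ l) cA"
        by (rule holder_bounded_nth[OF holder_bounded_nth[OF cA]])
      moreover have hv: "holder_bounded s X (\<lambda>x. grad v x $ k \<bullet> grad v x $ l) (2 * cv * cv)"
        by (rule holder_bounded_inner[OF holder_bounded_nth[OF cv] holder_bounded_nth[OF cv]])
      moreover have hw: "holder_bounded s X (\<lambda>x. grad w x $ k $ l + grad w x $ l $ k) (cw + cw)"
        by (rule holder_bounded_add[OF holder_bounded_nth[OF holder_bounded_nth[OF cw]] holder_bounded_nth[OF holder_bounded_nth[OF cw]]])
      ultimately show ?thesis
        using holder_bounded_diff[OF hA holder_bounded_add[OF holder_bounded_cmult[OF hv, of "1/2"]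
            holder_bounded_cmult[OF hw, of "1/2"]]] by auto
    qed
    then obtain cD where cD: "\<And>k l. holder_bounded s X (D k l) (cD k l)" by metis
    have DT: "\<bar>D k l x\<bar> \<le> \<tau>" if "x \<in> T" for k l x
    proof -
      have "\<bar>D k l x\<bar> \<le> norm (defect A v w x $ k)" unfolding D_def by (rule component_le_norm_cart)
      also have "\<dots> \<le> norm (defect A v w x)" by (rule Finite_Cartesian_Product.norm_nth_le)
      also have "\<dots> \<le> \<tau>" unfolding \<tau>_def
        by (intro norm0_ge[OF T(1) _ that] continuous_on_defect contA v w)
      finally show ?thesis .
    qed
    define \<sigma> where "\<sigma> = (\<lambda>b. if b then 1 else - 1 :: real)"
    \<comment> \<open>Adding \<tau> to every weight makes it at least \<open>3 * \<tau> / 4\<close>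
      on \<open>T\<close>, where the entries of the defect are at most \<tau>. There the cut-off at
      \<open>\<tau>/2\<close> is inactive; elsewhere it keeps the square root Hoelder.\<close>
    define a where "a = (\<lambda>p x. case p of (i, j, b) \<Rightarrow> sqrt (max (\<tau>/2) (\<tau> + \<sigma> b * D i j x / 4)))"
    have aH: "\<exists>L. \<forall>x\<in>X. \<forall>y\<in>X. \<bar>a p x - a p y\<bar> \<le> L * dist x y powr s" for p
    proof (cases p)
      case (fields i j b)
      have "\<bar>a p x - a p y\<bar> \<le> cD i j / sqrt (\<tau>/2) * dist x y powr s" if "x \<in> X" "y \<in> X" for x y
      proof -
        have "\<bar>a p x - a p y\<bar> \<le> \<bar>(\<tau> + \<sigma> b * D i j x / 4) - (\<tau> + \<sigma> b * D i j y / 4)\<bar> / sqrt (\<tau>/2)"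
          unfolding a_def fields prod.case using t by (intro sqrt_max_lipschitz) simp
        also have "\<dots> \<le> \<bar>D i j x - D i j y\<bar> / sqrt (\<tau>/2)"
          using t by (intro divide_right_mono) (auto simp: \<sigma>_def)
        also have "\<dots> \<le> (cD i j * dist x y powr s) / sqrt (\<tau>/2)"
          using cD[of i j] that t by (intro divide_right_mono) (auto simp: holder_bounded_def)
        finally show ?thesis by simp
      qed
      then show ?thesis by blast
    qed
    have "\<exists>F K. (\<forall>m. tame (\<lambda>n. n) X m F) \<and> 0 \<le> K \<and>
        (\<forall>n. \<forall>x\<in>X. \<bar>F n x - a p x\<bar> \<le> K * real (n + 1) powr (- s / 2))" for p
    proof -
      obtain L where L: "\<And>x y. x \<in> X \<Longrightarrow> y \<in> X \<Longrightarrow> \<bar>a p x - a p y\<bar> \<le> L * dist x y powr s" using aH by blast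
      obtain F K where "\<And>m. tame (\<lambda>n. n) X m F" "0 \<le> K"
        "\<And>n x. x \<in> X \<Longrightarrow> \<bar>F n x - a p x\<bar> \<le> K * real (n + 1) powr (- s / 2)"
        using Bernstein_approximation[OF R X_def s L] by blast
      then show ?thesis by (intro exI[of _ F] exI[of _ K]) simp
    qed
    then obtain an Ka where an: "\<And>p m. tame (\<lambda>n. n) X m (an p)" "\<And>p. 0 \<le> Ka p"
      "\<And>p n x. x \<in> X \<Longrightarrow> \<bar>an p n x - a p x\<bar> \<le> Ka p * real (n + 1) powr (- s / 2)" by metis
    \<comment> \<open>An arbitrary component. All corrugations go into this single one, so any
      codimension is sufficient.\<close>
    define j0 where "j0 = (undefined :: 'k)"
    define h where "h = (\<lambda>i x. partial i v x $ j0)"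
    have "\<exists>F K. (\<forall>m. tame (\<lambda>n. n) X m F) \<and> 0 \<le> K \<and>
        (\<forall>n. \<forall>x\<in>X. \<bar>F n x - h i x\<bar> \<le> K * real (n + 1) powr (- s / 2))" for i
    proof -
      have "holder_bounded s X (h i) cv"
        using holder_bounded_nth[OF holder_bounded_nth[OF cv], of i j0] by (simp add: h_def grad_def)
      then have L: "\<And>x y. x \<in> X \<Longrightarrow> y \<in> X \<Longrightarrow> \<bar>h i x - h i y\<bar> \<le> cv * dist x y powr s"
        by (simp add: holder_bounded_def)
      obtain F K where "\<And>m. tame (\<lambda>n. n) X m F" "0 \<le> K"
        "\<And>n x. x \<in> X \<Longrightarrow> \<bar>F n x - h i x\<bar> \<le> K * real (n + 1) powr (- s / 2)"
        using Bernstein_approximation[OF R X_def s L] by blast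
      then show ?thesis by (intro exI[of _ F] exI[of _ K]) simp
    qed
    then obtain H Kh where H: "\<And>i m. tame (\<lambda>n. n) X m (H i)" "\<And>i. 0 \<le> Kh i"
      "\<And>i n x. x \<in> X \<Longrightarrow> \<bar>H i n x - h i x\<bar> \<le> Kh i * real (n + 1) powr (- s / 2)" by metis
    define r where "r = (\<lambda>n. real (n + 1) powr (- s / 2))"
    have r: "0 \<le> r n" "r n \<le> 1" for n
      using powr_mono[of "- s / 2" 0 "real (n + 1)"] s by (auto simp: r_def)
    define K1 where "K1 = (\<Sum>p\<in>UNIV. Ka p) + (\<Sum>i\<in>UNIV. Kh i)"
    have K1: "0 \<le> K1" "Ka p \<le> K1" "Kh i \<le> K1" for p i
    proof -
      have nn: "0 \<le> (\<Sum>p\<in>UNIV. Ka p)" "0 \<le> (\<Sum>i\<in>UNIV. Kh i)" using an(2) H(2) by (auto intro: sum_nonneg)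
      then show "0 \<le> K1" by (simp add: K1_def)
      show "Ka p \<le> K1" using member_le_sum[of p UNIV Ka] an(2) nn by (simp add: K1_def)
      show "Kh i \<le> K1" using member_le_sum[of i UNIV Kh] H(2) nn by (simp add: K1_def)
    qed
    have an_r: "\<bar>an p n x - a p x\<bar> \<le> K1 * r n" and H_r: "\<bar>H i n x - h i x\<bar> \<le> K1 * r n" if "x \<in> X" for p i n x
      using an(3)[OF that, of p n] H(3)[OF that, of i n] mult_right_mono[OF K1(2) r(1)[of n], of p]
        mult_right_mono[OF K1(3) r(1)[of n], of i] unfolding r_def by linarith+
    obtain f W K2 where "corrugated X UNIV an H direction f W K2"
      using corrugations[where I = UNIV and a = an and H = H and \<eta> = direction, OF finite X(3) an(1) H(1) direction_le]
      by blast
    note cor = this[unfolded corrugated_def, folded N_def]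
    have fW: "\<And>m. tame (\<lambda>n. n) X m f" "\<And>j m. tame (\<lambda>n. n) X m (W j)" "0 \<le> K2"
      using cor[THEN conjunct1] cor[THEN conjunct2, THEN conjunct1] cor[THEN conjunct2, THEN conjunct2, THEN conjunct1] by blast+
    note P = cor[THEN conjunct2, THEN conjunct2, THEN conjunct2]
    \<comment> \<open>The metric produced in excess by adding \<tau> to every weight. It is a
      constant symmetric matrix, hence the symmetric gradient of the linear field
      \<open>x \<mapsto> Pm x\<close>, which is subtracted from \<open>w\<close>.\<close>
    define Pm where "Pm = (\<lambda>(k::'d) l. \<Sum>p\<in>UNIV. \<tau> * direction p $ k * direction p $ l)"
    have Pm_le: "\<bar>Pm k l\<bar> \<le> 4 * N * \<tau>" for k l
    proof -
      have "\<bar>\<tau> * direction p $ k * direction p $ l\<bar> \<le> \<tau> * 2 * 2" for p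
        using t(1) by (intro abs_mult_le direction_le) simp
      then have "(\<Sum>p\<in>UNIV. \<bar>\<tau> * direction p $ k * direction p $ l\<bar>)
          \<le> (\<Sum>p\<in>(UNIV :: ('d \<times> 'd \<times> bool) set). \<tau> * 2 * 2)" by (intro sum_mono)
      then have "\<bar>Pm k l\<bar> \<le> (\<Sum>p\<in>(UNIV :: ('d \<times> 'd \<times> bool) set). \<tau> * 2 * 2)"
        unfolding Pm_def by (rule order_trans[OF sum_abs])
      then show ?thesis by (simp add: N_def)
    qed
    define gv where "gv = (\<lambda>j n x. if j = j0 then f n x else 0)"
    define gw where "gw = (\<lambda>j n x. W j n x - (\<Sum>k\<in>UNIV. Pm j k * x $ k))"
    have tgv: "tame (\<lambda>n. n) X m (gv j)" for m j
      by (cases "j = j0") (simp_all add: gv_def fW(1)[unfolded eta_contract_eq] tame_const fW)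
    have tlin: "tame (\<lambda>n. n) X m (\<lambda>n x. \<Sum>k\<in>UNIV. Pm j k * x $ k)" for m j
      by (intro tame_sum tame_mult tame_const tame_coordinate X) simp
    have tgw: "tame (\<lambda>n. n) X m (gw j)" for m j
      unfolding gw_def by (intro tame_diff fW tlin)
    define vs where "vs = (\<lambda>n x. v x + (\<chi> j. gv j n x))"
    define ws where "ws = (\<lambda>n x. w x + (\<chi> j. gw j n x))"
    have vs_eq: "(\<lambda>x. v x + (\<chi> j. gv j n x)) = vs n" and ws_eq: "(\<lambda>x. w x + (\<chi> j. gw j n x)) = ws n" for n
      by (simp_all add: vs_def ws_def)
    note V = tame_perturbation[where g = gv, OF v tgv T TX, unfolded vs_eq] and Wp = tame_perturbation[where g = gw, OF w tgw T TX, unfolded ws_eq]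
    obtain Kv qv where Kv: "0 \<le> Kv" "\<And>n. norm2 T (vs n) \<le> Kv * real (n + 1) ^ qv" using V(3) by blast
    obtain Kw qw where Kw: "0 \<le> Kw" "\<And>n. norm2 T (ws n) \<le> Kw * real (n + 1) ^ qw" using Wp(3) by blast
    have pgv: "partial i (gv j n) x = (if j = j0 then partial i (f n) x else 0)" for i j n x
      by (cases "j = j0") (simp_all add: gv_def partial_const)
    have pgw: "partial i (gw j n) x = partial i (W j n) x - Pm j i" for i j n x
    proof -
      have "((\<lambda>x. \<Sum>k\<in>UNIV. Pm j k * x $ k) has_derivative (\<lambda>h. \<Sum>k\<in>UNIV. Pm j k * h $ k)) (at x)"
        by (intro has_derivative_sum has_derivative_mult_right
            bounded_linear.has_derivative[OF bounded_linear_vec_nth has_derivative_ident])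
      from partial_eq[OF this] have "partial i (\<lambda>x. \<Sum>k\<in>UNIV. Pm j k * x $ k) x = Pm j i"
        by (simp add: axis_def if_distrib cong: if_cong)
      then show ?thesis unfolding gw_def
        using partial_diff[OF tame_differentiable[OF fW(2)] tame_differentiable[OF tlin]] by simp
    qed
    have Psym: "Pm k l = Pm l k" for k l by (simp add: Pm_def mult.commute mult.left_commute)
    \<comment> \<open>The strain was arranged for \<open>H\<close> instead of the true gradient
      \<open>h\<close>; the discrepancy enters only through \<open>H - h\<close> times first
      derivatives of \<open>f\<close>, which are bounded uniformly in \<open>n\<close>.\<close>
    have defect_kl: "defect A (vs n) (ws n) x $ k $ l = D k l x + Pm k l - strain H f W k l n x
        + ((H k n x - h k x) * partial l (f n) x + (H l n x - h l x) * partial k (f n) x) / 2" for n x k l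
    proof -
      have "partial k (vs n) x \<bullet> partial l (vs n) x = partial k v x \<bullet> partial l v x
          + h k x * partial l (f n) x + partial k (f n) x * h l x + partial k (f n) x * partial l (f n) x"
      proof -
        have ax: "(\<chi> j. partial i (gv j n) x) = axis j0 (partial i (f n) x)" for i
          by (simp add: vec_eq_iff pgv axis_def)
        show ?thesis unfolding V(2) ax h_def
          by (simp add: inner_add_left inner_add_right inner_axis inner_axis' algebra_simps)
      qed
      then show ?thesis
        unfolding defect_nth strain_def D_def Wp(2) using Psym[of k l]
        by (simp add: pgw algebra_simps add_divide_distrib diff_divide_distrib)
    qed
    \<comment> \<open>\<open>KA\<close> and \<open>Kf\<close> bound the amplitudes and the first
      derivatives of \<open>f\<close>; the other constants are coefficients of the decaying factor
      \<open>r n\<close>, one for each estimate, and \<open>K\<close> dominates them all.\<close>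
    define KA where "KA = 2 + K1"
    define Kf where "Kf = 4 * N * KA + K2"
    define Ke where "Ke = N * (K1 * (4 + K1) * 2 * 2) + K2 + K1 * Kf"
    define Kg where "Kg = 4 * N * K1 + K2"
    define KW where "KW = N * K1 * (8 + 4 * G + 4 * K1 + (16 * N + 4) * (4 + K1)) + (3 + K1) * K2"
    define K where "K = Kv + Kw + d * (d * Ke) + d * Kg + d * (d * KW) + d * K2 + K2"
    have nonneg: "0 \<le> KA" "0 \<le> Kf" "0 \<le> Ke" "0 \<le> Kg" "0 \<le> KW"
      using dN K1(1) fW(3) G by (simp_all add: KA_def Kf_def Ke_def Kg_def KW_def)
    have nonneg2: "0 \<le> d * (d * Ke)" "0 \<le> d * Kg" "0 \<le> d * (d * KW)" "0 \<le> d * K2"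
      using dN nonneg fW(3) by simp_all
    have K_ge: "0 \<le> K" "Kv \<le> K" "Kw \<le> K" "d * (d * Ke) \<le> K" "d * Kg \<le> K" "d * (d * KW) \<le> K" "d * K2 \<le> K" "K2 \<le> K"
      unfolding K_def using nonneg2 Kv(1) Kw(1) fW(3) by linarith+
    have rate: "K2 / real (n + 1) \<le> K2 * r n" for n unfolding r_def by (rule le_rate[OF s fW(3)])
    have K1r: "0 \<le> K1 * r n" "K1 * r n \<le> K1" for n using K1(1) r[of n] by (simp_all add: mult_left_le)
    have a_le: "\<bar>a p x\<bar> \<le> 2 * t" and a_sq: "(a p x)\<^sup>2 = \<tau> + (case p of (i, j, b) \<Rightarrow> \<sigma> b * D i j x / 4)"
      if "x \<in> T" for p x
    proof -
      obtain i j b where p: "p = (i, j, b)" by (cases p)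
      have "\<bar>\<sigma> b * D i j x / 4\<bar> \<le> \<tau> / 4" using DT[OF that, of i j] by (simp add: \<sigma>_def abs_mult)
      then have 1: "\<tau>/2 \<le> \<tau> + \<sigma> b * D i j x / 4" "\<tau> + \<sigma> b * D i j x / 4 \<le> 4 * \<tau>"
        unfolding abs_le_iff using t(1) by linarith+
      then have 2: "a p x = sqrt (\<tau> + \<sigma> b * D i j x / 4)" by (simp add: a_def p max_def)
      show "(a p x)\<^sup>2 = \<tau> + (case p of (i, j, b) \<Rightarrow> \<sigma> b * D i j x / 4)" using 1 2 t(1) by (simp add: p)
      have "sqrt (\<tau> + \<sigma> b * D i j x / 4) \<le> sqrt (4 * \<tau>)" using 1 by (intro real_sqrt_le_mono)
      also have "\<dots> = 2 * t" by (simp add: t_def real_sqrt_mult)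
      finally show "\<bar>a p x\<bar> \<le> 2 * t" using 1 2 t(1) by simp
    qed
    have main: "\<bar>f n x\<bar> \<le> K2 * r n" "\<bar>W j n x\<bar> \<le> K2 * r n" "\<bar>partial k (f n) x\<bar> \<le> 8 * N * t + Kg * r n"
      "\<bar>partial k (f n) x\<bar> \<le> Kf"
      "\<bar>partial k (W l n) x\<bar> \<le> N * (24 + 64 * N) * (t * (1 + G)) + KW * r n"
      "\<bar>defect A (vs n) (ws n) x $ k $ l\<bar> \<le> Ke * r n" if x: "x \<in> T" for n x j k l
    proof -
      have xX: "x \<in> X" using x TX by blast
      note Pn = P[THEN spec, THEN bspec, OF xX, of n]
      show "\<bar>f n x\<bar> \<le> K2 * r n" using Pn[THEN conjunct1] rate[of n] by linarith
      show "\<bar>W j n x\<bar> \<le> K2 * r n"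
        using Pn[THEN conjunct2, THEN conjunct1, THEN spec, of j] rate[of n] by linarith
      define \<kappa> where "\<kappa> = K1 * r n"
      have \<kappa>: "0 \<le> \<kappa>" "\<kappa> \<le> K1" using K1r by (simp_all add: \<kappa>_def)
      define B where "B = 2 * t + \<kappa>"
      have B: "0 \<le> B" "B \<le> KA" using t \<kappa> by (simp_all add: B_def KA_def)
      have anB: "\<forall>p\<in>UNIV. \<bar>an p n x\<bar> \<le> B"
      proof
        fix p show "\<bar>an p n x\<bar> \<le> B"
          using an_r[OF xX, of p n] a_le[OF x, of p] unfolding B_def \<kappa>_def[symmetric] by linarith
      qed
      have hG: "\<bar>h j x\<bar> \<le> G" for j
      proof -
        have "\<bar>h j x\<bar> \<le> norm (grad v x $ j)" unfolding h_def grad_def by (simp add: component_le_norm_cart)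
        also have "\<dots> \<le> norm (grad v x)" by (rule Finite_Cartesian_Product.norm_nth_le)
        also have "\<dots> \<le> G" unfolding G_def by (rule norm0_ge[OF T(1) C_class_2D(4)[OF v] x])
        finally show ?thesis .
      qed
      have HG: "\<forall>j. \<bar>H j n x\<bar> \<le> G + \<kappa>"
      proof
        fix j show "\<bar>H j n x\<bar> \<le> G + \<kappa>"
          using H_r[OF xX, of j n] hG[of j] unfolding \<kappa>_def[symmetric] by linarith
      qed
      note PW = Pn[THEN conjunct2, THEN conjunct2, THEN conjunct2, THEN spec, THEN spec, THEN mp, OF conjI[OF anB conjI[OF HG B(1)]]]
      have pf: "\<bar>partial k (f n) x\<bar> \<le> 4 * N * B + K2 * r n" for k
        using PW[THEN conjunct1, THEN spec, of k] rate[of n] by linarith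
      then show "\<bar>partial k (f n) x\<bar> \<le> 8 * N * t + Kg * r n"
        by (simp add: B_def \<kappa>_def Kg_def algebra_simps)
      show pfK: "\<bar>partial k (f n) x\<bar> \<le> Kf" for k
        using pf[of k] mult_left_mono[OF B(2), of "4 * N"] mult_left_mono[OF r(2)[of n] fW(3)] dN(2)
        unfolding Kf_def by simp
      have "\<bar>partial k (W l n) x\<bar> \<le> N * (4 * B * (G + \<kappa> + 4 * N * B) + 4 * B\<^sup>2) + (1 + B) * (K2 * r n)"
        using PW[THEN conjunct2, THEN spec, THEN spec, of k l] mult_left_mono[OF rate[of n], of "1 + B"] B(1) by linarith
      also have "\<dots> \<le> N * (8 * (t * G) + \<kappa> * (8 + 4 * G + 4 * K1) + (16 * N + 4) * (4 * t + \<kappa> * (4 + K1)))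
          + (3 + K1) * (K2 * r n)"
      proof (rule add_mono[OF mult_left_mono[OF _ dN(2)] mult_right_mono])
        \<comment> \<open>Products of small quantities are reduced to linear ones, so that the bound
          splits into \<open>t * (1 + G)\<close> with a coefficient free of the data and a remainder
          proportional to \<kappa>.\<close>
        have \<kappa>2: "\<kappa> * \<kappa> \<le> \<kappa> * K1" "t * \<kappa> \<le> \<kappa>" "t * t \<le> t"
          using \<kappa> t by (simp_all add: mult_left_mono mult_left_le mult_left_le_one_le)
        have 1: "4 * B * (G + \<kappa>) \<le> 8 * (t * G) + \<kappa> * (8 + 4 * G + 4 * K1)"
          using \<kappa>2 by (simp add: B_def algebra_simps)
        have 2: "B\<^sup>2 \<le> 4 * t + \<kappa> * (4 + K1)"
          using \<kappa>2 by (simp add: B_def power2_eq_square algebra_simps)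
        have "(16 * N + 4) * B\<^sup>2 \<le> (16 * N + 4) * (4 * t + \<kappa> * (4 + K1))"
          using 2 dN by (intro mult_left_mono) auto
        moreover have "4 * B * (G + \<kappa> + 4 * N * B) + 4 * B\<^sup>2 = 4 * B * (G + \<kappa>) + (16 * N + 4) * B\<^sup>2"
          by (simp add: power2_eq_square algebra_simps)
        ultimately show "4 * B * (G + \<kappa> + 4 * N * B) + 4 * B\<^sup>2
            \<le> 8 * (t * G) + \<kappa> * (8 + 4 * G + 4 * K1) + (16 * N + 4) * (4 * t + \<kappa> * (4 + K1))"
          using 1 by linarith
        show "1 + B \<le> 3 + K1" "0 \<le> K2 * r n" using B fW(3) r(1)[of n] by (auto simp: KA_def)
      qed
      also have "\<dots> = N * (8 * (t * G) + (16 * N + 4) * (4 * t)) + KW * r n"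
        by (simp add: KW_def \<kappa>_def algebra_simps)
      also have "N * (8 * (t * G) + (16 * N + 4) * (4 * t)) \<le> N * (24 + 64 * N) * (t * (1 + G))"
      proof -
        have "0 \<le> t * G" "0 \<le> N * (t * G)" "0 \<le> t" using t G dN by simp_all
        then have "8 * (t * G) + (16 * N + 4) * (4 * t) \<le> (24 + 64 * N) * (t * (1 + G))"
          by (simp add: algebra_simps)
        then show ?thesis unfolding mult.assoc[of N] using dN(2) by (rule mult_left_mono)
      qed
      finally show "\<bar>partial k (W l n) x\<bar> \<le> N * (24 + 64 * N) * (t * (1 + G)) + KW * r n" by simp
      have S1: "D k l x + Pm k l = (\<Sum>p\<in>UNIV. (a p x)\<^sup>2 * direction p $ k * direction p $ l)"
      proof -
        have "(\<Sum>p\<in>UNIV. (a p x)\<^sup>2 * direction p $ k * direction p $ l) = Pm k l +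
          (\<Sum>p\<in>UNIV. (case p of (i, j, b) \<Rightarrow> (if b then 1 else - 1) * D i j x / 4) * direction p $ k * direction p $ l)"
          unfolding Pm_def a_sq[OF x] \<sigma>_def by (simp add: distrib_right sum.distrib)
        then show ?thesis using direction_decomposition[of "\<lambda>i j. D i j x" k l] Dsym by simp
      qed
      have S2: "\<bar>(\<Sum>p\<in>UNIV. (a p x)\<^sup>2 * direction p $ k * direction p $ l)
          - (\<Sum>p\<in>UNIV. (an p n x)\<^sup>2 * direction p $ k * direction p $ l)\<bar> \<le> N * (\<kappa> * (4 + K1) * 2 * 2)"
      proof -
        have "\<bar>((a p x)\<^sup>2 - (an p n x)\<^sup>2) * direction p $ k * direction p $ l\<bar> \<le> \<kappa> * (4 + K1) * 2 * 2" for p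
        proof (intro abs_mult_le direction_le)
          have "\<bar>an p n x - a p x\<bar> \<le> \<kappa>" using an_r[OF xX] by (simp add: \<kappa>_def)
          then have 1: "\<bar>a p x - an p n x\<bar> \<le> \<kappa>" by simp
          have "\<bar>a p x + an p n x\<bar> \<le> 4 + K1"
            using 1 a_le[OF x, of p] t(4) \<kappa> by linarith
          with 1 have "\<bar>(a p x - an p n x) * (a p x + an p n x)\<bar> \<le> \<kappa> * (4 + K1)" by (rule abs_mult_le)
          then show "\<bar>(a p x)\<^sup>2 - (an p n x)\<^sup>2\<bar> \<le> \<kappa> * (4 + K1)"
            by (simp add: power2_eq_square algebra_simps)
        qed
        then have "(\<Sum>p\<in>UNIV. \<bar>((a p x)\<^sup>2 - (an p n x)\<^sup>2) * direction p $ k * direction p $ l\<bar>)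
            \<le> (\<Sum>p\<in>(UNIV :: ('d \<times> 'd \<times> bool) set). \<kappa> * (4 + K1) * 2 * 2)" by (intro sum_mono)
        then have "\<bar>\<Sum>p\<in>UNIV. ((a p x)\<^sup>2 - (an p n x)\<^sup>2) * direction p $ k * direction p $ l\<bar> \<le> N * (\<kappa> * (4 + K1) * 2 * 2)"
          unfolding N_def by (intro order_trans[OF sum_abs]) simp
        then show ?thesis by (simp add: left_diff_distrib sum_subtractf)
      qed
      have S3: "\<bar>(H k n x - h k x) * partial l (f n) x\<bar> \<le> \<kappa> * Kf" for k l
        by (intro abs_mult_le pfK) (use H_r[OF xX] in \<open>simp add: \<kappa>_def\<close>)
      have "\<bar>defect A (vs n) (ws n) x $ k $ l\<bar> \<le> N * (\<kappa> * (4 + K1) * 2 * 2) + K2 * r n + \<kappa> * Kf"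
      proof -
        have arith: "\<bar>X - Z + (u + u') / 2\<bar> \<le> a + b' + e"
          if "\<bar>X - Y\<bar> \<le> a" "\<bar>Z - Y\<bar> \<le> b" "b \<le> b'" "\<bar>u\<bar> \<le> e" "\<bar>u'\<bar> \<le> e" for X Y Z u u' a b b' e :: real
          using that by (simp add: abs_le_iff field_simps)
        show ?thesis
          unfolding defect_kl S1
          by (rule arith[OF S2 Pn[THEN conjunct2, THEN conjunct2, THEN conjunct1, THEN spec, THEN spec] rate S3 S3])
      qed
      then show "\<bar>defect A (vs n) (ws n) x $ k $ l\<bar> \<le> Ke * r n"
        by (simp add: Ke_def \<kappa>_def algebra_simps)
    qed
    have Kpow: "c * real (n + 1) ^ q \<le> K * real (n + 1) ^ (qv + qw)"
      if "0 \<le> c" "c \<le> K" "q \<le> qv + qw" for c n q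
      using that K_ge(1) by (intro mult_mono power_increasing) auto
    have Kr: "c * r n \<le> K * r n" if "c \<le> K" for c n using that r(1) by (rule mult_right_mono)
    have Ct: "C1 * t \<le> C * t" "c * (t * (1 + G)) \<le> C * t * (1 + G)" if "c \<le> C" for c
    proof -
      show "C1 * t \<le> C * t" using C0 t by (intro mult_right_mono) (auto simp: C_def)
      show "c * (t * (1 + G)) \<le> C * t * (1 + G)"
        unfolding mult.assoc using that t G by (intro mult_right_mono) auto
    qed
    have Nt: "N * \<tau> \<le> N * (t * (1 + G))"
    proof -
      have "t * 1 \<le> t * (1 + G)" using t G by (intro mult_left_mono) auto
      then show ?thesis using t(6) dN by (intro mult_left_mono) auto
    qed
    have fin: "norm (vs n x - v x) \<le> C * t + K * r n" "norm (grad (vs n) x - grad v x) \<le> C * t + K * r n"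
      "norm (ws n x - w x) \<le> C * t * (1 + G) + K * r n" "norm (grad (ws n) x - grad w x) \<le> C * t * (1 + G) + K * r n"
      if x: "x \<in> T" for n x
    proof -
      have "vs n x - v x = axis j0 (f n x)" by (simp add: vs_def gv_def vec_eq_iff axis_def)
      then have "norm (vs n x - v x) \<le> \<bar>f n x\<bar>"
        using norm_vec_le_sum[of "axis j0 (f n x)"] by (simp add: axis_def if_distrib cong: if_cong)
      also have "\<dots> \<le> 0 + K * r n" using main(1)[OF x, of n] Kr[OF K_ge(8), of n] by linarith
      also have "\<dots> \<le> C * t + K * r n" using C0 t by (intro add_mono) (auto simp: C_def)
      finally show "norm (vs n x - v x) \<le> C * t + K * r n" .
      have "norm (grad (vs n) x - grad v x) \<le> real CARD('d) * (8 * N * t + Kg * r n)"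
      proof (rule norm_vec_le_card)
        fix i
        have "(grad (vs n) x - grad v x) $ i = axis j0 (partial i (f n) x)"
          by (simp add: grad_def V(2) vec_eq_iff pgv axis_def)
        then have "norm ((grad (vs n) x - grad v x) $ i) \<le> \<bar>partial i (f n) x\<bar>"
          using norm_vec_le_sum[of "axis j0 (partial i (f n) x)"] by (simp add: axis_def if_distrib cong: if_cong)
        then show "norm ((grad (vs n) x - grad v x) $ i) \<le> 8 * N * t + Kg * r n"
          using main(3)[OF x, of i n] by linarith
      qed
      also have "\<dots> = C1 * t + d * Kg * r n" by (simp add: C1_def d_def algebra_simps)
      also have "\<dots> \<le> C * t + K * r n" using Ct(1)[of 0] Kr[OF K_ge(5), of n] C0 by (auto simp: C_def)
      finally show "norm (grad (vs n) x - grad v x) \<le> C * t + K * r n" .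
      have "norm (ws n x - w x) \<le> real CARD('d) * (K2 * r n + d * (4 * N * \<tau> * R))"
      proof (rule norm_vec_le_card)
        fix j
        have "\<bar>\<Sum>k\<in>UNIV. Pm j k * x $ k\<bar> \<le> (\<Sum>k\<in>(UNIV :: 'd set). 4 * N * \<tau> * R)"
          using TX x by (intro order_trans[OF sum_abs] sum_mono abs_mult_le Pm_le) (auto simp: X_def)
        then have "\<bar>\<Sum>k\<in>UNIV. Pm j k * x $ k\<bar> \<le> d * (4 * N * \<tau> * R)" by (simp add: d_def)
        then show "norm ((ws n x - w x) $ j) \<le> K2 * r n + d * (4 * N * \<tau> * R)"
          using main(2)[OF x, of j n] by (simp add: ws_def gw_def)
      qed
      also have "\<dots> = d * (d * (4 * R)) * (N * \<tau>) + d * K2 * r n" by (simp add: d_def algebra_simps)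
      also have "d * (d * (4 * R)) * (N * \<tau>) \<le> d * (d * (4 * R)) * (N * (t * (1 + G)))"
        by (rule mult_left_mono[OF Nt]) (use dN R in simp)
      also have "d * (d * (4 * R)) * (N * (t * (1 + G))) = C2 * (t * (1 + G))" by (simp add: C2_def)
      also have "C2 * (t * (1 + G)) + d * K2 * r n \<le> C * t * (1 + G) + K * r n"
        using Ct(2)[of C2] Kr[OF K_ge(7), of n] C0 by (auto simp: C_def)
      finally show "norm (ws n x - w x) \<le> C * t * (1 + G) + K * r n" by simp
      have "norm (grad (ws n) x - grad w x)
          \<le> real CARD('d) * (real CARD('d) * ((N * (24 + 64 * N) * (t * (1 + G)) + KW * r n) + 4 * N * \<tau>))"
      proof (rule norm_matrix_le)
        fix i j
        have "(grad (ws n) x - grad w x) $ i $ j = partial i (W j n) x - Pm j i"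
          by (simp add: grad_def Wp(2) pgw)
        then show "\<bar>(grad (ws n) x - grad w x) $ i $ j\<bar> \<le> (N * (24 + 64 * N) * (t * (1 + G)) + KW * r n) + 4 * N * \<tau>"
          using main(5)[OF x, of i j n] Pm_le[of j i] by linarith
      qed
      also have "\<dots> = d * (d * (N * (24 + 64 * N))) * (t * (1 + G)) + d * (d * 4) * (N * \<tau>) + d * (d * KW) * r n"
        by (simp add: d_def algebra_simps)
      also have "d * (d * 4) * (N * \<tau>) \<le> d * (d * 4) * (N * (t * (1 + G)))"
        by (rule mult_left_mono[OF Nt]) (use dN in simp)
      also have "d * (d * (N * (24 + 64 * N))) * (t * (1 + G)) + d * (d * 4) * (N * (t * (1 + G))) = C3 * (t * (1 + G))"
        by (simp add: C3_def algebra_simps)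
      also have "C3 * (t * (1 + G)) + d * (d * KW) * r n \<le> C * t * (1 + G) + K * r n"
        using Ct(2)[of C3] Kr[OF K_ge(6), of n] C0 by (auto simp: C_def)
      finally show "norm (grad (ws n) x - grad w x) \<le> C * t * (1 + G) + K * r n" by simp
    qed
    have fin2: "norm0 T (defect A (vs n) (ws n)) \<le> K * r n" for n
    proof (rule norm0_le[OF T(2)])
      fix x assume x: "x \<in> T"
      have "norm (defect A (vs n) (ws n) x) \<le> d * (d * (Ke * r n))"
        unfolding d_def by (rule norm_matrix_le) (rule main(6)[OF x])
      then show "norm (defect A (vs n) (ws n) x) \<le> K * r n" using Kr[OF K_ge(4), of n] by (simp add: mult.assoc)
    qed
    have fin3: "norm2 T (vs n) \<le> K * real (n + 1) ^ (qv + qw)" "norm2 T (ws n) \<le> K * real (n + 1) ^ (qv + qw)" for n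
      using Kv(2)[of n] Kpow[OF Kv(1) K_ge(2), of qv n] Kw(2)[of n] Kpow[OF Kw(1) K_ge(3), of qw n] by linarith+
    have s2: "0 < s / 2" using s by simp
    have rs: "real (n + 1) powr (- (s / 2)) = r n" for n by (simp add: r_def)
    show "\<exists>s K q vs ws. approximating_family T A v w C s K q vs ws"
      unfolding approximating_family_def
      unfolding \<tau>_def[symmetric] t_def[symmetric] G_def[symmetric]
      by (rule exI[of _ "s / 2"], rule exI[of _ K], rule exI[of _ "qv + qw"], rule exI[of _ vs], rule exI[of _ ws],
          intro conjI allI ballI, unfold rs)
        (rule s2 K_ge(1) V(1) Wp(1) fin3 fin2 | rule fin, assumption)+
  qed
qed

section \<open>Iterating the stage\<close>

lemma holder_seminorm_le:
  assumes "\<And>x y. norm (f x - f y) \<le> L * dist x y powr \<alpha>" "T \<noteq> {}"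
  shows "holder_seminorm \<alpha> T f \<le> \<bar>L\<bar>"
  unfolding holder_seminorm_def
proof (rule cSUP_least)
  fix z assume "z \<in> T \<times> T"
  obtain x y where z: "z = (x, y)" by (cases z)
  have "norm (f x - f y) \<le> \<bar>L\<bar> * dist x y powr \<alpha>"
    by (rule order_trans[OF assms(1)]) (intro mult_right_mono, auto)
  then have "norm (f x - f y) / dist x y powr \<alpha> \<le> \<bar>L\<bar>"
    by (cases "x = y") (simp_all add: divide_le_eq)
  then show "(case z of (x, y) \<Rightarrow> norm (f x - f y) / dist x y powr \<alpha>) \<le> \<bar>L\<bar>" by (simp add: z)
qed (use assms(2) in auto)

text \<open>One bound for all scales, so that the norm of \<open>A\<close> in (Stage) can be
  absorbed by a single choice of \<open>M\<close>.\<close>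

lemma norm0_holder_bounded:
  fixes A :: "real^'d \<Rightarrow> 'b::real_normed_vector"
  assumes "bounded \<omega>" "\<omega> \<noteq> {}" "C0_holder \<beta> A" "0 < \<beta>"
  obtains B where "0 \<le> B" "\<And>l. 0 \<le> l \<Longrightarrow> l \<le> l0 \<Longrightarrow> norm0_holder \<beta> (nbhd \<omega> (2 * l)) A \<le> B"
proof -
  let ?T0 = "nbhd \<omega> (2 * l0)"
  have ne: "nbhd \<omega> (2 * l) \<noteq> {}" if "0 \<le> l" for l
    using closure_subset_nbhd[of "2 * l" \<omega>] that assms(2) by auto
  have n0: "norm0 (nbhd \<omega> (2 * l)) f \<le> \<bar>norm0 ?T0 f\<bar>"
    if "0 \<le> l" "l \<le> l0" "continuous_on UNIV f" for l and f :: "real^'d \<Rightarrow> 'c::real_normed_vector"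
  proof (rule norm0_le[OF ne[OF that(1)]])
    fix x assume "x \<in> nbhd \<omega> (2 * l)"
    then have "x \<in> ?T0" using nbhd_mono[of "2 * l" "2 * l0" \<omega>] that(2) by auto
    then have "norm (f x) \<le> norm0 ?T0 f"
      using norm0_ge[OF compact_nbhd[OF assms(1)]] that(3) continuous_on_subset by blast
    then show "norm (f x) \<le> \<bar>norm0 ?T0 f\<bar>" by simp
  qed
  note contA = C0_holder_continuous[OF assms(3,4)]
  show thesis
  proof (cases "\<beta> \<le> 1")
    case True
    then obtain L where L: "\<And>x y. norm (A x - A y) \<le> L * dist x y powr \<beta>"
      using assms(3) unfolding C0_holder_def holder_def by auto
    show thesis
    proof (rule that)
      show "norm0_holder \<beta> (nbhd \<omega> (2 * l)) A \<le> \<bar>norm0 ?T0 A\<bar> + \<bar>L\<bar>" if "0 \<le> l" "l \<le> l0" for l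
        using n0[OF that contA] holder_seminorm_le[OF L ne[OF that(1)]] True by (simp add: norm0_holder_def)
    qed simp
  next
    case False
    then have C1: "C1_holder (\<beta> - 1) A" using assms(3) by (simp add: C0_holder_def)
    then have "C_class (Suc 0) A" by (simp add: C1_holder_def)
    then have contG: "continuous_on UNIV (grad A)" using C_class_continuous C_class_grad by blast
    obtain L where L: "\<And>x y. norm (grad A x - grad A y) \<le> L * dist x y powr (\<beta> - 1)"
      using C1 unfolding C1_holder_def holder_def by auto
    show thesis
    proof (rule that)
      show "norm0_holder \<beta> (nbhd \<omega> (2 * l)) A \<le> \<bar>norm0 ?T0 A\<bar> + \<bar>norm0 ?T0 (grad A)\<bar> + \<bar>L\<bar>" if "0 \<le> l" "l \<le> l0" for l
        using n0[OF that contA] n0[OF that contG] holder_seminorm_le[OF L ne[OF that(1)]] False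
        by (simp add: norm0_holder_def norm1_def)
    qed simp
  qed
qed

text \<open>
  The limiting ratio \<open>r\<close> between the decay of the defect and the growth of the second derivatives is
  chosen with \<open>\<alpha> < r / (1 + r) < min (\<beta> / 2) (S / (S + 2 J))\<close>.
\<close>

lemma iteration_parameters:
  fixes \<alpha> \<beta> S J \<rho>0' :: real
  assumes "0 < \<alpha>" "\<alpha> < \<beta> / 2" "\<alpha> < S / (S + 2 * J)" "0 < S" "0 < J" "\<beta> < 2" "0 < \<rho>0'"
  obtains r \<rho>0 p b \<theta> \<kappa> where "0 < \<rho>0" "\<rho>0 \<le> \<rho>0'" "\<rho>0 \<le> r" "0 < p" "1 < b" "0 < \<theta>" "0 < \<kappa>"
    "1 + p * J + 2 * \<theta> \<le> b"
    "\<And>\<rho>. 0 \<le> \<rho> \<Longrightarrow> \<rho> \<le> r \<Longrightarrow> 2 * min r (\<rho> + \<kappa>) * b \<le> 2 * \<rho> + p * S - 2 * \<theta>"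
    "\<And>\<rho>. 0 \<le> \<rho> \<Longrightarrow> \<rho> \<le> r \<Longrightarrow> 2 * min r (\<rho> + \<kappa>) * b \<le> \<beta> * (1 + \<rho>) - \<theta>"
    "\<alpha> * b + 2 * \<theta> < r * (1 - \<alpha>)" "4 * \<theta> \<le> \<rho>0"
proof -
  obtain x where x: "\<alpha> < x" "x < \<beta> / 2" "x < S / (S + 2 * J)"
    using dense[of \<alpha> "min (\<beta> / 2) (S / (S + 2 * J))"] assms by auto
  have x1: "0 < x" "x < 1" using x assms by auto
  \<comment> \<open>Chosen so that \<open>r / (1 + r) = x\<close>.\<close>
  define r where "r = x / (1 - x)"
  have r: "0 < r" using x1 by (simp add: r_def)
  have rx: "r * (1 - x) = x" using x1 by (simp add: r_def)
  \<comment> \<open>The three gaps are positive exactly by the three inequalities on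
    \<open>x\<close>: \<open>m1\<close> by the bound with \<open>S\<close> and \<open>J\<close>,
    \<open>m2\<close> by the one with \<beta>, and \<open>m3\<close> by
    \<open>\<alpha> < x\<close>.\<close>
  define m1 where "m1 = S - 2 * r * J"
  define m2 where "m2 = \<beta> - r * (2 - \<beta>)"
  define m3 where "m3 = r * (1 - \<alpha>) - \<alpha>"
  have "x * (S + 2 * J) < S" using x(3) assms by (simp add: field_simps)
  then have "0 < S * (1 - x) - 2 * (r * (1 - x)) * J" unfolding rx by (simp add: algebra_simps)
  then have "0 < m1 * (1 - x)" by (simp add: m1_def algebra_simps)
  then have m1: "0 < m1" using x1 by (simp add: zero_less_mult_iff)
  have "0 < \<beta> * (1 - x) - (r * (1 - x)) * (2 - \<beta>)" unfolding rx using x(2) by (simp add: algebra_simps)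
  then have "0 < m2 * (1 - x)" by (simp add: m2_def algebra_simps)
  then have m2: "0 < m2" using x1 by (simp add: zero_less_mult_iff)
  have "0 < (r * (1 - x)) * (1 - \<alpha>) - \<alpha> * (1 - x)" unfolding rx using x(1) by (simp add: algebra_simps)
  then have "0 < m3 * (1 - x)" by (simp add: m3_def algebra_simps)
  then have m3: "0 < m3" using x1 by (simp add: zero_less_mult_iff)
  \<comment> \<open>With \<open>b = 1 + p * (J + e)\<close> the growth of second derivatives has a
    margin \<open>p * e\<close>, which will pay for \<theta>. Its cost for the defect at the ratio
    \<open>r\<close> is \<open>2 * r * p * e\<close>, half of \<open>p * m1\<close>.\<close>
  define e where "e = m1 / (4 * r)"
  have e: "0 < e" using m1 r by (simp add: e_def)
  define bb where "bb = 1 + (J + e)"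
  have Je: "0 < J + e" using assms e by simp
  \<comment> \<open>The conditions involving \<open>m2\<close> and \<open>m3\<close> only see
    \<open>b - 1\<close>, which is made a quarter of the gap by a small \<open>p\<close>.\<close>
  define p where "p = min 1 (min (m2 / (8 * r * (J + e))) (m3 / (4 * \<alpha> * (J + e))))"
  have p: "0 < p" "p \<le> 1" "p * (8 * r * (J + e)) \<le> m2" "p * (4 * \<alpha> * (J + e)) \<le> m3"
  proof -
    show "0 < p" "p \<le> 1" using m2 m3 r Je assms by (auto simp: p_def)
    have "p \<le> m2 / (8 * r * (J + e))" "p \<le> m3 / (4 * \<alpha> * (J + e))" by (auto simp: p_def)
    then show "p * (8 * r * (J + e)) \<le> m2" "p * (4 * \<alpha> * (J + e)) \<le> m3"
      using r Je assms by (simp_all add: pos_le_divide_eq)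
  qed
  define b where "b = 1 + p * (J + e)"
  have b: "1 < b" "b \<le> bb" using p Je by (auto simp: b_def bb_def mult_le_cancel_right1)
  define \<rho>0 where "\<rho>0 = min \<rho>0' r"
  \<comment> \<open>The increase of the ratio in one step; its cost \<open>2 * \<kappa> * b\<close>
    is at most a quarter of \<open>p * m1\<close> and of \<open>m2\<close>.\<close>
  define \<kappa> where "\<kappa> = min (p * m1 / (8 * bb)) (m2 / (8 * bb))"
  have bb: "0 < bb" using Je by (simp add: bb_def)
  have \<kappa>: "0 < \<kappa>" "2 * \<kappa> * b \<le> p * m1 / 4" "2 * \<kappa> * b \<le> m2 / 4"
  proof -
    show "0 < \<kappa>" using p m1 m2 bb by (simp add: \<kappa>_def)
    then have 1: "\<kappa> * b \<le> \<kappa> * bb" using b by simp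
    have "\<kappa> \<le> p * m1 / (8 * bb)" "\<kappa> \<le> m2 / (8 * bb)" by (auto simp: \<kappa>_def)
    then have "\<kappa> * (8 * bb) \<le> p * m1" "\<kappa> * (8 * bb) \<le> m2" using bb by (simp_all add: pos_le_divide_eq)
    with 1 show "2 * \<kappa> * b \<le> p * m1 / 4" "2 * \<kappa> * b \<le> m2 / 4" by linarith+
  qed
  define \<theta> where "\<theta> = min (min (p * m1 / 8) (m2 / 4)) (min (p * e / 2) (min (m3 / 8) (\<rho>0 / 4)))"
  have \<theta>: "0 < \<theta>" "\<theta> \<le> p * m1 / 8" "\<theta> \<le> m2 / 4" "\<theta> \<le> p * e / 2" "\<theta> \<le> m3 / 8" "\<theta> \<le> \<rho>0 / 4"
    using p m1 m2 m3 e r assms by (auto simp: \<theta>_def \<rho>0_def)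
  \<comment> \<open>Raising \<rho> to \<open>\<rho> + \<kappa>\<close> and \<open>M\<close> to
    \<open>M powr b\<close> costs \<open>\<rho> * (b - 1)\<close>, which is largest at
    \<open>\<rho> = r\<close>; one estimate at \<open>r\<close> thus covers all intermediate
    ratios.\<close>
  have main: "2 * min r (\<rho> + \<kappa>) * b \<le> 2 * \<rho> + 2 * r * (b - 1) + 2 * \<kappa> * b" if "0 \<le> \<rho>" "\<rho> \<le> r" for \<rho>
  proof -
    have "2 * min r (\<rho> + \<kappa>) \<le> 2 * (\<rho> + \<kappa>)" by (rule mult_left_mono[OF min.cobounded2]) simp
    then have "2 * min r (\<rho> + \<kappa>) * b \<le> 2 * (\<rho> + \<kappa>) * b" using b by (intro mult_right_mono) auto
    also have "\<dots> = 2 * \<rho> + 2 * (\<rho> * (b - 1)) + 2 * \<kappa> * b" by (simp add: algebra_simps)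
    also have "\<rho> * (b - 1) \<le> r * (b - 1)" using that b by (intro mult_right_mono) auto
    finally show ?thesis by simp
  qed
  have rb: "2 * r * (b - 1) = p * (S - m1 / 2)"
  proof -
    have "2 * r * e = m1 / 2" using r by (simp add: e_def)
    then have "2 * r * J + 2 * r * e = S - m1 / 2" by (simp add: m1_def field_simps)
    moreover have "2 * r * (b - 1) = p * (2 * r * J + 2 * r * e)" by (simp add: b_def algebra_simps)
    ultimately show ?thesis by simp
  qed
  have rb2: "2 * r * (b - 1) \<le> m2 / 4" using p(3) by (simp add: b_def algebra_simps)
  have ab: "\<alpha> * (b - 1) \<le> m3 / 4" using p(4) by (simp add: b_def algebra_simps)
  show thesis
  proof (rule that[of \<rho>0 r p b \<theta> \<kappa>])
    show "0 < \<rho>0" "\<rho>0 \<le> \<rho>0'" "\<rho>0 \<le> r" using r assms by (auto simp: \<rho>0_def)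
    show "0 < p" "1 < b" "0 < \<theta>" "0 < \<kappa>" by fact+
    show "1 + p * J + 2 * \<theta> \<le> b" using \<theta>(4) by (simp add: b_def algebra_simps)
    show "2 * min r (\<rho> + \<kappa>) * b \<le> 2 * \<rho> + p * S - 2 * \<theta>" if "0 \<le> \<rho>" "\<rho> \<le> r" for \<rho>
    proof -
      have "p * (S - m1 / 2) = p * S - p * m1 / 2" by (simp add: algebra_simps)
      then show ?thesis using main[OF that] \<theta>(2) \<kappa>(2) unfolding rb by linarith
    qed
    show "2 * min r (\<rho> + \<kappa>) * b \<le> \<beta> * (1 + \<rho>) - \<theta>" if "0 \<le> \<rho>" "\<rho> \<le> r" for \<rho>
    proof -
      have "\<rho> * (2 - \<beta>) \<le> r * (2 - \<beta>)" using that assms by (intro mult_right_mono) auto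
      then have "2 * \<rho> - \<beta> * \<rho> \<le> \<beta> - m2" by (simp add: m2_def algebra_simps)
      then show ?thesis using main[OF that] rb2 \<kappa>(3) \<theta>(3) m2 unfolding distrib_left by linarith
    qed
    show "\<alpha> * b + 2 * \<theta> < r * (1 - \<alpha>)"
    proof -
      have "\<alpha> * b = \<alpha> + \<alpha> * (b - 1)" by (simp add: algebra_simps)
      moreover have "r * (1 - \<alpha>) = \<alpha> + m3" by (simp add: m3_def)
      ultimately show ?thesis using ab \<theta>(5) m3 by simp
    qed
    show "4 * \<theta> \<le> \<rho>0" using \<theta>(6) by simp
  qed
qed

text \<open>The body of \<open>stage\<close> for one \<gamma> with its constant made explicit,
  because the size of \<open>M\<close> is chosen depending on that constant.\<close>

definition stage_with ::
  "'k::finite itself \<Rightarrow> (real^'d) set \<Rightarrow> real \<Rightarrow> real \<Rightarrow> real \<Rightarrow> real \<Rightarrow> real \<Rightarrow> bool" where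
  "stage_with K \<omega> l0 S J \<gamma> C0 \<longleftrightarrow> (\<forall>l \<beta> (v :: real^'d \<Rightarrow> real^'k) w A lam M.
        0 < l \<and> l < l0 \<and> 0 < \<beta> \<and> \<beta> < 2 \<and>
        C_class 2 v \<and> C_class 2 w \<and> C0_holder_sym \<beta> A \<and> 1 / l < lam \<and>
        norm2 (nbhd \<omega> (2*l)) v \<le> M \<and> norm2 (nbhd \<omega> (2*l)) w \<le> M \<and> 1 \<le> M \<longrightarrow>
        (\<exists>(v' :: real^'d \<Rightarrow> real^'k) w'. C_class 2 v' \<and> C_class 2 w' \<and>
          (let T = nbhd \<omega> l; D = norm0 (nbhd \<omega> (2*l)) (defect A v w);
               dv = norm0 (nbhd \<omega> (2*l)) (grad v)
           in norm1 T (\<lambda>x. v' x - v x) \<le> C0 * lam powr (\<gamma>/2) * (sqrt D + l*M) \<and>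
              norm1 T (\<lambda>x. w' x - w x) \<le>
                C0 * lam powr \<gamma> * (sqrt D + l*M) * (1 + sqrt D + l*M + dv) \<and>
              norm0 T (grad (grad v')) \<le>
                C0 * ((lam*l) powr J / l) * lam powr (\<gamma>/2) * (sqrt D + l*M) \<and>
              norm0 T (grad (grad w')) \<le>
                C0 * ((lam*l) powr J / l) * lam powr \<gamma> * (sqrt D + l*M) * (1 + sqrt D + l*M + dv) \<and>
              norm0 T (defect A v' w') \<le>
                C0 * (l powr \<beta> * norm0_holder \<beta> (nbhd \<omega> (2*l)) A
                     + 1 / (lam*l) powr S * lam powr \<gamma> * (D + (l*M)\<^sup>2)))))"

text \<open>With \<open>l = M powr (- 1 - \<rho>)\<close> and
  \<open>lam = M powr (1 + \<rho> + p)\<close>, both \<open>sqrt D\<close> and \<open>l * M\<close>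
  are at most \<open>M powr (- \<rho>)\<close>, and \<open>lam * l = M powr p\<close>. Constants and
  the loss are swallowed by factors \<open>M powr \<theta>\<close>, so \<open>par\<close> consists
  of inequalities between exponents. The first conclusion places twice the next scale within the
  present one, so that bounds on the \<open>l\<close>-neighbourhood become the hypotheses of the
  next step.\<close>

lemma stage_step:
  fixes \<omega> :: "(real^'d) set" and v :: "real^'d \<Rightarrow> real^'k" and w :: "real^'d \<Rightarrow> real^'d"
  assumes \<omega>: "bounded \<omega>" "\<omega> \<noteq> {}" and C0: "0 < C0"
    and stage: "stage_with TYPE('k) \<omega> l0 S J \<gamma> C0"
    and A: "C0_holder_sym \<beta> A" "0 < \<beta>" "\<beta> < 2"
    and B: "0 \<le> B" "\<forall>l. 0 \<le> l \<and> l \<le> l0 \<longrightarrow> norm0_holder \<beta> (nbhd \<omega> (2 * l)) A \<le> B"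
    and par: "0 < p" "0 \<le> \<rho>" "\<rho> \<le> \<rho>'" "1 < b" "0 < \<gamma>" "\<gamma> * (1 + \<rho> + p) \<le> \<theta>" "2 * \<theta> \<le> \<rho>"
      "1 + p * J + 2 * \<theta> \<le> b" "2 * \<rho>' * b \<le> 2 * \<rho> + p * S - 2 * \<theta>" "2 * \<rho>' * b \<le> \<beta> * (1 + \<rho>) - \<theta>" "0 < J"
    and M: "1 < M" "1 / l0 < M" "0 < l0" "2 \<le> M powr (b - 1)" "4 * (1 + C0) * (3 + G) * (1 + B) \<le> M powr \<theta>"
    and v: "C_class 2 v" "norm2 (nbhd \<omega> (2 * M powr (- 1 - \<rho>))) v \<le> M"
      "norm0 (nbhd \<omega> (2 * M powr (- 1 - \<rho>))) (grad v) \<le> G"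
    and w: "C_class 2 w" "norm2 (nbhd \<omega> (2 * M powr (- 1 - \<rho>))) w \<le> M"
    and D: "norm0 (nbhd \<omega> (2 * M powr (- 1 - \<rho>))) (defect A v w) \<le> M powr (- 2 * \<rho>)"
  shows "2 * (M powr b) powr (- 1 - \<rho>') \<le> M powr (- 1 - \<rho>)"
    and "\<exists>(v' :: real^'d \<Rightarrow> real^'k) w'. C_class 2 v' \<and> C_class 2 w' \<and>
      (\<forall>x\<in>nbhd \<omega> (M powr (- 1 - \<rho>)).
        norm (v' x - v x) \<le> M powr (2 * \<theta> - \<rho>) \<and> norm (grad v' x - grad v x) \<le> M powr (2 * \<theta> - \<rho>) \<and>
        norm (w' x - w x) \<le> M powr (2 * \<theta> - \<rho>) \<and> norm (grad w' x - grad w x) \<le> M powr (2 * \<theta> - \<rho>) \<and>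
        norm (grad (grad v') x) \<le> M powr b \<and> norm (grad (grad w') x) \<le> M powr b) \<and>
      norm2 (nbhd \<omega> (2 * (M powr b) powr (- 1 - \<rho>'))) v' \<le> M powr b \<and>
      norm2 (nbhd \<omega> (2 * (M powr b) powr (- 1 - \<rho>'))) w' \<le> M powr b \<and>
      norm0 (nbhd \<omega> (2 * (M powr b) powr (- 1 - \<rho>'))) (defect A v' w') \<le> (M powr b) powr (- 2 * \<rho>')"
    (is "\<exists>v' w'. ?P v' w'")
proof -
  define l where "l = M powr (- 1 - \<rho>)"
  define lam where "lam = M powr (1 + \<rho> + p)"
  define l' where "l' = (M powr b) powr (- 1 - \<rho>')"
  have M0: "0 < M" "1 \<le> M" using M by auto
  have mono: "M powr a \<le> M powr c" if "a \<le> c" for a c using that M0 by (intro powr_mono) auto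
  have l'eq: "l' = M powr (- b * (1 + \<rho>'))" by (simp add: l'_def powr_powr algebra_simps)
  show ll: "2 * (M powr b) powr (- 1 - \<rho>') \<le> M powr (- 1 - \<rho>)"
  proof -
    have "b * (1 + \<rho>') \<ge> b * (1 + \<rho>)" using par by (intro mult_left_mono) auto
    moreover have "b * (1 + \<rho>) = (1 + \<rho>) + (b - 1) * (1 + \<rho>)" by (simp add: algebra_simps)
    moreover have "(b - 1) * 1 \<le> (b - 1) * (1 + \<rho>)" using par by (intro mult_left_mono) auto
    ultimately have "- b * (1 + \<rho>') + (b - 1) \<le> - 1 - \<rho>" by simp
    then have "l' * M powr (b - 1) \<le> M powr (- 1 - \<rho>)"
      unfolding l'eq powr_add[symmetric] by (rule mono)
    moreover have "l' * 2 \<le> l' * M powr (b - 1)" using M(4) by (intro mult_left_mono) (auto simp: l'_def)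
    ultimately show ?thesis by (simp add: l'_def)
  qed
  have l: "0 < l" "l < l0" "l \<le> 1" "1 / l = M powr (1 + \<rho>)" "1 / l < lam" "l * M = M powr (- \<rho>)" "lam * l = M powr p"
  proof -
    show l0: "0 < l" using M0 by (simp add: l_def)
    have "l \<le> M powr (- 1)" unfolding l_def using par by (intro mono) simp
    also have "M powr (- 1) = 1 / M" using M0 powr_minus_divide[of M 1] by simp
    also have "1 / M < l0" using M M0 by (simp add: field_simps)
    finally show "l < l0" .
    have "l \<le> M powr 0" unfolding l_def using par by (intro mono) simp
    then show "l \<le> 1" using M0 by simp
    show eq: "1 / l = M powr (1 + \<rho>)"
      using powr_minus_divide[of M "- 1 - \<rho>"] by (simp add: l_def add.commute)
    show "1 / l < lam" unfolding eq lam_def using par M by (intro powr_less_mono) auto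
    show "l * M = M powr (- \<rho>)" unfolding l_def using M0 powr_add[of M "- 1 - \<rho>" 1] by simp
    show "lam * l = M powr p" unfolding l_def lam_def using powr_add[of M "1 + \<rho> + p" "- 1 - \<rho>"] by simp
  qed
  let ?T = "nbhd \<omega> l" and ?T2 = "nbhd \<omega> (2 * l)"
  have cT: "compact ?T" "compact ?T2" using compact_nbhd \<omega>(1) by auto
  have neT: "nbhd \<omega> a \<noteq> {}" if "0 \<le> a" for a using closure_subset_nbhd[OF that, of \<omega>] \<omega>(2) by auto
  have contA: "continuous_on Y A" for Y
    using A C0_holder_continuous continuous_on_subset unfolding C0_holder_sym_def by blast
  obtain v' w' where v'w': "C_class 2 v'" "C_class 2 w'" and
    est: "let T = ?T; D = norm0 ?T2 (defect A v w); dv = norm0 ?T2 (grad v)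
       in norm1 T (\<lambda>x. v' x - v x) \<le> C0 * lam powr (\<gamma>/2) * (sqrt D + l*M) \<and>
              norm1 T (\<lambda>x. w' x - w x) \<le>
                C0 * lam powr \<gamma> * (sqrt D + l*M) * (1 + sqrt D + l*M + dv) \<and>
              norm0 T (grad (grad v')) \<le>
                C0 * ((lam*l) powr J / l) * lam powr (\<gamma>/2) * (sqrt D + l*M) \<and>
              norm0 T (grad (grad w')) \<le>
                C0 * ((lam*l) powr J / l) * lam powr \<gamma> * (sqrt D + l*M) * (1 + sqrt D + l*M + dv) \<and>
              norm0 T (defect A v' w') \<le>
                C0 * (l powr \<beta> * norm0_holder \<beta> ?T2 A
                     + 1 / (lam*l) powr S * lam powr \<gamma> * (D + (l*M)\<^sup>2))"
    using stage[unfolded stage_with_def, rule_format, of l \<beta> v w A lam M] l A v w M0 unfolding l_def[symmetric] by blast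
  define DD where "DD = norm0 ?T2 (defect A v w)"
  define dv where "dv = norm0 ?T2 (grad v)"
  have DD: "0 \<le> DD" "DD \<le> M powr (- 2 * \<rho>)" "sqrt DD \<le> M powr (- \<rho>)" "0 \<le> sqrt DD"
  proof -
    show "0 \<le> DD" unfolding DD_def
      by (intro norm0_nonneg cT neT continuous_on_defect contA v(1) w(1)) (use l in simp)
    show le: "DD \<le> M powr (- 2 * \<rho>)" using D by (simp add: DD_def l_def)
    have "sqrt DD \<le> sqrt (M powr (- 2 * \<rho>))" using le by (rule real_sqrt_le_mono)
    also have "M powr (- 2 * \<rho>) = (M powr (- \<rho>))\<^sup>2"
      by (simp add: power2_eq_square flip: powr_add)
    finally show "sqrt DD \<le> M powr (- \<rho>)" by simp
    show "0 \<le> sqrt DD" using \<open>0 \<le> DD\<close> by simp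
  qed
  have dv: "0 \<le> dv" "dv \<le> G"
    using v(3) norm0_nonneg[OF cT(2) neT C_class_2D(4)[OF v(1)]] l by (simp_all add: dv_def l_def)
  have G0: "0 \<le> G" using dv by simp
  define m where "m = M powr (- \<rho>)"
  have m: "0 < m" "m \<le> 1"
    using M0 par mono[of "- \<rho>" 0] by (auto simp: m_def)
  define X where "X = sqrt DD + l * M"
  have X: "0 \<le> X" "X \<le> 2 * m" using DD l(6) m by (auto simp: X_def m_def)
  define Y where "Y = 1 + sqrt DD + l * M + dv"
  have Y: "1 \<le> Y" "Y \<le> 3 + G" using DD l(6) m dv by (auto simp: Y_def m_def)
  \<comment> \<open>Here the loss becomes harmless: \<gamma> is so small that
    \<open>lam powr \<gamma>\<close> is at most \<open>M powr \<theta>\<close>.\<close>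
  have lamg: "lam powr \<gamma> \<le> M powr \<theta>" "lam powr (\<gamma>/2) \<le> M powr \<theta>"
  proof -
    have 1: "lam powr \<gamma> = M powr ((1 + \<rho> + p) * \<gamma>)" by (simp add: lam_def powr_powr)
    then show 2: "lam powr \<gamma> \<le> M powr \<theta>" using par by (auto intro: mono simp: mult.commute)
    have "lam powr (\<gamma>/2) \<le> lam powr \<gamma>"
      using par M0 ge_one_powr_ge_zero[of M "1 + \<rho> + p"] by (intro powr_mono) (auto simp: lam_def)
    with 2 show "lam powr (\<gamma>/2) \<le> M powr \<theta>" by simp
  qed
  \<comment> \<open>A common majorant of all constants that occur, itself at most
    \<open>M powr \<theta>\<close>.\<close>
  define Q where "Q = 4 * (1 + C0) * (3 + G) * (1 + B)"
  have Q: "12 \<le> Q" "4 * C0 * (3 + G) \<le> Q" "4 * C0 \<le> Q" "C0 * (B + 2) \<le> Q" "Q \<le> M powr \<theta>"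
  proof -
    have 1: "4 * (1 + C0) * (3 + G) * 1 \<le> Q" unfolding Q_def using C0 G0 B by (intro mult_left_mono) auto
    have "4 * C0 * (3 + G) \<le> 4 * (1 + C0) * (3 + G)" using G0 by (intro mult_right_mono) auto
    with 1 show 2: "4 * C0 * (3 + G) \<le> Q" by simp
    have "4 * C0 * 1 \<le> 4 * C0 * (3 + G)" using G0 C0 by (intro mult_left_mono) auto
    with 2 show "4 * C0 \<le> Q" by simp
    have "4 * 1 * 3 \<le> 4 * (1 + C0) * (3 + G)" using G0 C0 by (intro mult_mono) auto
    with 1 show "12 \<le> Q" by simp
    have "C0 * (B + 2) \<le> (4 * (1 + C0)) * (3 + G) * (1 + B)"
    proof -
      have "C0 * (B + 2) \<le> (1 + C0) * (2 * (1 + B))" using C0 B by (intro mult_mono) auto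
      also have "\<dots> \<le> (4 * (1 + C0)) * (3 + G) * (1 + B)"
      proof -
        have "(1 + C0) * (1 + B) * 2 \<le> (1 + C0) * (1 + B) * (4 * (3 + G))"
          using C0 B G0 by (intro mult_left_mono) auto
        then show ?thesis by (simp add: algebra_simps)
      qed
      finally show ?thesis .
    qed
    then show "C0 * (B + 2) \<le> Q" by (simp add: Q_def)
    show "Q \<le> M powr \<theta>" using M(5) by (simp add: Q_def)
  qed
  \<comment> \<open>One factor \<open>M powr \<theta>\<close> pays for the loss and another for the
    constants.\<close>
  define \<eta> where "\<eta> = M powr (2 * \<theta> - \<rho>)"
  have \<eta>eq: "\<eta> = M powr \<theta> * M powr \<theta> * m" by (simp add: \<eta>_def m_def flip: powr_add)
  have \<eta>: "0 < \<eta>" "\<eta> \<le> 1" using mono[of "2 * \<theta> - \<rho>" 0] par M0 by (auto simp: \<eta>_def)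
  have est': "norm1 ?T (\<lambda>x. v' x - v x) \<le> C0 * lam powr (\<gamma>/2) * X"
    "norm1 ?T (\<lambda>x. w' x - w x) \<le> C0 * lam powr \<gamma> * X * Y"
    "norm0 ?T (grad (grad v')) \<le> C0 * ((lam*l) powr J / l) * lam powr (\<gamma>/2) * X"
    "norm0 ?T (grad (grad w')) \<le> C0 * ((lam*l) powr J / l) * lam powr \<gamma> * X * Y"
    "norm0 ?T (defect A v' w') \<le> C0 * (l powr \<beta> * norm0_holder \<beta> ?T2 A
                     + 1 / (lam*l) powr S * lam powr \<gamma> * (DD + (l*M)\<^sup>2))"
    using est unfolding Let_def DD_def[symmetric] dv_def[symmetric] X_def[symmetric] Y_def[symmetric] by blast+
  have e1: "C0 * lam powr (\<gamma>/2) * X \<le> \<eta>"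
  proof -
    have "C0 * lam powr (\<gamma>/2) * X \<le> C0 * M powr \<theta> * (2 * m)" using lamg X C0 by (intro mult_mono) auto
    also have "\<dots> = (2 * C0) * (M powr \<theta> * m)" by simp
    also have "\<dots> \<le> M powr \<theta> * (M powr \<theta> * m)" using Q(3,5) C0 m by (intro mult_right_mono) auto
    finally show ?thesis by (simp add: \<eta>eq mult_ac)
  qed
  have e2: "C0 * lam powr \<gamma> * X * Y \<le> \<eta>"
  proof -
    have "C0 * lam powr \<gamma> * X * Y \<le> C0 * M powr \<theta> * (2 * m) * (3 + G)"
      using lamg X Y C0 m by (intro mult_mono) auto
    also have "\<dots> = (2 * C0 * (3 + G)) * (M powr \<theta> * m)" by simp
    also have "\<dots> \<le> M powr \<theta> * (M powr \<theta> * m)"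
    proof (intro mult_right_mono)
      have "0 \<le> 2 * C0 * (3 + G)" using C0 G0 by simp
      then show "2 * C0 * (3 + G) \<le> M powr \<theta>" using Q(2,5) by linarith
    qed (use m in simp)
    finally show ?thesis by (simp add: \<eta>eq mult_ac)
  qed
  have Jl: "(lam*l) powr J / l = M powr (p * J + 1 + \<rho>)"
  proof -
    have "(lam*l) powr J / l = (lam * l) powr J * (1 / l)" by simp
    also have "\<dots> = M powr (p * J + 1 + \<rho>)" unfolding l(4,7) powr_powr by (simp add: add.assoc flip: powr_add)
    finally show ?thesis .
  qed
  have hM: "C0 * ((lam*l) powr J / l) * Z * X * Y' \<le> M powr b / 2"
    if "0 \<le> Z" "Z \<le> M powr \<theta>" "0 \<le> Y'" "Y' \<le> 3 + G" for Z Y'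
  proof -
    have "C0 * ((lam*l) powr J / l) * Z * X * Y' \<le> C0 * M powr (p * J + 1 + \<rho>) * M powr \<theta> * (2 * m) * (3 + G)"
      unfolding Jl using that X C0 m by (intro mult_mono) auto
    also have "\<dots> = (2 * C0 * (3 + G)) * (M powr (p * J + 1 + \<rho>) * M powr \<theta> * m)" by simp
    also have "M powr (p * J + 1 + \<rho>) * M powr \<theta> * m = M powr (p * J + 1 + \<theta>)"
      by (simp add: m_def add.assoc flip: powr_add)
    also have "2 * C0 * (3 + G) * M powr (p * J + 1 + \<theta>) \<le> M powr \<theta> / 2 * M powr (p * J + 1 + \<theta>)"
      using Q(2,5) by (intro mult_right_mono) auto
    also have "\<dots> = M powr (p * J + 1 + 2 * \<theta>) / 2" by (simp add: algebra_simps flip: powr_add)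
    also have "\<dots> \<le> M powr b / 2" using mono[of "p * J + 1 + 2 * \<theta>" b] par by simp
    finally show ?thesis .
  qed
  have h1: "norm0 ?T (grad (grad v')) \<le> M powr b / 2"
  proof -
    have "C0 * ((lam*l) powr J / l) * lam powr (\<gamma>/2) * X * 1 \<le> M powr b / 2"
      by (rule hM) (use lamg G0 in auto)
    then show ?thesis using order_trans[OF est'(3)] by (simp only: mult_1_right)
  qed
  have h2: "norm0 ?T (grad (grad w')) \<le> M powr b / 2"
    by (rule order_trans[OF est'(4) hM]) (use lamg Y in auto)
  have dfv: "C_class 2 (\<lambda>x. v' x - v x)" "C_class 2 (\<lambda>x. w' x - w x)" using v'w' v w by (auto intro: C_class_diff)
  have inc: "norm (v' x - v x) \<le> \<eta>" "norm (grad v' x - grad v x) \<le> \<eta>"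
    "norm (w' x - w x) \<le> \<eta>" "norm (grad w' x - grad w x) \<le> \<eta>"
    "norm (grad (grad v') x) \<le> M powr b / 2" "norm (grad (grad w') x) \<le> M powr b / 2" if x: "x \<in> ?T" for x
  proof -
    note n1 = order_trans[OF norm1_ge(1)[OF cT(1) dfv(1) x] order_trans[OF est'(1) e1]]
      order_trans[OF norm1_ge(2)[OF cT(1) dfv(1) x] order_trans[OF est'(1) e1]]
      order_trans[OF norm1_ge(1)[OF cT(1) dfv(2) x] order_trans[OF est'(2) e2]]
      order_trans[OF norm1_ge(2)[OF cT(1) dfv(2) x] order_trans[OF est'(2) e2]]
    show "norm (v' x - v x) \<le> \<eta>" "norm (w' x - w x) \<le> \<eta>" by (rule n1)+
    show "norm (grad v' x - grad v x) \<le> \<eta>"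
      using n1(2) unfolding grad_diff[OF C_class_2D(1)[OF v'w'(1)] C_class_2D(1)[OF v(1)]] .
    show "norm (grad w' x - grad w x) \<le> \<eta>"
      using n1(4) unfolding grad_diff[OF C_class_2D(1)[OF v'w'(2)] C_class_2D(1)[OF w(1)]] .
    show "norm (grad (grad v') x) \<le> M powr b / 2"
      by (rule order_trans[OF norm0_ge[OF cT(1) C_class_2D(5)[OF v'w'(1)] x] h1])
    show "norm (grad (grad w') x) \<le> M powr b / 2"
      by (rule order_trans[OF norm0_ge[OF cT(1) C_class_2D(5)[OF v'w'(2)] x] h2])
  qed
  let ?T' = "nbhd \<omega> (2 * l')"
  have sub: "?T' \<subseteq> ?T" "?T \<subseteq> ?T2"
    using nbhd_mono[OF ll, of \<omega>] nbhd_mono[of l "2 * l" \<omega>] l(1) by (simp_all add: l'_def l_def)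
  have l'0: "0 \<le> l'" by (simp add: l'_def)
  \<comment> \<open>The second derivatives were bounded by half of \<open>M powr b\<close>. The
    other half has to hold the lower order part of \<open>norm2\<close>, which is at most
    \<open>M + 2 * \<eta>\<close> and hence at most \<open>3 * M\<close>.\<close>
  have big: "3 * M \<le> M powr b / 2"
  proof -
    have "12 \<le> M powr \<theta>" using Q by linarith
    moreover have "0 < \<gamma> * (1 + \<rho> + p)" using par by (intro mult_pos_pos) auto
    then have "0 < \<theta>" using par(6) by linarith
    then have "\<theta> \<le> b - 1" using par(8) mult_pos_pos[OF par(1) par(11)] by linarith
    then have "M powr \<theta> \<le> M powr (b - 1)" by (rule mono)
    ultimately have "12 * M \<le> M powr (b - 1) * M" using M0 by (intro mult_right_mono) auto
    also have "\<dots> = M powr b" using M0 powr_add[of M "b - 1" 1] by simp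
    finally show ?thesis using M0 by simp
  qed
  have n2: "norm2 ?T' u' \<le> M powr b"
    if u: "C_class 2 u" "norm2 ?T2 u \<le> M"
      and i: "\<And>x. x \<in> ?T \<Longrightarrow> norm (u' x - u x) \<le> \<eta> \<and> norm (grad u' x - grad u x) \<le> \<eta> \<and> norm (grad (grad u') x) \<le> M powr b / 2"
    for u u' :: "real^'d \<Rightarrow> real^'z"
  proof -
    have "norm2 ?T' u' \<le> (norm0 ?T2 u + \<eta>) + (norm0 ?T2 (grad u) + \<eta>) + M powr b / 2"
    proof (rule norm2_le)
      show "?T' \<noteq> {}" using l'0 by (intro neT) simp
      fix x assume "x \<in> ?T'"
      then have x: "x \<in> ?T" "x \<in> ?T2" using sub by auto
      show "norm (u' x) \<le> norm0 ?T2 u + \<eta>"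
        using norm0_ge[OF cT(2) C_class_2D(3)[OF u(1)] x(2)] i[OF x(1)] norm_triangle_sub[of "u' x" "u x"] by simp
      show "norm (grad u' x) \<le> norm0 ?T2 (grad u) + \<eta>"
        using norm0_ge[OF cT(2) C_class_2D(4)[OF u(1)] x(2)] i[OF x(1)] norm_triangle_sub[of "grad u' x" "grad u x"] by simp
      show "norm (grad (grad u') x) \<le> M powr b / 2" using i[OF x(1)] by simp
    qed
    moreover have "norm0 ?T2 u + norm0 ?T2 (grad u) \<le> M"
      using u(2) norm0_nonneg[OF cT(2) neT C_class_2D(5)[OF u(1)]] l(1) unfolding norm2_def by simp
    ultimately show ?thesis using big \<eta>(2) M0 by simp
  qed
  have nv: "norm2 ?T' v' \<le> M powr b" using v(1,2) inc by (intro n2[of v]) (auto simp: l_def)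
  have nw: "norm2 ?T' w' \<le> M powr b" using w(1,2) inc by (intro n2[of w]) (auto simp: l_def)
  have df: "norm0 ?T' (defect A v' w') \<le> (M powr b) powr (- 2 * \<rho>')"
  proof (rule norm0_le)
    show "?T' \<noteq> {}" using l'0 by (intro neT) simp
    fix x assume "x \<in> ?T'"
    then have "norm (defect A v' w' x) \<le> norm0 ?T (defect A v' w')"
      using sub by (intro norm0_ge cT continuous_on_defect contA v'w') auto
    also have "\<dots> \<le> C0 * (l powr \<beta> * norm0_holder \<beta> ?T2 A + 1 / (lam*l) powr S * lam powr \<gamma> * (DD + (l*M)\<^sup>2))"
      by (rule est'(5))
    also have "\<dots> \<le> C0 * (M powr (- \<beta> * (1 + \<rho>)) * B + M powr (- p * S) * M powr \<theta> * (2 * M powr (- 2 * \<rho>)))"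
    proof (rule mult_left_mono[OF add_mono])
      have "l powr \<beta> = M powr (- \<beta> * (1 + \<rho>))" by (simp add: l_def powr_powr algebra_simps)
      then show "l powr \<beta> * norm0_holder \<beta> ?T2 A \<le> M powr (- \<beta> * (1 + \<rho>)) * B"
        using l B(2)[rule_format, of l] by (simp add: mult_left_mono)
      have 1: "1 / (lam*l) powr S = M powr (- p * S)" unfolding l(7) powr_powr by (simp add: powr_minus_divide)
      have "(l*M)\<^sup>2 = M powr (- 2 * \<rho>)" unfolding l(6) by (simp add: power2_eq_square flip: powr_add)
      then have 2: "DD + (l*M)\<^sup>2 \<le> 2 * M powr (- 2 * \<rho>)" using DD(2) by simp
      show "1 / (lam*l) powr S * lam powr \<gamma> * (DD + (l*M)\<^sup>2)
          \<le> M powr (- p * S) * M powr \<theta> * (2 * M powr (- 2 * \<rho>))"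
        unfolding 1 by (rule mult_mono[OF mult_left_mono[OF lamg(1)] 2]) (use DD(1) in auto)
    qed (use C0 in simp)
    also have "\<dots> \<le> C0 * (M powr (- 2 * \<rho>' * b - \<theta>) * B + 2 * M powr (- 2 * \<rho>' * b - \<theta>))"
    proof (intro mult_left_mono add_mono mult_right_mono)
      show "M powr (- \<beta> * (1 + \<rho>)) \<le> M powr (- 2 * \<rho>' * b - \<theta>)" using par by (intro mono) simp
      have "M powr (- p * S) * M powr \<theta> * (2 * M powr (- 2 * \<rho>)) = 2 * M powr (- p * S + \<theta> - 2 * \<rho>)"
        by (simp flip: powr_add)
      also have "\<dots> \<le> 2 * M powr (- 2 * \<rho>' * b - \<theta>)" using par by (intro mult_left_mono mono) auto
      finally show "M powr (- p * S) * M powr \<theta> * (2 * M powr (- 2 * \<rho>)) \<le> 2 * M powr (- 2 * \<rho>' * b - \<theta>)" .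
    qed (use C0 B in auto)
    also have "\<dots> = C0 * (B + 2) * M powr (- 2 * \<rho>' * b - \<theta>)" by (simp add: algebra_simps)
    also have "\<dots> \<le> M powr \<theta> * M powr (- 2 * \<rho>' * b - \<theta>)" using Q(4,5) by (intro mult_right_mono) auto
    also have "\<dots> = (M powr b) powr (- 2 * \<rho>')" by (simp add: powr_powr algebra_simps flip: powr_add)
    finally show "norm (defect A v' w' x) \<le> (M powr b) powr (- 2 * \<rho>')" .
  qed
  show "\<exists>v' w'. ?P v' w'"
  proof (rule exI[of _ v'], rule exI[of _ w'], intro conjI ballI)
    have half: "y \<le> M powr b" if "y \<le> M powr b / 2" for y
    proof -
      have "0 \<le> M powr b" by simp
      with that show ?thesis by linarith
    qed
    fix x assume "x \<in> nbhd \<omega> (M powr (- 1 - \<rho>))"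
    then have x: "x \<in> ?T" by (simp add: l_def)
    show "norm (v' x - v x) \<le> M powr (2 * \<theta> - \<rho>)" "norm (grad v' x - grad v x) \<le> M powr (2 * \<theta> - \<rho>)"
      "norm (w' x - w x) \<le> M powr (2 * \<theta> - \<rho>)" "norm (grad w' x - grad w x) \<le> M powr (2 * \<theta> - \<rho>)"
      "norm (grad (grad v') x) \<le> M powr b" "norm (grad (grad w') x) \<le> M powr b"
      using inc[OF x] half unfolding \<eta>_def by blast+
  qed (use v'w' nv nw df in \<open>simp_all add: l'_def\<close>)
qed

text \<open>For \<open>z = norm (g x - g y)\<close> write
  \<open>z = z powr (1 - \<alpha>) * z powr \<alpha>\<close>, with the sup bound in one factor and
  the Lipschitz bound in the other. Beyond the distance \<open>l\<close> the bound
  \<open>2 * \<eta>\<close> is at most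
  \<open>2 * \<eta> * (dist x y / l) powr \<alpha>\<close>.\<close>

lemma holder_bounded_interpolation:
  fixes g :: "'a::metric_space \<Rightarrow> 'b::real_normed_vector"
  assumes "0 < l" "l \<le> 1" "0 < \<alpha>" "\<alpha> \<le> 1" "0 \<le> \<eta>" "0 \<le> L"
    and g: "\<And>x. x \<in> T \<Longrightarrow> norm (g x) \<le> \<eta>"
    and lip: "\<And>x y. x \<in> T \<Longrightarrow> y \<in> T \<Longrightarrow> dist x y \<le> l \<Longrightarrow> norm (g x - g y) \<le> L * dist x y"
  shows "holder_bounded \<alpha> T g ((2 * \<eta>) powr (1 - \<alpha>) * L powr \<alpha> + 2 * \<eta> * l powr (- \<alpha>))"
proof -
  have l1: "1 \<le> l powr (- \<alpha>)"
    using powr_mono2'[of "- \<alpha>" l 1] assms(1-3) by simp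
  then have \<eta>l: "\<eta> \<le> 2 * \<eta> * l powr (- \<alpha>)" using mult_left_mono[OF l1 assms(5)] assms(5) by simp
  have nn: "0 \<le> (2 * \<eta>) powr (1 - \<alpha>) * L powr \<alpha>" by simp
  have "norm (g x - g y) \<le> ((2 * \<eta>) powr (1 - \<alpha>) * L powr \<alpha> + 2 * \<eta> * l powr (- \<alpha>)) * dist x y powr \<alpha>"
    if x: "x \<in> T" "y \<in> T" for x y
  proof -
    define z where "z = norm (g x - g y)"
    have z: "0 \<le> z" "z \<le> 2 * \<eta>"
      using norm_triangle_ineq4[of "g x" "g y"] g[OF x(1)] g[OF x(2)] by (auto simp: z_def)
    show ?thesis
    proof (cases "dist x y \<le> l")
      case True
      have "z \<le> (2 * \<eta>) powr (1 - \<alpha>) * (L * dist x y) powr \<alpha>"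
      proof (cases "z = 0")
        case False
        then have "z = z powr (1 - \<alpha>) * z powr \<alpha>" using z(1) by (simp flip: powr_add)
        also have "\<dots> \<le> (2 * \<eta>) powr (1 - \<alpha>) * (L * dist x y) powr \<alpha>"
          using z lip[OF x True] assms by (intro mult_mono powr_mono2) (auto simp: z_def)
        finally show ?thesis .
      qed simp
      also have "\<dots> = (2 * \<eta>) powr (1 - \<alpha>) * L powr \<alpha> * dist x y powr \<alpha>" using assms by (simp add: powr_mult)
      finally have 1: "z \<le> (2 * \<eta>) powr (1 - \<alpha>) * L powr \<alpha> * dist x y powr \<alpha>" .
      have "0 \<le> 2 * \<eta> * l powr (- \<alpha>) * dist x y powr \<alpha>" using assms by simp
      with 1 show ?thesis unfolding z_def[symmetric] distrib_right by linarith
    next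
      case False
      have "1 \<le> (dist x y / l) powr \<alpha>" using False assms by (intro ge_one_powr_ge_zero) auto
      also have "\<dots> = l powr (- \<alpha>) * dist x y powr \<alpha>" using assms by (simp add: powr_divide powr_minus field_simps)
      finally have "2 * \<eta> * 1 \<le> 2 * \<eta> * (l powr (- \<alpha>) * dist x y powr \<alpha>)" using assms by (intro mult_left_mono) auto
      then have 1: "z \<le> 2 * \<eta> * l powr (- \<alpha>) * dist x y powr \<alpha>" using z by (simp add: mult.assoc)
      have "0 \<le> (2 * \<eta>) powr (1 - \<alpha>) * L powr \<alpha> * dist x y powr \<alpha>" by simp
      with 1 show ?thesis unfolding z_def[symmetric] distrib_right by linarith
    qed
  qed
  moreover have "norm (g x) \<le> (2 * \<eta>) powr (1 - \<alpha>) * L powr \<alpha> + 2 * \<eta> * l powr (- \<alpha>)" if "x \<in> T" for x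
    using g[OF that] \<eta>l nn by linarith
  ultimately show ?thesis unfolding holder_bounded_def by blast
qed

text \<open>
  Closeness of two points of the closure to within \<open>l\<close> guarantees that the segment between them lies in
  the \<open>l\<close>-neighbourhood; for distant points the sup norm suffices.
\<close>

lemma increment_holder_bounded:
  fixes u :: "real^'d \<Rightarrow> 'b::real_normed_vector"
  assumes u: "C_class 2 u" and l: "0 < l" "l \<le> 1" and \<alpha>: "0 < \<alpha>" "\<alpha> \<le> 1" and nn: "0 \<le> \<eta>" "0 \<le> L"
    and bd: "\<And>x. x \<in> nbhd \<omega> l \<Longrightarrow> norm (u x) \<le> \<eta>" "\<And>x. x \<in> nbhd \<omega> l \<Longrightarrow> norm (grad u x) \<le> \<eta>"
      "\<And>x. x \<in> nbhd \<omega> l \<Longrightarrow> norm (grad (grad u) x) \<le> L"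
  shows "holder_bounded \<alpha> (closure \<omega>) u ((2 * \<eta>) powr (1 - \<alpha>) * L powr \<alpha> + 4 * \<eta> * l powr (- \<alpha>))"
    and "holder_bounded \<alpha> (closure \<omega>) (grad u) ((2 * \<eta>) powr (1 - \<alpha>) * L powr \<alpha> + 4 * \<eta> * l powr (- \<alpha>))"
proof -
  have sub: "closure \<omega> \<subseteq> nbhd \<omega> l" using l by (intro closure_subset_nbhd) simp
  have cb: "cball x l \<subseteq> nbhd \<omega> l" if "x \<in> closure \<omega>" for x using that by (auto intro: nbhdI)
  have l1: "1 \<le> l powr (- \<alpha>)" using powr_mono2'[of "- \<alpha>" l 1] l \<alpha> by simp
  have 1: "norm (u x - u y) \<le> \<eta> * dist x y" "norm (grad u x - grad u y) \<le> L * dist x y"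
    if "x \<in> closure \<omega>" "dist x y \<le> l" for x y
  proof -
    have xy: "x \<in> cball x l" "y \<in> cball x l" using that l by auto
    show "norm (u x - u y) \<le> \<eta> * dist x y"
      by (rule convex_grad_bound[OF convex_cball C_class_2D(1)[OF u] bd(2) xy]) (use cb[OF that(1)] in blast)
    show "norm (grad u x - grad u y) \<le> L * dist x y"
      by (rule convex_grad_bound[OF convex_cball C_class_2D(2)[OF u] bd(3) xy]) (use cb[OF that(1)] in blast)
  qed
  have "holder_bounded \<alpha> (closure \<omega>) (grad u) ((2 * \<eta>) powr (1 - \<alpha>) * L powr \<alpha> + 2 * \<eta> * l powr (- \<alpha>))"
    using sub 1 by (intro holder_bounded_interpolation l \<alpha> nn bd) auto
  then show "holder_bounded \<alpha> (closure \<omega>) (grad u) ((2 * \<eta>) powr (1 - \<alpha>) * L powr \<alpha> + 4 * \<eta> * l powr (- \<alpha>))"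
    by (rule holder_bounded_mono) (use nn in simp)
  have "holder_bounded \<alpha> (closure \<omega>) u ((2 * \<eta>) powr (1 - \<alpha>) * \<eta> powr \<alpha> + 2 * \<eta> * l powr (- \<alpha>))"
    using sub 1 by (intro holder_bounded_interpolation l \<alpha> nn bd) auto
  moreover have "(2 * \<eta>) powr (1 - \<alpha>) * \<eta> powr \<alpha> \<le> 2 * \<eta> * l powr (- \<alpha>)"
  proof -
    have "(2 * \<eta>) powr (1 - \<alpha>) * \<eta> powr \<alpha> \<le> (2 * \<eta>) powr (1 - \<alpha>) * (2 * \<eta>) powr \<alpha>"
      using nn \<alpha> by (intro mult_left_mono powr_mono2) auto
    also have "\<dots> = 2 * \<eta>" using nn by (cases "\<eta> = 0") (simp_all flip: powr_add)
    also have "\<dots> \<le> 2 * \<eta> * l powr (- \<alpha>)" using mult_left_mono[OF l1, of "2 * \<eta>"] nn by simp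
    finally show ?thesis .
  qed
  moreover have "0 \<le> (2 * \<eta>) powr (1 - \<alpha>) * L powr \<alpha>" by simp
  ultimately show "holder_bounded \<alpha> (closure \<omega>) u ((2 * \<eta>) powr (1 - \<alpha>) * L powr \<alpha> + 4 * \<eta> * l powr (- \<alpha>))"
    by (elim holder_bounded_mono) linarith
qed

text \<open>Telescoping: \<open>V 0\<close> is prepended to the increments, so that partial sums are
  the members of the sequence. \<open>V 0\<close> contributes a finite bound by compactness, and
  summability is a matter of the increments alone.\<close>

lemma sequence_limit:
  fixes \<omega> :: "(real^'d) set" and V :: "nat \<Rightarrow> real^'d \<Rightarrow> real^'m"
  assumes \<omega>: "smooth_bounded_domain \<omega>" and \<alpha>: "0 < \<alpha>" "\<alpha> \<le> 1" and V: "\<And>i. C_class 2 (V i)" and c: "summable c"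
    and h: "\<And>i. holder_bounded \<alpha> (closure \<omega>) (\<lambda>x. V (Suc i) x - V i x) (c i)"
      "\<And>i. holder_bounded \<alpha> (closure \<omega>) (grad (\<lambda>x. V (Suc i) x - V i x)) (c i)"
  shows "\<exists>F. C1_holder \<alpha> F \<and> (\<forall>x\<in>closure \<omega>. (\<lambda>i. V i x) \<longlonglongrightarrow> F x \<and> (\<lambda>i. grad (V i) x) \<longlonglongrightarrow> grad F x)"
proof -
  have "bounded (closure \<omega>)" using \<omega> bounded_closure by (auto simp: smooth_bounded_domain_def)
  then obtain R where R: "closure \<omega> \<subseteq> cball 0 R" by (auto simp: bounded_iff subset_iff)
  have cX: "compact (cball (0::real^'d) R)" "convex (cball (0::real^'d) R)" by auto
  obtain a where a: "holder_bounded \<alpha> (cball 0 R) (V 0) a"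
    using holder_bounded_C1[OF cX C_class_2D(1,4)[OF V] \<alpha>] by blast
  obtain b where b: "holder_bounded \<alpha> (cball 0 R) (grad (V 0)) b"
    using holder_bounded_C1[OF cX C_class_2D(2,5)[OF V] \<alpha>] by blast
  define f where "f = (\<lambda>i. case i of 0 \<Rightarrow> V 0 | Suc k \<Rightarrow> (\<lambda>x. V (Suc k) x - V k x))"
  define c' where "c' = (\<lambda>i. case i of 0 \<Rightarrow> max a b | Suc k \<Rightarrow> c k)"
  have fC: "C_class 2 (f i)" for i
    by (cases i) (simp_all add: f_def V C_class_diff)
  have "summable (\<lambda>i. c' (Suc i))" using c by (simp add: c'_def)
  then have c': "summable c'" by (simp add: summable_Suc_iff)
  have "holder_bounded \<alpha> (closure \<omega>) (f i) (c' i)" "holder_bounded \<alpha> (closure \<omega>) (grad (f i)) (c' i)" for i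
  proof -
    have "holder_bounded \<alpha> (closure \<omega>) (V 0) (max a b)" "holder_bounded \<alpha> (closure \<omega>) (grad (V 0)) (max a b)"
      using holder_bounded_mono[OF holder_bounded_subset[OF a R]] holder_bounded_mono[OF holder_bounded_subset[OF b R]]
      by auto
    then show "holder_bounded \<alpha> (closure \<omega>) (f i) (c' i)" "holder_bounded \<alpha> (closure \<omega>) (grad (f i)) (c' i)"
      using h by (cases i; simp add: f_def c'_def)+
  qed
  from extension_series[OF \<omega> \<alpha> C_class_2D(1)[OF fC] c' this]
  obtain F where F: "C1_holder \<alpha> F" "\<And>x. x \<in> closure \<omega> \<Longrightarrow> (\<lambda>i. f i x) sums F x"
    "\<And>x k. x \<in> closure \<omega> \<Longrightarrow> (\<lambda>i. partial k (f i) x) sums partial k F x" by blast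
  have s1: "(\<Sum>i<Suc n. f i x) = V n x" for n x
    by (induction n) (simp_all add: f_def)
  have s2: "(\<Sum>i<Suc n. partial k (f i) x) = partial k (V n) x" for n x k
  proof (induction n)
    case (Suc n)
    have "partial k (f (Suc n)) x = partial k (V (Suc n)) x - partial k (V n) x"
      by (simp add: f_def partial_diff C_class_2D(1)[OF V])
    with Suc show ?case by simp
  qed (simp add: f_def)
  have "(\<lambda>i. V i x) \<longlonglongrightarrow> F x" "(\<lambda>i. grad (V i) x) \<longlonglongrightarrow> grad F x" if "x \<in> closure \<omega>" for x
  proof -
    show "(\<lambda>i. V i x) \<longlonglongrightarrow> F x" using LIMSEQ_Suc[OF F(2)[OF that, unfolded sums_def]] unfolding s1 .
    have "(\<lambda>i. partial k (V i) x) \<longlonglongrightarrow> partial k F x" for k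
      using LIMSEQ_Suc[OF F(3)[OF that, of k, unfolded sums_def]] unfolding s2 .
    then show "(\<lambda>i. grad (V i) x) \<longlonglongrightarrow> grad F x"
      by - (rule vec_tendstoI, simp add: grad_def)
  qed
  with F(1) show ?thesis by blast
qed

section \<open>Passage to the limit\<close>

lemma defect_limit:
  assumes "(\<lambda>i. grad (V i) x) \<longlonglongrightarrow> grad F x" "(\<lambda>i. grad (W i) x) \<longlonglongrightarrow> grad H x"
  shows "(\<lambda>i. defect A (V i) (W i) x) \<longlonglongrightarrow> defect A F H x"
proof (intro vec_tendstoI)
  fix k l
  have "(\<lambda>i. partial k (V i) x) \<longlonglongrightarrow> partial k F x" "(\<lambda>i. partial k (W i) x) \<longlonglongrightarrow> partial k H x" for k
    using tendsto_vec_nth[OF assms(1), of k] tendsto_vec_nth[OF assms(2), of k] by (simp_all add: grad_def)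
  then show "(\<lambda>i. defect A (V i) (W i) x $ k $ l) \<longlonglongrightarrow> defect A F H x $ k $ l"
    unfolding defect_nth by (intro tendsto_intros) auto
qed

text \<open>By Bernoulli's inequality \<open>b ^ i\<close> is at least
  \<open>1 + i * (b - 1)\<close>, so double exponential decay is dominated by a geometric
  sequence.\<close>

lemma double_exponential_decay:
  fixes M b a :: real
  assumes "1 < M" "1 < b" "0 < a"
  shows "(M powr (b ^ i)) powr (- a) \<le> M powr (- a) * (M powr (- a * (b - 1))) ^ i"
proof -
  have "1 + real i * (b - 1) \<le> (1 + (b - 1)) ^ i" using assms by (intro Bernoulli_inequality) simp
  then have "a * (1 + real i * (b - 1)) \<le> a * b ^ i" using assms by (intro mult_left_mono) auto
  then have "M powr (b ^ i * - a) \<le> M powr (- a + real i * (- a * (b - 1)))"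
    using assms by (intro powr_mono) (auto simp: algebra_simps)
  also have "\<dots> = M powr (- a) * (M powr (- a * (b - 1))) ^ i"
  proof -
    have "0 < M powr (- a * (b - 1))" using assms by simp
    then have "(M powr (- a * (b - 1))) ^ i = M powr (real i * (- a * (b - 1)))"
      by (simp add: powr_realpow[symmetric] powr_powr mult.commute)
    then show ?thesis by (simp only: powr_add)
  qed
  finally show ?thesis by (simp only: powr_powr)
qed


text \<open>Two rates are at work. The \<open>C^1\<close> increments decay from the first step on,
  as the ratio is never below \<open>\<rho>0\<close>, and this bounds the total displacement.
  Summability of the Hoelder bounds with exponent \<alpha> is only argued once the ratio has reached
  \<open>r\<close>.\<close>

lemma iteration:
  fixes \<omega> :: "(real^'d) set" and v0 :: "real^'d \<Rightarrow> real^'k" and w0 :: "real^'d \<Rightarrow> real^'d"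
  assumes \<omega>: "smooth_bounded_domain \<omega>" and C0: "0 < C0"
    and stage: "stage_with TYPE('k) \<omega> l0 S J \<gamma> C0"
    and A: "C0_holder_sym \<beta> A" "0 < \<beta>" "\<beta> < 2"
    and B: "0 \<le> B" "\<forall>l. 0 \<le> l \<and> l \<le> l0 \<longrightarrow> norm0_holder \<beta> (nbhd \<omega> (2 * l)) A \<le> B"
    and \<alpha>: "0 < \<alpha>" "\<alpha> \<le> 1"
    and par: "0 < \<rho>0" "\<rho>0 \<le> r" "0 < p" "1 < b" "0 < \<theta>" "0 < \<kappa>" "0 < \<gamma>" "\<gamma> * (1 + r + p) \<le> \<theta>" "0 < J"
      "1 + p * J + 2 * \<theta> \<le> b"
      "\<And>\<rho>. 0 \<le> \<rho> \<Longrightarrow> \<rho> \<le> r \<Longrightarrow> 2 * min r (\<rho> + \<kappa>) * b \<le> 2 * \<rho> + p * S - 2 * \<theta>"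
      "\<And>\<rho>. 0 \<le> \<rho> \<Longrightarrow> \<rho> \<le> r \<Longrightarrow> 2 * min r (\<rho> + \<kappa>) * b \<le> \<beta> * (1 + \<rho>) - \<theta>"
      "\<alpha> * b + 2 * \<theta> < r * (1 - \<alpha>)" "4 * \<theta> \<le> \<rho>0"
    and M: "1 < M" "1 / l0 < M" "0 < l0" "2 \<le> M powr (b - 1)" "4 * (1 + C0) * (4 + G) * (1 + B) \<le> M powr \<theta>"
      "2 \<le> M powr (\<rho>0 / 2 * (b - 1))" "2 \<le> M powr (\<rho>0 / 2)"
    and v0: "C_class 2 v0" "norm2 (nbhd \<omega> (2 * M powr (- 1 - \<rho>0))) v0 \<le> M"
      "norm0 (nbhd \<omega> (2 * M powr (- 1 - \<rho>0))) (grad v0) \<le> G"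
    and w0: "C_class 2 w0" "norm2 (nbhd \<omega> (2 * M powr (- 1 - \<rho>0))) w0 \<le> M"
    and D0: "norm0 (nbhd \<omega> (2 * M powr (- 1 - \<rho>0))) (defect A v0 w0) \<le> M powr (- 2 * \<rho>0)"
  shows "\<exists>F H. C1_holder \<alpha> (F :: real^'d \<Rightarrow> real^'k) \<and> C1_holder \<alpha> (H :: real^'d \<Rightarrow> real^'d) \<and>
    (\<forall>x\<in>closure \<omega>. norm (F x - v0 x) \<le> 2 * M powr (- \<rho>0 / 2) \<and> norm (grad F x - grad v0 x) \<le> 2 * M powr (- \<rho>0 / 2) \<and>
      norm (H x - w0 x) \<le> 2 * M powr (- \<rho>0 / 2) \<and> norm (grad H x - grad w0 x) \<le> 2 * M powr (- \<rho>0 / 2) \<and>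
      defect A F H x = 0)"
proof -
  have \<omega>': "bounded \<omega>" "\<omega> \<noteq> {}" using \<omega> by (auto simp: smooth_bounded_domain_def)
  \<comment> \<open>The ratio climbs by \<kappa> per step and stops at \<open>r\<close>, which it
    reaches after finitely many steps.\<close>
  define \<rho> where "\<rho> = (\<lambda>i::nat. min r (\<rho>0 + real i * \<kappa>))"
  define m where "m = (\<lambda>i::nat. M powr (b ^ i))"
  define l where "l = (\<lambda>i. m i powr (- 1 - \<rho> i))"
  define \<eta> where "\<eta> = (\<lambda>i. m i powr (2 * \<theta> - \<rho> i))"
  \<comment> \<open>The estimates for \<open>w\<close> involve the sup norm of the gradient of
    \<open>v\<close>, which must stay bounded along the iteration. The increments sum to at most 1,
    so \<open>G + 1\<close> always works; this is why \<open>M\<close> is assumed large relative to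
    \<open>4 + G\<close> where one step asks for \<open>3 + G\<close>.\<close>
  define g where "g = (\<lambda>i. G + (\<Sum>j<i. \<eta> j))"
  have \<rho>: "\<rho>0 \<le> \<rho> i" "\<rho> i \<le> r" "\<rho> (Suc i) = min r (\<rho> i + \<kappa>)" "\<rho> 0 = \<rho>0" "\<rho> i \<le> \<rho> (Suc i)" for i
  proof -
    have "0 \<le> real i * \<kappa>" using par by simp
    then show "\<rho>0 \<le> \<rho> i" "\<rho> i \<le> r" using par by (auto simp: \<rho>_def)
    show "\<rho> 0 = \<rho>0" using par by (simp add: \<rho>_def)
    show "\<rho> (Suc i) = min r (\<rho> i + \<kappa>)" using par by (auto simp: \<rho>_def min_def algebra_simps)
    then show "\<rho> i \<le> \<rho> (Suc i)" using par \<open>\<rho> i \<le> r\<close> by simp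
  qed
  have b1: "1 \<le> b ^ i" for i using par by (simp add: one_le_power)
  have m: "M \<le> m i" "1 < m i" "m (Suc i) = m i powr b" "m 0 = M" "m i \<le> m (Suc i)" for i
  proof -
    have "M powr 1 \<le> M powr (b ^ i)" using M b1 by (intro powr_mono) auto
    then show 1: "M \<le> m i" using M by (simp add: m_def)
    then show 2: "1 < m i" using M by simp
    show 3: "m (Suc i) = m i powr b" by (simp add: m_def powr_powr mult.commute)
    show "m 0 = M" using M by (simp add: m_def)
    have "m i powr 1 \<le> m i powr b" using 2 par by (intro powr_mono) auto
    then show "m i \<le> m (Suc i)" using 2 3 by simp
  qed
  have m_mono: "m i powr a \<le> m i powr c" if "a \<le> c" for i a c using that m(2)[of i] by (intro powr_mono) auto
  have M_le: "M powr a \<le> m i powr a" if "0 \<le> a" for a i using that m(1)[of i] M by (intro powr_mono2) auto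
  define e where "e = M powr (- \<rho>0 / 2)"
  have e: "0 < e" "2 * e \<le> 1"
  proof -
    show "0 < e" using M by (simp add: e_def)
    have "e * M powr (\<rho>0 / 2) = 1" using M by (simp add: e_def flip: powr_add)
    moreover have "e * 2 \<le> e * M powr (\<rho>0 / 2)" using M \<open>0 < e\<close> by (intro mult_left_mono) auto
    ultimately show "2 * e \<le> 1" by simp
  qed
  have small: "m i powr (- \<rho>0 / 2) \<le> e * (1 / 2) ^ i" for i
  proof -
    have "m i powr (- (\<rho>0 / 2)) \<le> M powr (- (\<rho>0 / 2)) * (M powr (- (\<rho>0 / 2) * (b - 1))) ^ i"
      unfolding m_def using M par by (intro double_exponential_decay) auto
    also have "\<dots> \<le> M powr (- (\<rho>0 / 2)) * (1 / 2) ^ i"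
    proof (intro mult_left_mono power_mono)
      have "M powr (- (\<rho>0 / 2) * (b - 1)) = 1 / M powr (\<rho>0 / 2 * (b - 1))"
        using powr_minus_divide[of M "\<rho>0 / 2 * (b - 1)"] by simp
      also have "\<dots> \<le> 1 / 2" using M(6) by (intro divide_left_mono) auto
      finally show "M powr (- (\<rho>0 / 2) * (b - 1)) \<le> 1 / 2" .
    qed auto
    finally show ?thesis by (simp add: e_def)
  qed
  \<comment> \<open>The condition \<open>4 * \<theta> \<le> \<rho>0\<close> keeps the exponent below
    \<open>- \<rho>0 / 2\<close> whatever the current ratio.\<close>
  have \<eta>_le: "\<eta> i \<le> e * (1 / 2) ^ i" for i
  proof -
    have "2 * \<theta> - \<rho> i \<le> - \<rho>0 / 2" using par(14) \<rho>(1)[of i] by simp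
    from m_mono[OF this] show ?thesis using small[of i] unfolding \<eta>_def by (rule order_trans)
  qed
  have \<eta>0: "0 \<le> \<eta> i" for i by (simp add: \<eta>_def)
  have sum\<eta>: "(\<Sum>j<i. \<eta> j) \<le> 2 * e" for i
  proof -
    have "(\<Sum>j<i. \<eta> j) \<le> (\<Sum>j<i. e * (1 / 2) ^ j)" by (intro sum_mono \<eta>_le)
    also have "\<dots> = e * (2 * (1 - (1 / 2) ^ i))"
      unfolding sum_distrib_left[symmetric] by (simp add: sum_gp_strict)
    also have "\<dots> \<le> e * 2" using e by (intro mult_left_mono) auto
    finally show ?thesis by simp
  qed
  have g: "g i \<le> G + 1" for i using sum\<eta>[of i] e unfolding g_def by linarith
  \<comment> \<open>The clause for \<open>i = 0\<close> pins the start: dependent choice only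
    promises some pair satisfying \<open>P 0\<close>.\<close>
  define P where "P = (\<lambda>i (v :: real^'d \<Rightarrow> real^'k, w :: real^'d \<Rightarrow> real^'d). C_class 2 v \<and> C_class 2 w \<and>
    norm2 (nbhd \<omega> (2 * l i)) v \<le> m i \<and> norm2 (nbhd \<omega> (2 * l i)) w \<le> m i \<and>
    norm0 (nbhd \<omega> (2 * l i)) (defect A v w) \<le> m i powr (- 2 * \<rho> i) \<and>
    norm0 (nbhd \<omega> (2 * l i)) (grad v) \<le> g i \<and> (i = 0 \<longrightarrow> v = v0 \<and> w = w0))"
  define Q where "Q = (\<lambda>i (v :: real^'d \<Rightarrow> real^'k, w :: real^'d \<Rightarrow> real^'d)
      (v' :: real^'d \<Rightarrow> real^'k, w' :: real^'d \<Rightarrow> real^'d). \<forall>x\<in>nbhd \<omega> (l i).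
        norm (v' x - v x) \<le> \<eta> i \<and> norm (grad v' x - grad v x) \<le> \<eta> i \<and>
        norm (w' x - w x) \<le> \<eta> i \<and> norm (grad w' x - grad w x) \<le> \<eta> i \<and>
        norm (grad (grad v') x) \<le> m (Suc i) \<and> norm (grad (grad w') x) \<le> m (Suc i))"
  have l0: "0 < l i" "l i \<le> 1" for i
    using m(2)[of i] m_mono[of "- 1 - \<rho> i" 0 i] \<rho>(1)[of i] par(1) by (auto simp: l_def)
  have step: "\<exists>y. P (Suc i) y \<and> Q i x y" if Px: "P i x" for i x
  proof -
    obtain v w where x: "x = (v, w)" by (cases x)
    have Pv: "C_class 2 v" "C_class 2 w" "norm2 (nbhd \<omega> (2 * l i)) v \<le> m i" "norm2 (nbhd \<omega> (2 * l i)) w \<le> m i"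
      "norm0 (nbhd \<omega> (2 * l i)) (defect A v w) \<le> m i powr (- 2 * \<rho> i)"
      "norm0 (nbhd \<omega> (2 * l i)) (grad v) \<le> g i"
      using Px by (auto simp: P_def x)
    have pars: "0 < p" "0 \<le> \<rho> i" "\<rho> i \<le> \<rho> (Suc i)" "1 < b" "0 < \<gamma>" "\<gamma> * (1 + \<rho> i + p) \<le> \<theta>" "2 * \<theta> \<le> \<rho> i"
      "1 + p * J + 2 * \<theta> \<le> b" "2 * \<rho> (Suc i) * b \<le> 2 * \<rho> i + p * S - 2 * \<theta>"
      "2 * \<rho> (Suc i) * b \<le> \<beta> * (1 + \<rho> i) - \<theta>" "0 < J"
    proof -
      have "\<gamma> * (1 + \<rho> i + p) \<le> \<gamma> * (1 + r + p)" using par(7) \<rho>(2)[of i] by (intro mult_left_mono) auto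
      then show "\<gamma> * (1 + \<rho> i + p) \<le> \<theta>" using par(8) by linarith
      show i0: "0 \<le> \<rho> i" using \<rho>(1)[of i] par(1) by linarith
      show "2 * \<theta> \<le> \<rho> i" using \<rho>(1)[of i] par(5,14) by linarith
      show "2 * \<rho> (Suc i) * b \<le> 2 * \<rho> i + p * S - 2 * \<theta>" "2 * \<rho> (Suc i) * b \<le> \<beta> * (1 + \<rho> i) - \<theta>"
        unfolding \<rho>(3)[of i] by (rule par(11,12)[OF i0 \<rho>(2)])+
      show "\<rho> i \<le> \<rho> (Suc i)" by (rule \<rho>(5))
    qed (fact par)+
    have Ms: "1 < m i" "1 / l0 < m i" "0 < l0" "2 \<le> m i powr (b - 1)" "4 * (1 + C0) * (3 + (G + 1)) * (1 + B) \<le> m i powr \<theta>"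
    proof -
      show "1 / l0 < m i" using M(2) m(1)[of i] by linarith
      show "2 \<le> m i powr (b - 1)" by (rule order_trans[OF M(4) M_le]) (use par in simp)
      have "4 * (1 + C0) * (4 + G) * (1 + B) \<le> m i powr \<theta>" by (rule order_trans[OF M(5) M_le]) (use par in simp)
      then show "4 * (1 + C0) * (3 + (G + 1)) * (1 + B) \<le> m i powr \<theta>" by (simp add: add.commute)
    qed (fact m M)+
    have l_eq: "m i powr (- 1 - \<rho> i) = l i" and \<eta>_eq: "m i powr (2 * \<theta> - \<rho> i) = \<eta> i"
      by (simp_all add: l_def \<eta>_def)
    note ss = stage_step[OF \<omega>' C0 stage A B pars Ms Pv(1) _ _ Pv(2), unfolded l_eq, OF Pv(3) order_trans[OF Pv(6) g] Pv(4,5)]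
    have lS: "m (Suc i) powr (- 1 - \<rho> (Suc i)) = l (Suc i)" by (simp add: l_def)
    obtain v' w' where n: "C_class 2 v'" "C_class 2 w'"
      "\<forall>x\<in>nbhd \<omega> (l i). norm (v' x - v x) \<le> \<eta> i \<and> norm (grad v' x - grad v x) \<le> \<eta> i \<and>
        norm (w' x - w x) \<le> \<eta> i \<and> norm (grad w' x - grad w x) \<le> \<eta> i \<and>
        norm (grad (grad v') x) \<le> m (Suc i) \<and> norm (grad (grad w') x) \<le> m (Suc i)"
      "norm2 (nbhd \<omega> (2 * l (Suc i))) v' \<le> m (Suc i)" "norm2 (nbhd \<omega> (2 * l (Suc i))) w' \<le> m (Suc i)"
      "norm0 (nbhd \<omega> (2 * l (Suc i))) (defect A v' w') \<le> m (Suc i) powr (- 2 * \<rho> (Suc i))"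
      using ss(2) unfolding m(3)[of i, symmetric] lS \<eta>_eq by blast
    have sub: "nbhd \<omega> (2 * l (Suc i)) \<subseteq> nbhd \<omega> (l i)" "nbhd \<omega> (l i) \<subseteq> nbhd \<omega> (2 * l i)"
      using ss(1) l0(1)[of i] unfolding m(3)[of i, symmetric] lS by (auto intro!: nbhd_mono)
    have "norm0 (nbhd \<omega> (2 * l (Suc i))) (grad v') \<le> g (Suc i)"
    proof (rule norm0_le)
      show "nbhd \<omega> (2 * l (Suc i)) \<noteq> {}"
        using closure_subset_nbhd[of "2 * l (Suc i)" \<omega>] \<omega>'(2) l0(1)[of "Suc i"] by auto
      fix x assume "x \<in> nbhd \<omega> (2 * l (Suc i))"
      then have x: "x \<in> nbhd \<omega> (l i)" "x \<in> nbhd \<omega> (2 * l i)" using sub by auto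
      have "norm (grad v x) \<le> g i"
        by (rule order_trans[OF norm0_ge[OF compact_nbhd[OF \<omega>'(1)] C_class_2D(4)[OF Pv(1)] x(2)] Pv(6)])
      moreover have "norm (grad v' x - grad v x) \<le> \<eta> i" using n(3) x(1) by blast
      moreover have "norm (grad v' x) \<le> norm (grad v x) + norm (grad v' x - grad v x)" by (rule norm_triangle_sub)
      ultimately show "norm (grad v' x) \<le> g (Suc i)" by (simp add: g_def)
    qed
    with n have "P (Suc i) (v', w') \<and> Q i x (v', w')" by (simp add: P_def Q_def x)
    then show ?thesis by blast
  qed
  have P0: "\<exists>x. P 0 x"
  proof -
    have "l 0 = M powr (- 1 - \<rho>0)" by (simp add: l_def m(4) \<rho>(4))
    then have "P 0 (v0, w0)" using v0 w0 D0 by (simp add: P_def m(4) \<rho>(4) g_def)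
    then show ?thesis by blast
  qed
  from dependent_nat_choice[where P = P and Q = Q, OF P0 step]
  obtain x where x: "\<And>i. P i (x i)" "\<And>i. Q i (x i) (x (Suc i))" by blast
  define V where "V = (\<lambda>i. fst (x i))"
  define W where "W = (\<lambda>i. snd (x i))"
  have PV: "C_class 2 (V i)" "C_class 2 (W i)" "norm2 (nbhd \<omega> (2 * l i)) (V i) \<le> m i" "norm2 (nbhd \<omega> (2 * l i)) (W i) \<le> m i"
    "norm0 (nbhd \<omega> (2 * l i)) (defect A (V i) (W i)) \<le> m i powr (- 2 * \<rho> i)" for i
    using x(1)[of i] by (auto simp: P_def V_def W_def split: prod.splits)
  have V0: "V 0 = v0" "W 0 = w0" using x(1)[of 0] by (auto simp: P_def V_def W_def split: prod.splits)
  have QV: "norm (V (Suc i) y - V i y) \<le> \<eta> i" "norm (grad (V (Suc i)) y - grad (V i) y) \<le> \<eta> i"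
    "norm (W (Suc i) y - W i y) \<le> \<eta> i" "norm (grad (W (Suc i)) y - grad (W i) y) \<le> \<eta> i"
    "norm (grad (grad (V (Suc i))) y) \<le> m (Suc i)" "norm (grad (grad (W (Suc i))) y) \<le> m (Suc i)"
    if "y \<in> nbhd \<omega> (l i)" for i y
    using x(2)[of i] that by (auto simp: Q_def V_def W_def split: prod.splits)
  \<comment> \<open>The bound of \<open>increment_holder_bounded\<close>, the second derivatives of
    an increment being at most \<open>m (Suc i) + m i\<close>.\<close>
  define c where "c = (\<lambda>i. (2 * \<eta> i) powr (1 - \<alpha>) * (2 * m (Suc i)) powr \<alpha> + 4 * \<eta> i * l i powr (- \<alpha>))"
  have hb: "holder_bounded \<alpha> (closure \<omega>) (\<lambda>x. U (Suc i) x - U i x) (c i)"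
      "holder_bounded \<alpha> (closure \<omega>) (grad (\<lambda>x. U (Suc i) x - U i x)) (c i)"
    if U: "\<And>i. C_class 2 (U i)" "\<And>i. norm2 (nbhd \<omega> (2 * l i)) (U i) \<le> m i"
      "\<And>i y. y \<in> nbhd \<omega> (l i) \<Longrightarrow> norm (U (Suc i) y - U i y) \<le> \<eta> i"
      "\<And>i y. y \<in> nbhd \<omega> (l i) \<Longrightarrow> norm (grad (U (Suc i)) y - grad (U i) y) \<le> \<eta> i"
      "\<And>i y. y \<in> nbhd \<omega> (l i) \<Longrightarrow> norm (grad (grad (U (Suc i))) y) \<le> m (Suc i)"
    for U :: "nat \<Rightarrow> real^'d \<Rightarrow> real^'z" and i
  proof -
    note dU = C_class_2D(1)[OF U(1)] and ddU = C_class_2D(2)[OF U(1)]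
    have gd: "grad (\<lambda>x. U (Suc i) x - U i x) = (\<lambda>x. grad (U (Suc i)) x - grad (U i) x)"
      by (simp add: fun_eq_iff grad_diff dU)
    have ggd: "grad (grad (\<lambda>x. U (Suc i) x - U i x)) y = grad (grad (U (Suc i))) y - grad (grad (U i)) y" for y
      unfolding gd by (rule grad_diff) (rule ddU)+
    have n2: "norm (grad (grad (U i)) y) \<le> m (Suc i)" if "y \<in> nbhd \<omega> (l i)" for y
    proof -
      have "y \<in> nbhd \<omega> (2 * l i)" using nbhd_mono[of "l i" "2 * l i" \<omega>] l0(1)[of i] that by auto
      then have "norm (grad (grad (U i)) y) \<le> norm2 (nbhd \<omega> (2 * l i)) (U i)"
        by (rule norm2_ge(3)[OF compact_nbhd[OF \<omega>'(1)] U(1)])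
      then show ?thesis using U(2)[of i] m(5)[of i] by linarith
    qed
    have u2: "C_class 2 (\<lambda>x. U (Suc i) x - U i x)" by (intro C_class_diff U(1))
    have m0: "0 \<le> 2 * m (Suc i)" using m(2)[of "Suc i"] by simp
    have b2: "norm (grad (\<lambda>x. U (Suc i) x - U i x) y) \<le> \<eta> i" if "y \<in> nbhd \<omega> (l i)" for y
      unfolding gd by (rule U(4)[OF that])
    have b3: "norm (grad (grad (\<lambda>x. U (Suc i) x - U i x)) y) \<le> 2 * m (Suc i)" if "y \<in> nbhd \<omega> (l i)" for y
      unfolding ggd using norm_triangle_ineq4[of "grad (grad (U (Suc i))) y" "grad (grad (U i)) y"] U(5)[OF that] n2[OF that]
      by linarith
    show "holder_bounded \<alpha> (closure \<omega>) (\<lambda>x. U (Suc i) x - U i x) (c i)"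
      "holder_bounded \<alpha> (closure \<omega>) (grad (\<lambda>x. U (Suc i) x - U i x)) (c i)"
      unfolding c_def
      by (rule increment_holder_bounded[OF u2 l0 \<alpha> \<eta>0 m0 U(3) b2 b3]; assumption)+
  qed
  have "summable c"
  proof -
    define a where "a = r * (1 - \<alpha>) - \<alpha> * b - 2 * \<theta>"
    have a: "0 < a" using par(13) by (simp add: a_def)
    \<comment> \<open>From \<open>N\<close> on the ratio equals \<open>r\<close>, and only then does
      the assumption on \<alpha> make the exponent \<open>- a\<close> available. The finitely many
      earlier terms do not affect summability.\<close>
    obtain N where N: "r - \<rho>0 < real N * \<kappa>" using reals_Archimedean3[OF par(6)] by blast
    have c_le: "c i \<le> 6 * m i powr (- a)" if "N \<le> i" for i
    proof -
      have "real N * \<kappa> \<le> real i * \<kappa>" using that par(6) by (intro mult_right_mono) auto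
      then have \<rho>r: "\<rho> i = r" using N by (simp add: \<rho>_def)
      have "(2 * \<eta> i) powr (1 - \<alpha>) * (2 * m (Suc i)) powr \<alpha>
          = (2 powr (1 - \<alpha>) * 2 powr \<alpha>) * (\<eta> i powr (1 - \<alpha>) * m (Suc i) powr \<alpha>)"
        using \<eta>0[of i] m(2)[of "Suc i"] by (simp add: powr_mult)
      also have "(2::real) powr (1 - \<alpha>) * 2 powr \<alpha> = 2" by (simp flip: powr_add)
      also have "\<eta> i powr (1 - \<alpha>) * m (Suc i) powr \<alpha> = m i powr ((2 * \<theta> - r) * (1 - \<alpha>) + b * \<alpha>)"
        by (simp add: \<eta>_def m(3) \<rho>r powr_powr powr_add)
      also have "\<dots> \<le> m i powr (- a)"
      proof (rule m_mono)
        have "0 \<le> 2 * \<theta> * \<alpha>" using par \<alpha> by simp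
        then show "(2 * \<theta> - r) * (1 - \<alpha>) + b * \<alpha> \<le> - a" by (simp add: a_def algebra_simps)
      qed
      finally have 1: "(2 * \<eta> i) powr (1 - \<alpha>) * (2 * m (Suc i)) powr \<alpha> \<le> 2 * m i powr (- a)" by simp
      have "\<eta> i * l i powr (- \<alpha>) = m i powr ((2 * \<theta> - r) + (- 1 - r) * (- \<alpha>))"
        by (simp only: \<eta>_def l_def \<rho>r powr_powr powr_add)
      also have "\<dots> \<le> m i powr (- a)"
      proof (rule m_mono)
        have "\<alpha> * 1 \<le> \<alpha> * b" using par \<alpha> by (intro mult_left_mono) auto
        then show "(2 * \<theta> - r) + (- 1 - r) * (- \<alpha>) \<le> - a" by (simp add: a_def algebra_simps)
      qed
      finally have 2: "\<eta> i * l i powr (- \<alpha>) \<le> m i powr (- a)" .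
      from 1 2 show ?thesis unfolding c_def mult.assoc by linarith
    qed
    define q where "q = M powr (- a * (b - 1))"
    have q: "0 \<le> q" "q < 1"
    proof -
      have "0 < a * (b - 1)" using a par by (intro mult_pos_pos) auto
      then have "M powr (- a * (b - 1)) < M powr 0" using M by (intro powr_less_mono) auto
      then show "0 \<le> q" "q < 1" using M by (simp_all add: q_def)
    qed
    have "summable (\<lambda>i. 6 * (M powr (- a) * q ^ i))" using q by (intro summable_mult summable_geometric) simp
    moreover have "norm (c i) \<le> 6 * (M powr (- a) * q ^ i)" if "N \<le> i" for i
    proof -
      have "0 \<le> c i" using \<eta>0[of i] by (simp add: c_def)
      moreover have "m i powr (- a) \<le> M powr (- a) * q ^ i"
        unfolding m_def q_def by (rule double_exponential_decay[OF M(1) par(4) a])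
      ultimately show ?thesis using c_le[OF that] by simp
    qed
    ultimately show ?thesis by (rule summable_comparison_test')
  qed
  note hbV = hb[OF PV(1,3) QV(1,2,5)] and hbW = hb[OF PV(2,4) QV(3,4,6)]
  obtain F where F: "C1_holder \<alpha> F" "\<And>x. x \<in> closure \<omega> \<Longrightarrow> (\<lambda>i. V i x) \<longlonglongrightarrow> F x"
    "\<And>x. x \<in> closure \<omega> \<Longrightarrow> (\<lambda>i. grad (V i) x) \<longlonglongrightarrow> grad F x"
    using sequence_limit[OF \<omega> \<alpha> PV(1) \<open>summable c\<close> hbV] by blast
  obtain H where H: "C1_holder \<alpha> H" "\<And>x. x \<in> closure \<omega> \<Longrightarrow> (\<lambda>i. W i x) \<longlonglongrightarrow> H x"
    "\<And>x. x \<in> closure \<omega> \<Longrightarrow> (\<lambda>i. grad (W i) x) \<longlonglongrightarrow> grad H x"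
    using sequence_limit[OF \<omega> \<alpha> PV(2) \<open>summable c\<close> hbW] by blast
  have lim_le: "norm (L - U 0) \<le> 2 * e"
    if "U \<longlonglongrightarrow> L" "\<And>i. norm (U (Suc i) - U i) \<le> \<eta> i" for U :: "nat \<Rightarrow> 'z::real_normed_vector" and L
  proof -
    have "norm (U i - U 0) \<le> (\<Sum>j<i. \<eta> j)" for i
    proof (induction i)
      case (Suc i)
      have "norm (U (Suc i) - U 0) \<le> norm (U (Suc i) - U i) + norm (U i - U 0)"
        using norm_triangle_ineq[of "U (Suc i) - U i" "U i - U 0"] by simp
      then show ?case using Suc that(2)[of i] by simp
    qed simp
    then have "norm (U i - U 0) \<le> 2 * e" for i using sum\<eta>[of i] order_trans by blast
    moreover have "(\<lambda>i. norm (U i - U 0)) \<longlonglongrightarrow> norm (L - U 0)" by (intro tendsto_intros that)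
    ultimately show ?thesis by (intro LIMSEQ_le_const2[of _ _ "2 * e"]) auto
  qed
  have clo: "closure \<omega> \<subseteq> nbhd \<omega> (l i)" "closure \<omega> \<subseteq> nbhd \<omega> (2 * l i)" for i
    using l0(1)[of i] by (intro closure_subset_nbhd; simp)+
  have contA: "continuous_on Y A" for Y
    using A C0_holder_continuous continuous_on_subset unfolding C0_holder_sym_def by blast
  have "defect A F H y = 0" if y: "y \<in> closure \<omega>" for y
  proof -
    have "norm (defect A (V i) (W i) y) \<le> e * (1 / 2) ^ i" for i
    proof -
      have "norm (defect A (V i) (W i) y) \<le> norm0 (nbhd \<omega> (2 * l i)) (defect A (V i) (W i))"
        using y clo(2) by (intro norm0_ge compact_nbhd \<omega>' continuous_on_defect contA PV) auto
      also have "\<dots> \<le> m i powr (- 2 * \<rho> i)" by (rule PV(5))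
      also have "\<dots> \<le> m i powr (- \<rho>0 / 2)" using \<rho>(1)[of i] par(1) by (intro m_mono) simp
      also have "\<dots> \<le> e * (1 / 2) ^ i" by (rule small)
      finally show ?thesis .
    qed
    then have ev: "\<forall>\<^sub>F i in sequentially. norm (defect A (V i) (W i) y) \<le> e * (1 / 2) ^ i"
      by (rule always_eventually[OF allI])
    have "(\<lambda>i. e * (1 / 2) ^ i) \<longlonglongrightarrow> e * 0" by (intro tendsto_intros LIMSEQ_power_zero) simp
    then have "(\<lambda>i. e * (1 / 2) ^ i) \<longlonglongrightarrow> 0" by simp
    with ev have "(\<lambda>i. defect A (V i) (W i) y) \<longlonglongrightarrow> 0" by (rule Lim_null_comparison)
    moreover have "(\<lambda>i. defect A (V i) (W i) y) \<longlonglongrightarrow> defect A F H y" by (rule defect_limit[OF F(3)[OF y] H(3)[OF y]])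
    ultimately show ?thesis using LIMSEQ_unique by blast
  qed
  moreover have "norm (F y - v0 y) \<le> 2 * e" "norm (grad F y - grad v0 y) \<le> 2 * e"
    "norm (H y - w0 y) \<le> 2 * e" "norm (grad H y - grad w0 y) \<le> 2 * e" if y: "y \<in> closure \<omega>" for y
  proof -
    have yl: "y \<in> nbhd \<omega> (l i)" for i using y clo(1) by blast
    show "norm (F y - v0 y) \<le> 2 * e" using lim_le[OF F(2)[OF y] QV(1)[OF yl]] V0 by simp
    show "norm (grad F y - grad v0 y) \<le> 2 * e" using lim_le[OF F(3)[OF y] QV(2)[OF yl]] V0 by simp
    show "norm (H y - w0 y) \<le> 2 * e" using lim_le[OF H(2)[OF y] QV(3)[OF yl]] V0 by simp
    show "norm (grad H y - grad w0 y) \<le> 2 * e" using lim_le[OF H(3)[OF y] QV(4)[OF yl]] V0 by simp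
  qed
  ultimately show ?thesis using F(1) H(1) unfolding e_def by blast
qed

section \<open>Choice of the starting frequency and conclusion\<close>

lemma eventually_le_powr:
  fixes a c :: real
  assumes "0 < a"
  shows "\<forall>\<^sub>F n in sequentially. c \<le> real (n + 1) powr a"
proof -
  have "c \<le> real (n + 1) powr a" if "nat \<lceil>\<bar>c\<bar> powr (1 / a)\<rceil> \<le> n" for n
  proof -
    have "\<bar>c\<bar> powr (1 / a) \<le> real (nat \<lceil>\<bar>c\<bar> powr (1 / a)\<rceil>)" by (rule real_nat_ceiling_ge)
    also have "\<dots> \<le> real n" using that by (simp only: of_nat_le_iff)
    also have "\<dots> \<le> real (n + 1)" by simp
    finally have "(\<bar>c\<bar> powr (1 / a)) powr a \<le> real (n + 1) powr a" using assms by (intro powr_mono2) auto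
    moreover have "(\<bar>c\<bar> powr (1 / a)) powr a = \<bar>c\<bar>" using assms by (simp add: powr_powr)
    ultimately show ?thesis using abs_ge_self[of c] by linarith
  qed
  then show ?thesis unfolding eventually_sequentially by blast
qed

lemma norm0_mono:
  assumes "T \<subseteq> T0" "T \<noteq> {}" "compact T0" "continuous_on T0 f"
  shows "norm0 T f \<le> norm0 T0 f"
  using assms by (intro norm0_le norm0_ge) auto

lemma norm2_mono:
  assumes "T \<subseteq> T0" "T \<noteq> {}" "compact T0" "C_class 2 f"
  shows "norm2 T f \<le> norm2 T0 f"
  unfolding norm2_def by (intro add_mono norm0_mono assms C_class_2D)

theorem theorem1p4:
  fixes \<omega> :: "(real^'d) set" and l0 S J \<alpha> :: real and A :: "real^'d \<Rightarrow> real^'d^'d"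
  assumes "smooth_bounded_domain \<omega>"
    and "0 < l0" and "l0 < 1" and "1 \<le> S" and "1 \<le> J"
    and "stage TYPE('k::finite) \<omega> l0 S J"
  shows "\<exists>C>0. \<forall>\<beta> (v :: real^'d \<Rightarrow> real^'k) (w :: real^'d \<Rightarrow> real^'d).
    0 < \<beta> \<and> \<beta> < 2 \<and> C_class 2 v \<and> C_class 2 w \<and> C0_holder_sym \<beta> A \<and>
    0 < norm0 (nbhd \<omega> (2*l0)) (defect A v w) \<and> norm0 (nbhd \<omega> (2*l0)) (defect A v w) \<le> 1 \<and>
    0 < \<alpha> \<and> \<alpha> < min (\<beta>/2) (S / (S + 2*J)) \<longrightarrow>
    (\<exists>(v' :: real^'d \<Rightarrow> real^'k) (w' :: real^'d \<Rightarrow> real^'d).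
      C1_holder \<alpha> v' \<and> C1_holder \<alpha> w' \<and>
      norm1 (closure \<omega>) (\<lambda>x. v' x - v x) \<le>
        C * (1 + norm0 (nbhd \<omega> (2*l0)) (grad v))\<^sup>2
          * norm0 (nbhd \<omega> (2*l0)) (defect A v w) powr (1/4) \<and>
      norm1 (closure \<omega>) (\<lambda>x. w' x - w x) \<le>
        C * (1 + norm0 (nbhd \<omega> (2*l0)) (grad v)) ^ 3
          * norm0 (nbhd \<omega> (2*l0)) (defect A v w) powr (1/4) \<and>
      (\<forall>x\<in>closure \<omega>. defect A v' w' x = 0))"
proof -
  let ?T = "nbhd \<omega> (2*l0)"
  have \<omega>: "bounded \<omega>" "\<omega> \<noteq> {}" using assms(1) by (auto simp: smooth_bounded_domain_def)
  have ne: "nbhd \<omega> a \<noteq> {}" if "0 \<le> a" for a using closure_subset_nbhd[OF that, of \<omega>] \<omega>(2) by auto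
  have T: "compact ?T" "?T \<noteq> {}" using compact_nbhd[OF \<omega>(1)] ne assms(2) by auto
  obtain C1 where C1: "0 \<le> C1" and init: "\<forall>\<beta> A (v :: real^'d \<Rightarrow> real^'k) w.
    0 < \<beta> \<and> \<beta> < 2 \<and> C0_holder_sym \<beta> A \<and> C_class 2 v \<and> C_class 2 w \<and>
    0 < norm0 ?T (defect A v w) \<and> norm0 ?T (defect A v w) \<le> 1 \<longrightarrow>
    (\<exists>s K q vs ws. approximating_family ?T A v w C1 s K q vs ws)"
    using initial_stage[OF T] by blast
  show ?thesis
  \<comment> \<open>\<open>C1\<close> comes from the first stage and the 1 from the whole iteration;
    the factor 2 adds values and gradients in \<open>norm1\<close>.\<close>
  proof (rule exI[of _ "2 * (C1 + 1)"], intro conjI allI impI; (elim conjE)?)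
    show "0 < 2 * (C1 + 1)" using C1 by simp
    fix \<beta> and v :: "real^'d \<Rightarrow> real^'k" and w :: "real^'d \<Rightarrow> real^'d"
    assume \<beta>: "0 < \<beta>" "\<beta> < 2" and v: "C_class 2 v" and w: "C_class 2 w" and A: "C0_holder_sym \<beta> A"
      and D: "0 < norm0 ?T (defect A v w)" "norm0 ?T (defect A v w) \<le> 1"
      and \<alpha>: "0 < \<alpha>" "\<alpha> < min (\<beta>/2) (S / (S + 2*J))"
    define \<tau> where "\<tau> = norm0 ?T (defect A v w)"
    define t where "t = sqrt \<tau>"
    define G where "G = norm0 ?T (grad v)"
    \<comment> \<open>As \<tau> is at most 1, its square root is at most the power
      \<open>1/4\<close> of the statement.\<close>
    have t: "0 < t" "t \<le> 1" "t \<le> \<tau> powr (1/4)"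
    proof -
      show "0 < t" "t \<le> 1" using D by (simp_all add: t_def \<tau>_def)
      have "t = \<tau> powr (1/2)" using D by (simp add: t_def powr_half_sqrt \<tau>_def)
      also have "\<dots> \<le> \<tau> powr (1/4)" using D by (intro powr_mono') (auto simp: \<tau>_def)
      finally show "t \<le> \<tau> powr (1/4)" .
    qed
    have G: "0 \<le> G" unfolding G_def by (intro norm0_nonneg T C_class_2D v)
    obtain s K q and vs :: "nat \<Rightarrow> real^'d \<Rightarrow> real^'k" and ws :: "nat \<Rightarrow> real^'d \<Rightarrow> real^'d"
      where "approximating_family ?T A v w C1 s K q vs ws"
      using init[rule_format, of \<beta> A v w] \<beta> A v w D by blast
    note af = this[unfolded approximating_family_def, folded \<tau>_def, folded t_def G_def]
    have s: "0 < s" and K: "0 \<le> K" using af[THEN conjunct1] af[THEN conjunct2, THEN conjunct1] .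
    note vw = af[THEN conjunct2, THEN conjunct2]
    obtain B where B: "0 \<le> B" "\<And>l. 0 \<le> l \<Longrightarrow> l \<le> l0 \<Longrightarrow> norm0_holder \<beta> (nbhd \<omega> (2 * l)) A \<le> B"
      using norm0_holder_bounded[OF \<omega>, of \<beta> A l0] A \<beta> unfolding C0_holder_sym_def by blast
    then have B2: "\<forall>l. 0 \<le> l \<and> l \<le> l0 \<longrightarrow> norm0_holder \<beta> (nbhd \<omega> (2 * l)) A \<le> B" by blast
    have \<alpha>': "\<alpha> < \<beta> / 2" "\<alpha> < S / (S + 2 * J)" "0 < S" "0 < J" using \<alpha> assms(4,5) by simp_all
    \<comment> \<open>\<open>M\<close> will be \<open>y powr (q + 1)\<close> and the initial defect
      at most \<open>y powr (- s / 2)\<close>. This ceiling for \<open>\<rho>0\<close> is the one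
      for which the latter is at most \<open>M powr (- 2 * \<rho>0)\<close>.\<close>
    have "0 < s / (4 * (real q + 1))" using s by simp
    then obtain r \<rho>0 p b \<theta> \<kappa> where par: "0 < \<rho>0" "\<rho>0 \<le> s / (4 * (real q + 1))" "\<rho>0 \<le> r" "0 < p" "1 < b" "0 < \<theta>" "0 < \<kappa>"
      "1 + p * J + 2 * \<theta> \<le> b"
      "\<And>\<rho>. 0 \<le> \<rho> \<Longrightarrow> \<rho> \<le> r \<Longrightarrow> 2 * min r (\<rho> + \<kappa>) * b \<le> 2 * \<rho> + p * S - 2 * \<theta>"
      "\<And>\<rho>. 0 \<le> \<rho> \<Longrightarrow> \<rho> \<le> r \<Longrightarrow> 2 * min r (\<rho> + \<kappa>) * b \<le> \<beta> * (1 + \<rho>) - \<theta>"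
      "\<alpha> * b + 2 * \<theta> < r * (1 - \<alpha>)" "4 * \<theta> \<le> \<rho>0"
      by (rule iteration_parameters[OF \<alpha>(1) \<alpha>'(1,2) \<alpha>'(3,4) \<beta>(2)]) (rule that; blast)
    have rp: "0 < 1 + r + p" using par by simp
    \<comment> \<open>Adapted to the largest ratio \<open>r\<close>, so that the loss is at most
      \<open>M powr \<theta>\<close> in every step; (Stage) then supplies \<open>C0\<close> for this
      \<gamma>.\<close>
    define \<gamma> where "\<gamma> = min (1/2) (\<theta> / (1 + r + p))"
    have \<gamma>: "0 < \<gamma>" "\<gamma> < 1" "\<gamma> * (1 + r + p) \<le> \<theta>"
    proof -
      show "0 < \<gamma>" "\<gamma> < 1" using par rp by (auto simp: \<gamma>_def)
      have "\<gamma> \<le> \<theta> / (1 + r + p)" by (simp add: \<gamma>_def)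
      then show "\<gamma> * (1 + r + p) \<le> \<theta>" using rp by (simp add: pos_le_divide_eq)
    qed
    obtain C0 where C0: "0 < C0" and stage: "stage_with TYPE('k) \<omega> l0 S J \<gamma> C0"
    proof -
      have "0 < \<gamma> \<and> \<gamma> < 1" using \<gamma> by simp
      from assms(6)[unfolded stage_def, THEN spec, THEN mp, OF this] show thesis
        by (elim exE conjE) (rule that, assumption, unfold stage_with_def, assumption)
    qed
    define G' where "G' = G + C1 * t + K"
    define Q where "Q = 4 * (1 + C0) * (4 + G') * (1 + B)"
    \<comment> \<open>What remains is finitely many lower bounds on positive powers of
      \<open>n + 1\<close>, so a single \<open>n\<close> meets them all. The last two make the
      displacement of the iteration and the remainder of the first stage at most
      \<open>t / 2\<close> each.\<close>
    have b1: "0 < b - 1" "0 < \<rho>0 / 2" "0 < \<rho>0 / 2 * (b - 1)" "0 < s / 2" using par s by simp_all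
    have "\<forall>\<^sub>F n in sequentially. K \<le> real (n + 1) powr 1 \<and> 1 / l0 + 1 \<le> real (n + 1) powr 1 \<and>
        K \<le> real (n + 1) powr (s / 2) \<and> 2 \<le> real (n + 1) powr (b - 1) \<and> Q \<le> real (n + 1) powr \<theta> \<and>
        2 \<le> real (n + 1) powr (\<rho>0 / 2 * (b - 1)) \<and> 2 \<le> real (n + 1) powr (\<rho>0 / 2) \<and>
        2 * K / t \<le> real (n + 1) powr s \<and> 4 / t \<le> real (n + 1) powr (\<rho>0 / 2)"
      by (intro eventually_conj eventually_le_powr b1 s par) auto
    then obtain n where "K \<le> real (n + 1) powr 1 \<and> 1 / l0 + 1 \<le> real (n + 1) powr 1 \<and>
        K \<le> real (n + 1) powr (s / 2) \<and> 2 \<le> real (n + 1) powr (b - 1) \<and> Q \<le> real (n + 1) powr \<theta> \<and>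
        2 \<le> real (n + 1) powr (\<rho>0 / 2 * (b - 1)) \<and> 2 \<le> real (n + 1) powr (\<rho>0 / 2) \<and>
        2 * K / t \<le> real (n + 1) powr s \<and> 4 / t \<le> real (n + 1) powr (\<rho>0 / 2)"
      by (rule eventually_happens'[OF sequentially_bot, THEN exE])
    moreover define y where "y = real (n + 1)"
    ultimately have n: "K \<le> y" "1 / l0 + 1 \<le> y" "K \<le> y powr (s / 2)" "2 \<le> y powr (b - 1)" "Q \<le> y powr \<theta>"
      "2 \<le> y powr (\<rho>0 / 2 * (b - 1))" "2 \<le> y powr (\<rho>0 / 2)" "2 * K / t \<le> y powr s" "4 / t \<le> y powr (\<rho>0 / 2)"
      by auto
    have y: "0 < y" "1 \<le> y" by (simp_all add: y_def)
    \<comment> \<open>One power more than the growth \<open>q\<close> of the second derivatives, so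
      that \<open>K\<close> is absorbed by the extra factor \<open>y\<close>.\<close>
    define M where "M = y powr (real q + 1)"
    have yM: "y \<le> M"
      using powr_mono[of 1 "real q + 1" y] y by (simp add: M_def)
    have yMp: "y powr a \<le> M powr a" if "0 \<le> a" for a using yM y that by (intro powr_mono2) auto
    have l0': "0 < 1 / l0" using assms(2) by simp
    have M1: "1 < M" "1 / l0 < M" using yM n(2) l0' by linarith+
    have M2: "2 \<le> M powr (b - 1)" "4 * (1 + C0) * (4 + G') * (1 + B) \<le> M powr \<theta>"
      "2 \<le> M powr (\<rho>0 / 2 * (b - 1))" "2 \<le> M powr (\<rho>0 / 2)"
      using order_trans[OF n(4) yMp] order_trans[OF n(5) yMp] order_trans[OF n(6) yMp] order_trans[OF n(7) yMp] b1 par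
      by (simp_all add: Q_def)
    define l where "l = M powr (- 1 - \<rho>0)"
    have l: "0 < l" "l \<le> l0"
    proof -
      show "0 < l" using M1 by (simp add: l_def)
      have "l \<le> M powr (- 1)" unfolding l_def using M1 par by (intro powr_mono) auto
      also have "\<dots> = 1 / M" using M1 powr_minus_divide[of M 1] by simp
      also have "\<dots> \<le> l0" using M1 assms(2) by (simp add: field_simps)
      finally show "l \<le> l0" .
    qed
    have sub: "nbhd \<omega> (2 * l) \<subseteq> ?T" "nbhd \<omega> (2 * l) \<noteq> {}"
      using l by (auto intro!: nbhd_mono ne)
    note vwn = vw[THEN spec, of n, folded y_def]
    have C2: "C_class 2 (vs n)" "C_class 2 (ws n)" using vwn by blast+
    have contA: "continuous_on Y A" for Y
      using A \<beta> C0_holder_continuous continuous_on_subset unfolding C0_holder_sym_def by blast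
    have Ky: "K * y ^ q \<le> M"
    proof -
      have "K * y ^ q \<le> y * y ^ q" using n(1) y by (intro mult_right_mono) auto
      also have "\<dots> = M" using y by (simp add: M_def powr_add powr_realpow)
      finally show ?thesis .
    qed
    have S1: "norm2 (nbhd \<omega> (2 * l)) (vs n) \<le> M" "norm2 (nbhd \<omega> (2 * l)) (ws n) \<le> M"
      using norm2_mono[OF sub T(1) C2(1)] norm2_mono[OF sub T(1) C2(2)] vwn Ky by linarith+
    have ys: "y powr (- s) \<le> 1" using powr_mono[of "- s" 0 y] y s by simp
    have S2: "norm0 (nbhd \<omega> (2 * l)) (grad (vs n)) \<le> G'"
    proof (rule norm0_le[OF sub(2)])
      fix x assume "x \<in> nbhd \<omega> (2 * l)"
      then have x: "x \<in> ?T" using sub by blast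
      have "norm (grad (vs n) x - grad v x) \<le> C1 * t + K * y powr (- s)" using vwn x by blast
      moreover have "K * y powr (- s) \<le> K" using mult_left_mono[OF ys K] by simp
      moreover have "norm (grad v x) \<le> G" unfolding G_def by (rule norm0_ge[OF T(1) C_class_2D(4)[OF v] x])
      ultimately show "norm (grad (vs n) x) \<le> G'"
        using norm_triangle_sub[of "grad (vs n) x" "grad v x"] unfolding G'_def by linarith
    qed
    have S3: "norm0 (nbhd \<omega> (2 * l)) (defect A (vs n) (ws n)) \<le> M powr (- 2 * \<rho>0)"
    proof -
      have "norm0 (nbhd \<omega> (2 * l)) (defect A (vs n) (ws n)) \<le> norm0 ?T (defect A (vs n) (ws n))"
        by (intro norm0_mono sub T continuous_on_defect contA C2)
      also have "\<dots> \<le> K * y powr (- s)" using vwn by blast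
      also have "\<dots> \<le> y powr (s / 2) * y powr (- s)" using n(3) by (intro mult_right_mono) auto
      also have "\<dots> = y powr (- (s / 2))" by (simp flip: powr_add)
      also have "\<dots> \<le> y powr ((real q + 1) * (- 2 * \<rho>0))"
      proof (rule powr_mono)
        have "\<rho>0 * (4 * (real q + 1)) \<le> s" using par(2) by (simp add: pos_le_divide_eq)
        then show "- (s / 2) \<le> (real q + 1) * (- 2 * \<rho>0)" by (simp add: algebra_simps)
      qed (rule y)
      also have "\<dots> = M powr (- 2 * \<rho>0)" by (simp add: M_def powr_powr)
      finally show ?thesis .
    qed
    have \<alpha>1: "\<alpha> \<le> 1" using \<alpha> \<beta> by simp
    have J0: "0 < J" using assms(5) by simp
    obtain F :: "real^'d \<Rightarrow> real^'k" and H :: "real^'d \<Rightarrow> real^'d" where FH: "C1_holder \<alpha> F" "C1_holder \<alpha> H"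
      "\<forall>x\<in>closure \<omega>. norm (F x - vs n x) \<le> 2 * M powr (- \<rho>0 / 2) \<and> norm (grad F x - grad (vs n) x) \<le> 2 * M powr (- \<rho>0 / 2) \<and>
      norm (H x - ws n x) \<le> 2 * M powr (- \<rho>0 / 2) \<and> norm (grad H x - grad (ws n) x) \<le> 2 * M powr (- \<rho>0 / 2) \<and>
      defect A F H x = 0"
      using iteration[OF assms(1) C0 stage A \<beta> B(1) B2 \<alpha>(1) \<alpha>1 par(1,3,4,5,6,7) \<gamma>(1,3) J0 par(8-12) M1 assms(2) M2
          C2(1) S1(1)[unfolded l_def] S2[unfolded l_def] C2(2) S1(2)[unfolded l_def] S3[unfolded l_def]]
      by blast
    have small: "2 * M powr (- \<rho>0 / 2) + K * y powr (- s) \<le> t"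
    proof -
      have "4 \<le> y powr (\<rho>0 / 2) * t" using n(9) t(1) by (simp add: pos_divide_le_eq)
      also have "\<dots> \<le> M powr (\<rho>0 / 2) * t" using yMp[of "\<rho>0 / 2"] par t by (intro mult_right_mono) auto
      finally have "4 * M powr (- (\<rho>0 / 2)) \<le> M powr (\<rho>0 / 2) * t * M powr (- (\<rho>0 / 2))" by (rule mult_right_mono) simp
      also have "\<dots> = t * (M powr (\<rho>0 / 2) * M powr (- (\<rho>0 / 2)))" by simp
      also have "M powr (\<rho>0 / 2) * M powr (- (\<rho>0 / 2)) = 1" using M1 by (simp flip: powr_add)
      finally have 1: "4 * M powr (- (\<rho>0 / 2)) \<le> t" by simp
      have "2 * K \<le> y powr s * t" using n(8) t(1) by (simp add: pos_divide_le_eq)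
      then have "2 * K * y powr (- s) \<le> y powr s * t * y powr (- s)" by (rule mult_right_mono) simp
      also have "\<dots> = t * (y powr s * y powr (- s))" by simp
      also have "y powr s * y powr (- s) = 1" using y by (simp flip: powr_add)
      finally have "2 * (K * y powr (- s)) \<le> t" by simp
      with 1 show ?thesis by simp
    qed
    have clo: "closure \<omega> \<subseteq> ?T" using assms(2) by (intro closure_subset_nbhd) simp
    have dF: "F differentiable (at x)" "H differentiable (at x)" for x
      using FH(1,2) by (simp_all add: C1_holder_def)
    have tri: "norm (a - c) \<le> E + t" if "norm (a - b) \<le> 2 * M powr (- \<rho>0 / 2)" "norm (b - c) \<le> E + K * y powr (- s)"
      for a b c :: "'z::real_normed_vector" and E
      using that small norm_triangle_ineq[of "a - b" "b - c"] by simp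
    have est: "norm (F x - v x) \<le> (C1 + 1) * t" "norm (grad (\<lambda>x. F x - v x) x) \<le> (C1 + 1) * t"
      "norm (H x - w x) \<le> (C1 + 1) * t * (1 + G)" "norm (grad (\<lambda>x. H x - w x) x) \<le> (C1 + 1) * t * (1 + G)"
      if x: "x \<in> closure \<omega>" for x
    proof -
      have xT: "x \<in> ?T" using x clo by blast
      have e: "C1 * t + t = (C1 + 1) * t" "C1 * t * (1 + G) + t \<le> (C1 + 1) * t * (1 + G)"
        using G t by (simp_all add: algebra_simps)
      have g: "grad (\<lambda>x. F x - v x) x = grad F x - grad v x" "grad (\<lambda>x. H x - w x) x = grad H x - grad w x"
        by (rule grad_diff dF C_class_2D(1)[OF v] C_class_2D(1)[OF w])+
      have f: "norm (F x - vs n x) \<le> 2 * M powr (- \<rho>0 / 2)" "norm (grad F x - grad (vs n) x) \<le> 2 * M powr (- \<rho>0 / 2)"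
        "norm (H x - ws n x) \<le> 2 * M powr (- \<rho>0 / 2)" "norm (grad H x - grad (ws n) x) \<le> 2 * M powr (- \<rho>0 / 2)"
        using FH(3) x by blast+
      have h: "norm (vs n x - v x) \<le> C1 * t + K * y powr (- s)" "norm (grad (vs n) x - grad v x) \<le> C1 * t + K * y powr (- s)"
        "norm (ws n x - w x) \<le> C1 * t * (1 + G) + K * y powr (- s)"
        "norm (grad (ws n) x - grad w x) \<le> C1 * t * (1 + G) + K * y powr (- s)"
        using vwn xT by blast+
      show "norm (F x - v x) \<le> (C1 + 1) * t" using tri[OF f(1) h(1)] unfolding e(1) .
      show "norm (grad (\<lambda>x. F x - v x) x) \<le> (C1 + 1) * t" using tri[OF f(2) h(2)] unfolding e(1) g .
      show "norm (H x - w x) \<le> (C1 + 1) * t * (1 + G)" by (rule order_trans[OF tri[OF f(3) h(3)] e(2)])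
      show "norm (grad (\<lambda>x. H x - w x) x) \<le> (C1 + 1) * t * (1 + G)"
        unfolding g by (rule order_trans[OF tri[OF f(4) h(4)] e(2)])
    qed
    have ne': "closure \<omega> \<noteq> {}" using \<omega>(2) by simp
    have fin: "norm1 (closure \<omega>) (\<lambda>x. F x - v x) \<le> 2 * (C1 + 1) * (1 + G)\<^sup>2 * \<tau> powr (1/4)"
      "norm1 (closure \<omega>) (\<lambda>x. H x - w x) \<le> 2 * (C1 + 1) * (1 + G) ^ 3 * \<tau> powr (1/4)"
    proof -
      have "norm1 (closure \<omega>) (\<lambda>x. F x - v x) \<le> (C1 + 1) * t + (C1 + 1) * t"
        by (rule norm1_le[OF ne' est(1,2)])
      also have "\<dots> = 2 * (C1 + 1) * 1 * t" by simp
      also have "\<dots> \<le> 2 * (C1 + 1) * (1 + G)\<^sup>2 * \<tau> powr (1/4)"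
        using C1 G t by (intro mult_mono) (auto intro: one_le_power)
      finally show "norm1 (closure \<omega>) (\<lambda>x. F x - v x) \<le> 2 * (C1 + 1) * (1 + G)\<^sup>2 * \<tau> powr (1/4)" .
      have "norm1 (closure \<omega>) (\<lambda>x. H x - w x) \<le> (C1 + 1) * t * (1 + G) + (C1 + 1) * t * (1 + G)"
        by (rule norm1_le[OF ne' est(3,4)])
      also have "\<dots> = 2 * (C1 + 1) * (1 + G) ^ 1 * t" by (simp add: algebra_simps)
      also have "\<dots> \<le> 2 * (C1 + 1) * (1 + G) ^ 3 * \<tau> powr (1/4)"
        using C1 G t by (intro mult_mono power_increasing) auto
      finally show "norm1 (closure \<omega>) (\<lambda>x. H x - w x) \<le> 2 * (C1 + 1) * (1 + G) ^ 3 * \<tau> powr (1/4)" .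
    qed
    show "\<exists>(v' :: real^'d \<Rightarrow> real^'k) (w' :: real^'d \<Rightarrow> real^'d).
      C1_holder \<alpha> v' \<and> C1_holder \<alpha> w' \<and>
      norm1 (closure \<omega>) (\<lambda>x. v' x - v x) \<le> 2 * (C1 + 1) * (1 + norm0 ?T (grad v))\<^sup>2 * norm0 ?T (defect A v w) powr (1/4) \<and>
      norm1 (closure \<omega>) (\<lambda>x. w' x - w x) \<le> 2 * (C1 + 1) * (1 + norm0 ?T (grad v)) ^ 3 * norm0 ?T (defect A v w) powr (1/4) \<and>
      (\<forall>x\<in>closure \<omega>. defect A v' w' x = 0)"
      using FH fin unfolding G_def \<tau>_def by blast
  qed
qed

end
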